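(* Let $E\subset\mathbb{R}^d$ be a Lebesgue measurable set with $E=-E$ and Lebesgue measure $|E|=1$, let $K(x)=\int_E e^{2\pi\mathrm{i}\,x\cdot\xi}\,\mathrm{d}\xi$, and let $\mathsf{K}$ be the determinantal point process on $\mathbb{R}^d$ with correlation functions $\rho^{(n)}(x_1,\dots,x_n)=\det[K(x_i-x_j)]_{i,j=1}^n$, $n\in\mathbb{N}$. For $\ell>0$ let $\Lambda=B_\ell(0)$, and for a function $v:\mathbb{R}^d\to\mathbb{R}$ let $V_\Lambda(\gamma)=\sum_{x_1\neq x_2\in\gamma}1_\Lambda(x_1)1_\Lambda(x_2)\,v(x_1-x_2)$. Then, for every even function $v\in L^1(\mathbb{R}^d)\cap L^2(\mathbb{R}^d)\setminus\{0\}$, the following limit (with respect to $\mathsf{K}$) satisfies $$\lim_{\ell\to\infty}\frac{1}{|\Lambda|}\,\mathbb{V}\mathrm{ar}\bigl[V_\Lambda\bigr]>0.$$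
   Context: $|\cdot|$ denotes Lebesgue measure and $B_\ell(0)\subset\mathbb{R}^d$ the ball of radius $\ell$ around the origin. $\Gamma$ is the set of locally finite subsets $\gamma\subset\mathbb{R}^d$ with the $\sigma$-algebra generated by the counting maps $\gamma\mapsto\#(\gamma\cap\triangle)$, $\triangle$ bounded (Borel); a point process is a probability measure on $\Gamma$. Its correlation functions $\rho^{(n)}\ge0$ are defined by $\mathbb{E}\bigl[\sum_{x_1\neq\dots\neq x_n\in\gamma}G(x_1,\dots,x_n)\bigr]=\int_{(\mathbb{R}^d)^n}G\,\rho^{(n)}\,\mathrm{d}x_1\cdots\mathrm{d}x_n$ for all measurable $G\ge0$ (sum over $n$-tuples of pairwise distinct points; the sum in $V_\Lambda$ is over ordered pairs of distinct points). It is known that the given determinantal correlation functions determine a unique (stationary) point process. *)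

theory Defs
  imports "HOL-Probability.Probability" "Jordan_Normal_Form.Determinant"
begin

definition configurations :: "'a::euclidean_space set set" where
  "configurations = {\<gamma>. \<forall>B. bounded B \<longrightarrow> finite (\<gamma> \<inter> B)}"

text \<open>The sigma-algebra generated by the counting maps. On configurations, \<open>card (\<gamma> \<inter> D)\<close>
  is the cardinality of a finite set.\<close>

definition configuration_space :: "'a::euclidean_space set measure" where
  "configuration_space = sigma configurations
     {(\<lambda>\<gamma>. card (\<gamma> \<inter> D)) -` A \<inter> configurations | D (A :: nat set). D \<in> sets borel \<and> bounded D}"

definition point_process :: "'a::euclidean_space set measure \<Rightarrow> bool" where
  "point_process M \<longleftrightarrow> prob_space M \<and> sets M = sets configuration_space"

text \<open>An \<open>n\<close>-tuple of points is an extensional function on \<open>{..<n}\<close>, so that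
  \<open>PiM {..<n} (\<lambda>_. lborel)\<close> is Lebesgue measure on \<open>n\<close>-tuples.\<close>

definition distinct_tuples :: "nat \<Rightarrow> 'a set \<Rightarrow> (nat \<Rightarrow> 'a) set" where
  "distinct_tuples n \<gamma> = {x \<in> {..<n} \<rightarrow>\<^sub>E \<gamma>. inj_on x {..<n}}"

definition has_correlation_functions ::
    "'a::euclidean_space set measure \<Rightarrow> (nat \<Rightarrow> (nat \<Rightarrow> 'a) \<Rightarrow> real) \<Rightarrow> bool" where
  "has_correlation_functions M \<rho> \<longleftrightarrow>
     (\<forall>n\<ge>1. \<rho> n \<in> borel_measurable (PiM {..<n} (\<lambda>_. lborel)) \<and> (\<forall>x. 0 \<le> \<rho> n x) \<and>
       (\<forall>G :: (nat \<Rightarrow> 'a) \<Rightarrow> ennreal. G \<in> borel_measurable (PiM {..<n} (\<lambda>_. lborel)) \<longrightarrow>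
         (\<integral>\<^sup>+\<gamma>. (\<integral>\<^sup>+x. G x \<partial>count_space (distinct_tuples n \<gamma>)) \<partial>M) =
         (\<integral>\<^sup>+x. G x * ennreal (\<rho> n x) \<partial>PiM {..<n} (\<lambda>_. lborel))))"

text \<open>The equation over the complex numbers includes that the determinants are real.\<close>

definition determinantal_point_process ::
    "('a::euclidean_space \<Rightarrow> 'a \<Rightarrow> complex) \<Rightarrow> 'a set measure \<Rightarrow> bool" where
  "determinantal_point_process k M \<longleftrightarrow> point_process M \<and>
     (\<exists>\<rho>. has_correlation_functions M \<rho> \<and>
       (\<forall>n\<ge>1. \<forall>x. complex_of_real (\<rho> n x) =
          Determinant.det (Matrix.mat n n (\<lambda>(i, j). k (x i) (x j)))))"

definition fourier_kernel :: "'a::euclidean_space set \<Rightarrow> 'a \<Rightarrow> complex" where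
  "fourier_kernel E x = (LINT \<xi>:E|lebesgue. exp (2 * of_real pi * \<i> * of_real (x \<bullet> \<xi>)))"

text \<open>For bounded \<open>L\<close> and a configuration \<open>\<gamma>\<close> only finitely many summands are nonzero.\<close>

definition pair_energy :: "('a::euclidean_space \<Rightarrow> real) \<Rightarrow> 'a set \<Rightarrow> 'a set \<Rightarrow> real" where
  "pair_energy v L \<gamma> =
     (\<Sum>\<^sub>\<infinity>(x, y)\<in>{(x, y). x \<in> \<gamma> \<and> y \<in> \<gamma> \<and> x \<noteq> y}. indicator L x * indicator L y * v (x - y))"

text \<open>For a merely Lebesgue measurable \<open>v\<close>, \<open>pair_energy v L\<close> need not be measurable with respect
  to the point process \<open>M\<close> itself, but only with respect to its completion; on the functions
  measurable for \<open>M\<close> the two integrals agree.\<close>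

definition energy_variance ::
    "'a::euclidean_space set measure \<Rightarrow> ('a \<Rightarrow> real) \<Rightarrow> 'a set \<Rightarrow> real" where
  "energy_variance M v L = prob_space.variance (completion M) (pair_energy v L)"

end

theory Submission
  imports Defs
begin

text \<open>Expanding the second moment of the pair energy by the number of common points of two pairs and
  integrating against the determinantal correlation functions, the permutations that do not mix two disjoint
  pairs cancel against the squared mean. In every other permutation two factors \<open>K\<close> link the pairs, so
  \<open>K \<in> L\<^sup>2\<close> makes its contribution of order \<open>\<bar>\<Lambda>\<bar>\<close>, and dominated convergence gives a limit \<open>\<sigma>\<^sup>2\<close> that
  is an absolutely convergent integral of products of \<open>v\<close> and \<open>K\<close>.

  The determinantal process is a gas of free fermions whose momenta fill \<open>E\<close>. By Parseval's identity,
  with \<open>v^\<close> the Fourier transform of \<open>v\<close>, \<open>\<sigma>\<^sup>2\<close> is the total weight of the excitations of two particles with momenta \<open>p, s \<in> E\<close> to \<open>p + k, s - k \<notin> E\<close>: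
  \<open>\<sigma>\<^sup>2 = \<integral>\<^bsub>E \<times> E\<^esub> \<integral> \<bar>v^(k) - v^(k + p - s)\<bar>\<^sup>2 1[p + k \<notin> E] 1[s - k \<notin> E] dk d(p, s)\<close>.
  If it vanished, then \<open>v^(k) = v^(k + w)\<close> whenever the set of \<open>p\<close> with \<open>p, p - w \<in> E\<close> and
  \<open>p + k, p - w - k \<notin> E\<close> has positive measure. For \<open>k \<noteq> 0\<close> this is the case for some \<open>w = n k\<close> with a natural
  number \<open>n\<close>, and then also for \<open>w = (n + \<epsilon>) k\<close>. Hence no \<open>k \<noteq> 0\<close> has maximal norm in the level set of a
  nonzero value of \<open>v^\<close>, although this level set is compact by the Riemann-Lebesgue lemma.\<close>

no_notation Matrix.scalar_prod (infix "\<bullet>" 70)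

section \<open>Translations and the Fourier transform\<close>

text \<open>In position space the terms of the limit have mixed signs, so its positivity cannot be
  read off there; in momentum space it is an integral of squares. The four terms obtained by
  expanding the two conditions \<open>\<notin> E\<close> correspond to the groups of terms in
  position space. As \<open>E\<close> has finite measure but no regularity, \<open>K\<close> need
  not be integrable: every estimate rests on \<open>\<bar>K\<bar> \<le> 1\<close>, on the square
  integrability of \<open>K\<close>, and on the fact that \<open>K\<close> convolved with itself is
  \<open>K\<close>. The number n comes from the runs that \<open>E\<close> forms on the lines p +
  \<int> k. A run with an upper end almost surely has a lower end too, since otherwise its
  translates would fill infinite measure inside \<open>E\<close>, and n counts the steps between the
  two ends. For n = 0 the equation for w = n k is empty. This forces the passage to (n + \<epsilon>)
  k, which is allowed because translations are continuous in L1, and which makes k + w strictly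
  longer than k. The point k = 0 is excluded since p and p + 0 cannot be inside and outside
  \<open>E\<close> at once.\<close>

definition ee :: "real \<Rightarrow> complex" where
  "ee t = cis (2 * pi * t)"

lemma norm_ee [simp]: "norm (ee t) = 1"
  by (simp add: ee_def)

lemma ee_0 [simp]: "ee 0 = 1"
  by (simp add: ee_def)

lemma ee_add: "ee (s + t) = ee s * ee t"
  by (simp add: ee_def cis_mult distrib_left)

lemma cnj_ee: "cnj (ee t) = ee (- t)"
  by (simp add: ee_def cis_cnj)

lemma continuous_on_ee: "continuous_on UNIV ee"
  unfolding ee_def by (intro continuous_intros)

lemma measurable_ee [measurable]: "ee \<in> borel_measurable borel"
  by (rule borel_measurable_continuous_onI[OF continuous_on_ee])

lemma ee_exp: "exp (2 * of_real pi * \<i> * of_real t) = ee t"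
  by (simp add: ee_def cis_conv_exp mult_ac)

text \<open>The exponent carries the plus sign of \<open>fourier_kernel\<close>, which makes the
  kernel itself the transform of an indicator.\<close>

definition fourier :: "('a::euclidean_space \<Rightarrow> complex) \<Rightarrow> 'a \<Rightarrow> complex" where
  "fourier f x = (LINT y|lborel. ee (x \<bullet> y) * f y)"

lemma fourier_integrable:
  fixes f :: "'a::euclidean_space \<Rightarrow> complex"
  assumes "integrable lborel f"
  shows "integrable lborel (\<lambda>y. ee (x \<bullet> y) * f y)"
proof (rule Bochner_Integration.integrable_bound[OF assms])
  show "(\<lambda>y. ee (x \<bullet> y) * f y) \<in> borel_measurable lborel"
    using assms by measurable
qed (simp add: norm_mult)

lemma fourier_measurable [measurable]:
  fixes f :: "'a::euclidean_space \<Rightarrow> complex"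
  assumes [measurable]: "f \<in> borel_measurable borel"
  shows "fourier f \<in> borel_measurable borel"
  unfolding fourier_def by measurable

lemma norm_fourier_le:
  fixes f :: "'a::euclidean_space \<Rightarrow> complex"
  shows "norm (fourier f x) \<le> (LINT y|lborel. norm (f y))"
  unfolding fourier_def
  by (rule order_trans[OF integral_norm_bound]) (simp add: norm_mult)

lemma fourier_continuous:
  fixes f :: "'a::euclidean_space \<Rightarrow> complex"
  assumes f: "integrable lborel f"
  shows "continuous_on UNIV (fourier f)"
proof -
  have "isCont (fourier f) x" for x
    unfolding continuous_at_sequentially o_def
  proof safe
    fix X :: "nat \<Rightarrow> 'a"
    assume X: "X \<longlonglongrightarrow> x"
    show "(\<lambda>n. fourier f (X n)) \<longlonglongrightarrow> fourier f x"
      unfolding fourier_def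
    proof (rule integral_dominated_convergence[where w = "\<lambda>y. norm (f y)"])
      show "AE y in lborel. (\<lambda>n. ee (X n \<bullet> y) * f y) \<longlonglongrightarrow> ee (x \<bullet> y) * f y"
        using X continuous_on_ee
        by (intro AE_I2 tendsto_mult tendsto_const continuous_on_tendsto_compose[OF continuous_on_ee])
           (auto intro!: tendsto_inner)
    qed (use f in \<open>auto simp: norm_mult\<close>)
  qed
  then show ?thesis
    by (simp add: continuous_at_imp_continuous_on)
qed

section \<open>Lebesgue measure under translation, reflection and scaling\<close>

lemma integrable_lborel_shift:
  fixes f :: "'a::euclidean_space \<Rightarrow> 'b::{banach, second_countable_topology}"
  assumes "integrable lborel f"
  shows "integrable lborel (\<lambda>x. f (c + x))"
proof -
  have "integrable (distr lborel borel ((+) c)) f"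
    using assms by (simp add: lborel_distr_plus)
  then show ?thesis
    by (subst (asm) integrable_distr_eq) (use assms in auto)
qed

lemma integral_lborel_shift:
  fixes f :: "'a::euclidean_space \<Rightarrow> 'b::{banach, second_countable_topology}"
  assumes [measurable]: "f \<in> borel_measurable borel"
  shows "(LINT x|lborel. f (c + x)) = (LINT x|lborel. f x)"
proof -
  have "(LINT x|lborel. f x) = (LINT x|distr lborel borel ((+) c). f x)"
    by (simp add: lborel_distr_plus)
  also have "\<dots> = (LINT x|lborel. f (c + x))"
    by (rule integral_distr) auto
  finally show ?thesis ..
qed

lemma distr_lborel_uminus: "distr lborel borel uminus = (lborel :: 'a::euclidean_space measure)"
proof -
  have "(lborel :: 'a measure) =
      density (distr lborel borel (\<lambda>x. 0 + (-1) *\<^sub>R x)) (\<lambda>_. ennreal (\<bar>-1::real\<bar> ^ DIM('a)))"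
    by (rule lborel_affine[of "-1::real" 0]) simp
  moreover have "(\<lambda>x::'a. 0 + (-1) *\<^sub>R x) = uminus" by auto
  ultimately show ?thesis
    by (simp add: density_1)
qed

lemma integrable_lborel_reflect:
  fixes f :: "'a::euclidean_space \<Rightarrow> 'b::{banach, second_countable_topology}"
  assumes "integrable lborel f"
  shows "integrable lborel (\<lambda>x. f (c - x))"
proof -
  have "integrable (distr lborel borel uminus) (\<lambda>x. f (c + x))"
    using integrable_lborel_shift[OF assms, of c] by (simp add: distr_lborel_uminus)
  then show ?thesis
    by (subst (asm) integrable_distr_eq) (use assms in auto)
qed

lemma integral_lborel_reflect:
  fixes f :: "'a::euclidean_space \<Rightarrow> 'b::{banach, second_countable_topology}"
  assumes [measurable]: "f \<in> borel_measurable borel"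
  shows "(LINT x|lborel. f (c - x)) = (LINT x|lborel. f x)"
proof -
  have "(LINT x|lborel. f (c + x)) = (LINT x|distr lborel borel uminus. f (c + x))"
    by (simp add: distr_lborel_uminus)
  also have "\<dots> = (LINT x|lborel. f (c + (- x)))"
    by (rule integral_distr) auto
  finally show ?thesis by (simp add: integral_lborel_shift)
qed

lemma nn_integral_lborel_shift:
  fixes f :: "'a::euclidean_space \<Rightarrow> ennreal"
  assumes [measurable]: "f \<in> borel_measurable borel"
  shows "(\<integral>\<^sup>+x. f (c + x) \<partial>lborel) = (\<integral>\<^sup>+x. f x \<partial>lborel)"
proof -
  have "(\<integral>\<^sup>+x. f x \<partial>lborel) = (\<integral>\<^sup>+x. f x \<partial>distr lborel borel ((+) c))"
    by (simp add: lborel_distr_plus)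
  also have "\<dots> = (\<integral>\<^sup>+x. f (c + x) \<partial>lborel)"
    by (rule nn_integral_distr) auto
  finally show ?thesis ..
qed

lemma nn_integral_lborel_reflect:
  fixes f :: "'a::euclidean_space \<Rightarrow> ennreal"
  assumes [measurable]: "f \<in> borel_measurable borel"
  shows "(\<integral>\<^sup>+x. f (c - x) \<partial>lborel) = (\<integral>\<^sup>+x. f x \<partial>lborel)"
proof -
  have "(\<integral>\<^sup>+x. f (c + x) \<partial>lborel) = (\<integral>\<^sup>+x. f (c + x) \<partial>distr lborel borel uminus)"
    by (simp add: distr_lborel_uminus)
  also have "\<dots> = (\<integral>\<^sup>+x. f (c + (- x)) \<partial>lborel)"
    by (rule nn_integral_distr) auto
  finally show ?thesis by (simp add: nn_integral_lborel_shift)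
qed

lemma integral_lborel_scale:
  fixes f :: "'a::euclidean_space \<Rightarrow> 'b::{banach, second_countable_topology}"
  assumes [measurable]: "f \<in> borel_measurable borel" and c: "c > 0"
  shows "(LINT x|lborel. f x) = c ^ DIM('a) *\<^sub>R (LINT x|lborel. f (c *\<^sub>R x))"
proof -
  have "(LINT x|lborel. f x) = (LINT x|density (distr lborel borel (\<lambda>x. 0 + c *\<^sub>R x)) (\<lambda>_. \<bar>c\<bar> ^ DIM('a)). f x)"
    using c by (subst lborel_affine[of c 0]) auto
  also have "\<dots> = (LINT x|distr lborel borel (\<lambda>x. 0 + c *\<^sub>R x). c ^ DIM('a) *\<^sub>R f x)"
    using c by (subst integral_density) auto
  also have "\<dots> = (LINT x|lborel. c ^ DIM('a) *\<^sub>R f (c *\<^sub>R x))"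
    by (subst integral_distr) auto
  finally show ?thesis by simp
qed

lemma integrable_lborel_scale:
  fixes f :: "'a::euclidean_space \<Rightarrow> 'b::{banach, second_countable_topology}"
  assumes f: "integrable lborel f" and c: "c > 0"
  shows "integrable lborel (\<lambda>x. f (c *\<^sub>R x))"
proof -
  have [measurable]: "f \<in> borel_measurable borel" using f by auto
  have "integrable (density (distr lborel borel (\<lambda>x. 0 + c *\<^sub>R x)) (\<lambda>_. ennreal (\<bar>c\<bar> ^ DIM('a)))) f"
    using c f by (subst lborel_affine[of c 0, symmetric]) auto
  then have "integrable (distr lborel borel (\<lambda>x. 0 + c *\<^sub>R x)) (\<lambda>x. c ^ DIM('a) *\<^sub>R f x)"
    using c by (subst (asm) integrable_density) auto
  then have "integrable lborel (\<lambda>x. c ^ DIM('a) *\<^sub>R f (c *\<^sub>R x))"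
    by (subst (asm) integrable_distr_eq) auto
  from integrable_scaleR_right[OF this, of "inverse (c ^ DIM('a))"] show ?thesis using c by simp
qed

section \<open>Approximation by continuous functions and translations in L1\<close>

lemma indicator_approx_continuous:
  fixes A :: "'a::euclidean_space set"
  assumes A[measurable]: "A \<in> sets borel" and fin: "emeasure lborel A < \<infinity>" and e: "e > 0"
  shows "\<exists>g::'a \<Rightarrow> real. continuous_on UNIV g \<and> integrable lborel g \<and>
    (LINT x|lborel. norm (indicator A x - g x)) < e"
proof -
  obtain V where V: "open V" "- A \<subseteq> V" "emeasure lborel (V - (- A)) < ennreal (e/3)"
    using outer_regular_lborel[of "- A" "e/3"] A e by auto
  obtain U where U: "open U" "A \<subseteq> U" "emeasure lborel (U - A) < ennreal (e/3)"
    using outer_regular_lborel[of A "e/3"] A e by auto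
  \<comment> \<open>Outer regularity of the complement of \<open>A\<close> yields a closed set
    inside \<open>A\<close>; a Urysohn function between it and the complement of \<open>U\<close>
    differs from the indicator only on \<open>U - T\<close>.\<close>
  define T where "T = - V"
  have T: "closed T" "T \<subseteq> A" using V by (auto simp: T_def)
  have [measurable]: "T \<in> sets borel" "U \<in> sets borel"
    using T(1) U(1) by auto
  have "closed T" "closed (- U)" "T \<inter> - U = {}"
    using T U by (auto intro: compact_imp_closed)
  from Urysohn[OF this, of 1 "0::real"] obtain g :: "'a \<Rightarrow> real" where
    g: "continuous_on UNIV g" "\<And>x. g x \<in> closed_segment 1 0" "\<And>x. x \<in> T \<Longrightarrow> g x = 1" "\<And>x. x \<in> - U \<Longrightarrow> g x = 0"
    by blast
  have g01: "0 \<le> g x" "g x \<le> 1" for x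
    using g(2)[of x] by (auto simp: closed_segment_eq_real_ivl)
  have [measurable]: "g \<in> borel_measurable borel"
    using g(1) by (rule borel_measurable_continuous_onI)
  have UT: "emeasure lborel (U - T) < ennreal e"
  proof -
    have "emeasure lborel (U - T) \<le> emeasure lborel ((U - A) \<union> (V - (- A)))"
      using V U by (intro emeasure_mono) (auto simp: T_def)
    also have "\<dots> \<le> emeasure lborel (U - A) + emeasure lborel (V - (- A))"
      using V(1) by (intro emeasure_subadditive) auto
    also have "\<dots> \<le> ennreal (e/3) + ennreal (e/3)"
      using U(3) V(3) by (intro add_mono) auto
    also have "\<dots> = ennreal (e/3 + e/3)" using e by (subst ennreal_plus) auto
    also have "\<dots> < ennreal e" using e by (intro ennreal_lessI) auto
    finally show ?thesis .
  qed
  have "emeasure lborel U \<le> emeasure lborel (U - A) + emeasure lborel A"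
    using emeasure_subadditive[of "U - A" lborel A] U(2) by (simp add: Un_absorb2 Un_absorb1)
  also have "\<dots> < \<infinity>"
    using U(3) fin by (auto simp: ennreal_add_less_top intro: less_trans[OF _ ennreal_less_top])
  finally have iU: "integrable lborel (indicator U :: 'a \<Rightarrow> real)"
    by (auto intro!: integrable_real_indicator)
  have iUT: "integrable lborel (indicator (U - T) :: 'a \<Rightarrow> real)"
    using less_trans[OF UT ennreal_less_top] by (auto intro!: integrable_real_indicator)
  have ig: "integrable lborel g"
    by (rule Bochner_Integration.integrable_bound[OF iU]) (use g01 g(4) in \<open>auto simp: indicator_def\<close>)
  have "(LINT x|lborel. norm (indicator A x - g x)) \<le> (LINT x|lborel. indicator (U - T) x)"
  proof (rule integral_mono)
    show "integrable lborel (\<lambda>x. norm (indicator A x - g x))"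
      using ig fin by (auto intro!: integrable_real_indicator)
    show "integrable lborel (indicator (U - T) :: 'a \<Rightarrow> real)" by (rule iUT)
    fix x
    show "norm (indicator A x - g x) \<le> indicator (U - T) x"
      using g01[of x] g(3,4)[of x] T(2) U(2) by (auto simp: indicator_def)
  qed
  also have "\<dots> = measure lborel (U - T)"
    by simp
  also have "\<dots> < e" using UT e by (cases "emeasure lborel (U - T)") (auto simp: measure_def ennreal_less_iff)
  finally show ?thesis using g(1) ig by blast
qed

text \<open>The approximant has to be continuous and integrable, which is what Scheffe's lemma needs
  for its translates; the induction passes through indicators, sums and dominated limits.\<close>

lemma integrable_approx_continuous:
  fixes f :: "'a::euclidean_space \<Rightarrow> 'b::{banach, second_countable_topology}"
  assumes "integrable lborel f" and "e > 0"
  shows "\<exists>g. continuous_on UNIV g \<and> integrable lborel g \<and> (LINT x|lborel. norm (f x - g x)) < e"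
  using assms
proof (induction f arbitrary: e rule: integrable_induct)
  case (base A c)
  obtain g :: "'a \<Rightarrow> real" where g: "continuous_on UNIV g" "integrable lborel g"
    "(LINT x|lborel. norm (indicator A x - g x)) < e / (norm c + 1)"
    using indicator_approx_continuous[of A "e / (norm c + 1)"] base
    by (auto simp: add_nonneg_pos)
  have "(LINT x|lborel. norm (indicator A x *\<^sub>R c - g x *\<^sub>R c)) =
        (LINT x|lborel. norm (indicator A x - g x) * norm c)"
    by (intro Bochner_Integration.integral_cong) (auto simp flip: scaleR_diff_left)
  also have "\<dots> = (LINT x|lborel. norm (indicator A x - g x)) * norm c"
    by simp
  also have "\<dots> \<le> (LINT x|lborel. norm (indicator A x - g x)) * (norm c + 1)"
    by (intro mult_left_mono) auto
  also have "\<dots> < e"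
    using g(3) by (simp add: pos_less_divide_eq add_nonneg_pos)
  finally show ?case
    using g by (intro exI[of _ "\<lambda>x. g x *\<^sub>R c"]) (auto intro!: continuous_intros)
next
  case (add f f')
  obtain g g' where g: "continuous_on UNIV g" "integrable lborel g" "(LINT x|lborel. norm (f x - g x)) < e/2"
    and g': "continuous_on UNIV g'" "integrable lborel g'" "(LINT x|lborel. norm (f' x - g' x)) < e/2"
    using add.IH(1)[of "e/2"] add.IH(2)[of "e/2"] add.prems by auto
  have "(LINT x|lborel. norm (f x + f' x - (g x + g' x))) \<le> (LINT x|lborel. norm (f x - g x) + norm (f' x - g' x))"
    using add.hyps g g'
    by (intro integral_mono) (auto simp: add_diff_add intro: norm_triangle_ineq)
  also have "\<dots> < e" using g g' add.hyps by simp
  finally show ?case using g g'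
    by (intro exI[of _ "\<lambda>x. g x + g' x"]) (auto intro!: continuous_intros)
next
  case (lim f s)
  have "(\<lambda>n. LINT x|lborel. norm (f x - s n x)) \<longlonglongrightarrow> (LINT x|(lborel::'a measure). 0)"
  proof (rule integral_dominated_convergence[where w = "\<lambda>x. 3 * norm (f x)"])
    show "AE x in lborel. (\<lambda>n. norm (f x - s n x)) \<longlonglongrightarrow> 0"
    proof (rule AE_I2)
      fix x
      have "(\<lambda>n. norm (f x - s n x)) \<longlonglongrightarrow> norm (f x - f x)"
        using lim.hyps(2)[of x] by (intro tendsto_intros) auto
      then show "(\<lambda>n. norm (f x - s n x)) \<longlonglongrightarrow> 0" by simp
    qed
    show "AE x in lborel. norm (norm (f x - s n x)) \<le> 3 * norm (f x)" for n
    proof (rule AE_I2)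
      fix x
      show "norm (norm (f x - s n x)) \<le> 3 * norm (f x)"
        using norm_triangle_ineq4[of "f x" "s n x"] lim.hyps(3)[of x n] by auto
    qed
  qed (use lim.hyps in auto)
  then have "eventually (\<lambda>n. (LINT x|lborel. norm (f x - s n x)) < e/2) sequentially"
    using lim.prems by (intro order_tendstoD) auto
  then obtain n where n: "(LINT x|lborel. norm (f x - s n x)) < e/2"
    by (auto simp: eventually_sequentially)
  obtain g where g: "continuous_on UNIV g" "integrable lborel g" "(LINT x|lborel. norm (s n x - g x)) < e/2"
    using lim.IH[of "e/2" n] lim.prems by auto
  have "(LINT x|lborel. norm (f x - g x)) \<le> (LINT x|lborel. norm (f x - s n x) + norm (s n x - g x))"
    using lim.hyps g
    by (intro integral_mono) (auto intro: order_trans[OF _ norm_triangle_ineq])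
  also have "\<dots> < e" using g n lim.hyps by simp
  finally show ?case using g by blast
qed

text \<open>Translates of a continuous integrable function converge pointwise and keep their norm,
  so Scheffe's lemma gives convergence in L1. The approximation error is the same for every
  translate, hence three parts of size \<open>e/3\<close>.\<close>

lemma translation_continuous_L1:
  fixes f :: "'a::euclidean_space \<Rightarrow> 'b::{banach, second_countable_topology}"
  assumes f: "integrable lborel f" and X: "X \<longlonglongrightarrow> t"
  shows "(\<lambda>n. LINT x|lborel. norm (f (x - X n) - f (x - t))) \<longlonglongrightarrow> 0"
proof (rule LIMSEQ_I)
  fix e :: real assume e: "0 < e"
  obtain g where g: "continuous_on UNIV g" "integrable lborel g" "(LINT x|lborel. norm (f x - g x)) < e/3"
    using integrable_approx_continuous[OF f, of "e/3"] e by auto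
  have shift: "integrable lborel (\<lambda>x. h (x - s))" if "integrable lborel h" for h :: "'a \<Rightarrow> 'b" and s
    using integrable_lborel_shift[OF that, of "- s"] by (simp add: algebra_simps)
  have [measurable]: "f \<in> borel_measurable borel" "g \<in> borel_measurable borel"
    using f g by auto
  have eqs: "(LINT x|lborel. norm (f (x - s) - g (x - s))) = (LINT x|lborel. norm (f x - g x))" for s
    using integral_lborel_shift[of "\<lambda>x. norm (f x - g x)" "- s"] by (simp add: algebra_simps)
  have "(\<lambda>n. \<integral>\<^sup>+x. norm (g (x - X n) - g (x - t)) \<partial>lborel) \<longlonglongrightarrow> 0"
  proof (rule Scheffe_lemma2)
    show "integrable lborel (\<lambda>x. g (x - t))" using shift[OF g(2)] .
    show "AE x in lborel. (\<lambda>n. g (x - X n)) \<longlonglongrightarrow> g (x - t)"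
      using X by (intro AE_I2 continuous_on_tendsto_compose[OF g(1)] tendsto_intros) auto
    have eqn: "(\<integral>\<^sup>+ x. ennreal (norm (g (x - s))) \<partial>lborel) = (\<integral>\<^sup>+ x. ennreal (norm (g x)) \<partial>lborel)" for s
      using nn_integral_lborel_shift[of "\<lambda>x. ennreal (norm (g x))" "- s"] by (simp add: algebra_simps)
    show "(\<integral>\<^sup>+ x. ennreal (norm (g (x - X n))) \<partial>lborel) \<le> (\<integral>\<^sup>+ x. ennreal (norm (g (x - t))) \<partial>lborel)" for n
      by (simp add: eqn)
  qed auto
  then have "(\<lambda>n. ennreal (LINT x|lborel. norm (g (x - X n) - g (x - t)))) \<longlonglongrightarrow> ennreal 0"
    by (subst (asm) nn_integral_eq_integral) (use shift[OF g(2)] in auto)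
  then have "(\<lambda>n. LINT x|lborel. norm (g (x - X n) - g (x - t))) \<longlonglongrightarrow> 0"
    by (subst (asm) tendsto_ennreal_iff) (auto intro!: integral_nonneg_AE)
  then obtain N where N: "\<And>n. n \<ge> N \<Longrightarrow> (LINT x|lborel. norm (g (x - X n) - g (x - t))) < e/3"
    using order_tendstoD(2)[of _ 0 sequentially "e/3"] e by (fastforce simp: eventually_sequentially)
  show "\<exists>no. \<forall>n\<ge>no. norm ((LINT x|lborel. norm (f (x - X n) - f (x - t))) - 0) < e"
  proof (intro exI allI impI)
    fix n assume n: "N \<le> n"
    have "(LINT x|lborel. norm (f (x - X n) - f (x - t))) \<le>
      (LINT x|lborel. norm (f (x - X n) - g (x - X n)) + norm (g (x - X n) - g (x - t)) + norm (f (x - t) - g (x - t)))"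
    proof (rule integral_mono)
      fix x
      have "norm (f (x - X n) - f (x - t)) = norm ((f (x - X n) - g (x - X n)) + (g (x - X n) - g (x - t)) - (f (x - t) - g (x - t)))"
        by simp
      also have "\<dots> \<le> norm (f (x - X n) - g (x - X n)) + norm (g (x - X n) - g (x - t)) + norm (f (x - t) - g (x - t))"
        by (rule order_trans[OF norm_triangle_ineq4 add_right_mono[OF norm_triangle_ineq]])
      finally show "norm (f (x - X n) - f (x - t)) \<le> norm (f (x - X n) - g (x - X n)) + norm (g (x - X n) - g (x - t)) + norm (f (x - t) - g (x - t))" .
    qed (use shift[OF f] shift[OF g(2)] in auto)
    also have "\<dots> = (LINT x|lborel. norm (f (x - X n) - g (x - X n))) + (LINT x|lborel. norm (g (x - X n) - g (x - t)))
         + (LINT x|lborel. norm (f (x - t) - g (x - t)))"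
      using shift[OF f] shift[OF g(2)] by simp
    also have "\<dots> < e" using N[OF n] g(3) eqs by auto
    finally show "norm ((LINT x|lborel. norm (f (x - X n) - f (x - t))) - 0) < e"
      by simp
  qed
qed

lemma cnj_measurable [measurable]: "cnj \<in> borel_measurable borel"
  by (intro borel_measurable_continuous_onI continuous_intros)

lemma mult_le_sum_power2: "a * b \<le> a\<^sup>2 + b\<^sup>2" for a b :: real
  using sum_squares_bound[of a b] sum_squares_bound[of a "- b"]
  by (cases "a * b \<ge> 0") (auto intro: order_trans[of _ "2 * a * b"])

section \<open>Gaussians and their transforms\<close>

definition gaussian :: "'a::euclidean_space \<Rightarrow> real" where
  "gaussian x = exp (- pi * (norm x)\<^sup>2)"

lemma gaussian_bounds [simp]: "0 < gaussian x" "0 \<le> gaussian x" "gaussian x \<le> 1" "\<bar>gaussian x\<bar> = gaussian x"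
  by (simp_all add: gaussian_def)

lemma gaussian_0 [simp]: "gaussian 0 = 1"
  by (simp add: gaussian_def)

lemma gaussian_measurable [measurable]: "gaussian \<in> borel_measurable borel"
  unfolding gaussian_def by measurable

text \<open>With this normalisation the Gaussian is its own transform; rescaling the variable by
  \<open>sqrt (2 * pi)\<close> reduces this to the characteristic function of the standard normal
  distribution.\<close>

lemma gaussian_fourier_real:
  "has_bochner_integral lborel (\<lambda>x. ee (t * x) * of_real (exp (- pi * x\<^sup>2))) (of_real (exp (- pi * t\<^sup>2)))"
proof -
  define c where "c = 1 / sqrt (2 * pi)"
  define F :: "real \<Rightarrow> complex" where "F x = iexp (sqrt (2 * pi) * t * x) * of_real (std_normal_density x)" for x
  have c: "c > 0" by (simp add: c_def)
  have sq: "sqrt (2 * pi) * sqrt (2 * pi) = 2 * pi" by simp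
  have int: "integrable lborel F"
    unfolding F_def
    by (rule Bochner_Integration.integrable_bound[where f = std_normal_density])
       (auto simp: norm_mult)
  have "(LINT x|lborel. F x) = char std_normal_distribution (sqrt (2 * pi) * t)"
    unfolding char_def F_def
    by (subst integral_density) (auto simp: scaleR_conv_of_real mult_ac)
  also have "\<dots> = of_real (exp (- pi * t\<^sup>2))"
    by (simp add: char_std_normal_distribution power_mult_distrib)
  finally have val: "(LINT x|lborel. F x) = of_real (exp (- pi * t\<^sup>2))" .
  have "has_bochner_integral lborel F (of_real (exp (- pi * t\<^sup>2)))"
    using int val by (simp add: has_bochner_integral_iff)
  then have "has_bochner_integral lborel (\<lambda>x. F (0 + sqrt (2 * pi) * x)) (of_real (exp (- pi * t\<^sup>2)) /\<^sub>R \<bar>sqrt (2 * pi)\<bar>)"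
    by (subst (asm) lborel_has_bochner_integral_real_affine_iff[of "sqrt (2 * pi)" _ _ 0]) auto
  then have "has_bochner_integral lborel (\<lambda>x. sqrt (2 * pi) *\<^sub>R F (sqrt (2 * pi) * x)) (sqrt (2 * pi) *\<^sub>R (of_real (exp (- pi * t\<^sup>2)) /\<^sub>R sqrt (2 * pi)))"
    by (intro has_bochner_integral_scaleR_right) simp
  moreover have "sqrt (2 * pi) *\<^sub>R F (sqrt (2 * pi) * x) = ee (t * x) * of_real (exp (- pi * x\<^sup>2))" for x
  proof -
    have "sqrt (2 * pi) * t * (sqrt (2 * pi) * x) = sqrt (2 * pi) * sqrt (2 * pi) * (t * x)"
      by (simp only: mult_ac)
    then have "sqrt (2 * pi) * t * (sqrt (2 * pi) * x) = 2 * pi * (t * x)"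
      by (simp only: sq)
    then have "iexp (sqrt (2 * pi) * t * (sqrt (2 * pi) * x)) = ee (t * x)"
      unfolding ee_def cis_conv_exp by (simp only:)
    moreover have "sqrt (2 * pi) * std_normal_density (sqrt (2 * pi) * x) = exp (- pi * x\<^sup>2)"
      by (simp add: std_normal_density_def power_mult_distrib real_sqrt_mult)
    ultimately show ?thesis
      unfolding F_def scaleR_conv_of_real
      by (metis (no_types, lifting) mult.commute mult.left_commute of_real_mult)
  qed
  ultimately show ?thesis by simp
qed

lemma gaussian_prod:
  fixes f :: "'a::euclidean_space \<Rightarrow> real"
  shows "gaussian (\<Sum>b\<in>Basis. f b *\<^sub>R b :: 'a) = (\<Prod>b\<in>(Basis::'a set). exp (- pi * (f b)\<^sup>2))"
proof -
  have "(norm (\<Sum>b\<in>Basis. f b *\<^sub>R b :: 'a))\<^sup>2 = (\<Sum>b\<in>(Basis::'a set). (f b)\<^sup>2)"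
    unfolding power2_norm_eq_inner
    by (subst euclidean_inner) (simp add: power2_eq_square)
  then show ?thesis
    by (simp add: gaussian_def exp_sum sum_distrib_left)
qed

lemma ee_sum: "finite A \<Longrightarrow> ee (sum f A) = (\<Prod>a\<in>A. ee (f a))"
  by (induction A rule: finite_induct) (simp_all add: ee_add)

text \<open>The coordinates separate: both the exponential and the Gaussian are products over
  \<open>Basis\<close>.\<close>

lemma gaussian_fourier:
  fixes t :: "'a::euclidean_space"
  shows "has_bochner_integral lborel (\<lambda>x. ee (t \<bullet> x) * of_real (gaussian x)) (of_real (gaussian t))"
proof -
  interpret product_sigma_finite "\<lambda>b::'a. lborel :: real measure" ..
  let ?g = "\<lambda>b x. ee ((t \<bullet> b) * x) * of_real (exp (- pi * x\<^sup>2))"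
  let ?S = "\<lambda>f. \<Sum>b\<in>Basis. f b *\<^sub>R b :: 'a"
  have eq: "ee (t \<bullet> ?S f) * of_real (gaussian (?S f)) = (\<Prod>b\<in>Basis. ?g b (f b))" for f :: "'a \<Rightarrow> real"
    by (simp add: gaussian_prod inner_sum_right ee_sum prod.distrib mult.commute)
  have int: "integrable (Pi\<^sub>M Basis (\<lambda>b::'a. lborel)) (\<lambda>f. \<Prod>b\<in>Basis. ?g b (f b))"
    by (rule product_integrable_prod) (use gaussian_fourier_real in \<open>auto simp: has_bochner_integral_iff\<close>)
  have "integral\<^sup>L (Pi\<^sub>M Basis (\<lambda>b::'a. lborel)) (\<lambda>f. \<Prod>b\<in>Basis. ?g b (f b)) = (\<Prod>b\<in>Basis. integral\<^sup>L lborel (?g b))"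
    by (rule product_integral_prod) (use gaussian_fourier_real in \<open>auto simp: has_bochner_integral_iff\<close>)
  also have "\<dots> = (\<Prod>b\<in>Basis. of_real (exp (- pi * (t \<bullet> b)\<^sup>2)))"
    using gaussian_fourier_real by (intro prod.cong) (auto simp: has_bochner_integral_iff)
  also have "\<dots> = of_real (gaussian t)"
    using gaussian_prod[of "\<lambda>b. t \<bullet> b"] by (simp add: euclidean_representation)
  finally have val: "integral\<^sup>L (Pi\<^sub>M Basis (\<lambda>b::'a. lborel)) (\<lambda>f. \<Prod>b\<in>Basis. ?g b (f b)) = of_real (gaussian t)" .
  have "has_bochner_integral (distr (Pi\<^sub>M Basis (\<lambda>b::'a. lborel)) borel ?S)
     (\<lambda>x. ee (t \<bullet> x) * of_real (gaussian x)) (of_real (gaussian t))"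
    unfolding has_bochner_integral_iff
    by (subst integrable_distr_eq, measurable, subst integral_distr) (use int val in \<open>simp_all add: eq\<close>)
  then show ?thesis by (subst lborel_eq)
qed

lemma gaussian_integrable: "integrable lborel (gaussian :: 'a::euclidean_space \<Rightarrow> real)"
  and gaussian_integral: "(LINT x|lborel. gaussian (x::'a)) = 1"
proof -
  have "has_bochner_integral lborel (\<lambda>x::'a. of_real (gaussian x) :: complex) (of_real 1)"
    using gaussian_fourier[of "0::'a"] by simp
  then have "integrable lborel (\<lambda>x::'a. of_real (gaussian x) :: complex)" "(LINT x|lborel. complex_of_real (gaussian (x::'a))) = of_real 1"
    by (simp_all only: has_bochner_integral_iff)
  then show "integrable lborel (gaussian :: 'a::euclidean_space \<Rightarrow> real)" "(LINT x|lborel. gaussian (x::'a)) = 1"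
    by (simp_all add: complex_of_real_integrable_eq)
qed

text \<open>For small \<open>r\<close> the right-hand side is an approximate identity in
  \<open>z\<close> of total mass 1; it arises as the transform of a broad Gaussian cut-off in
  momentum.\<close>

lemma fourier_gaussian_scaled:
  fixes z :: "'a::euclidean_space"
  assumes r: "r > 0"
  shows "(LINT k|lborel. ee (k \<bullet> z) * of_real (gaussian (r *\<^sub>R k))) = of_real (gaussian (z /\<^sub>R r) / r ^ DIM('a))"
proof -
  have "(LINT k|lborel. ee ((z /\<^sub>R r) \<bullet> k) * of_real (gaussian k)) =
    r ^ DIM('a) *\<^sub>R (LINT k|lborel. ee ((z /\<^sub>R r) \<bullet> (r *\<^sub>R k)) * of_real (gaussian (r *\<^sub>R k)))"
    by (rule integral_lborel_scale) (use r in auto)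
  moreover have "(LINT k|lborel. ee ((z /\<^sub>R r) \<bullet> k) * of_real (gaussian k)) = of_real (gaussian (z /\<^sub>R r))"
    using gaussian_fourier[of "z /\<^sub>R r"] unfolding has_bochner_integral_iff by blast
  ultimately show ?thesis
    using r by (simp add: inner_commute scaleR_conv_of_real field_simps)
qed

section \<open>Square integrable functions and their correlations\<close>

definition L12 :: "('a::euclidean_space \<Rightarrow> complex) \<Rightarrow> bool" where
  "L12 f \<longleftrightarrow> integrable lborel f \<and> integrable lborel (\<lambda>x. (norm (f x))\<^sup>2)"

lemma L12_D:
  assumes "L12 f"
  shows "integrable lborel f" "integrable lborel (\<lambda>x. (norm (f x))\<^sup>2)" "f \<in> borel_measurable borel"
  using assms by (auto simp: L12_def)

lemma square_integrable_mult:
  fixes f g :: "'a \<Rightarrow> 'b::{real_normed_algebra, banach, second_countable_topology}"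
  assumes [measurable]: "f \<in> borel_measurable M" "g \<in> borel_measurable M"
    and "integrable M (\<lambda>x. (norm (f x))\<^sup>2)" "integrable M (\<lambda>x. (norm (g x))\<^sup>2)"
  shows "integrable M (\<lambda>x. f x * g x)"
proof (rule Bochner_Integration.integrable_bound)
  show "integrable M (\<lambda>x. (norm (f x))\<^sup>2 + (norm (g x))\<^sup>2)"
    using assms by auto
  show "AE x in M. norm (f x * g x) \<le> norm ((norm (f x))\<^sup>2 + (norm (g x))\<^sup>2)"
  proof (rule AE_I2)
    fix x
    have "norm (f x * g x) \<le> norm (f x) * norm (g x)" by (rule norm_mult_ineq)
    also have "\<dots> \<le> (norm (f x))\<^sup>2 + (norm (g x))\<^sup>2"
      by (rule mult_le_sum_power2)
    finally show "norm (f x * g x) \<le> norm ((norm (f x))\<^sup>2 + (norm (g x))\<^sup>2)" by simp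
  qed
qed measurable

text \<open>At \<open>t = 0\<close> this is the L2 inner product; its continuity there lets the
  smoothing in Parseval's identity be removed.\<close>

definition correlation :: "('a::euclidean_space \<Rightarrow> complex) \<Rightarrow> ('a \<Rightarrow> complex) \<Rightarrow> 'a \<Rightarrow> complex" where
  "correlation f g t = (LINT x|lborel. f x * cnj (g (x - t)))"

lemma correlation_measurable [measurable]:
  assumes [measurable]: "f \<in> borel_measurable borel" "g \<in> borel_measurable borel"
  shows "correlation f g \<in> borel_measurable borel"
  unfolding correlation_def by measurable

lemma L12_shift: "L12 f \<Longrightarrow> L12 (\<lambda>x. f (x - t))"
  using integrable_lborel_shift[of f "-t"] integrable_lborel_shift[of "\<lambda>x. (norm (f x))\<^sup>2" "-t"]
  by (simp add: L12_def algebra_simps)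

lemma L12_mult_integrable:
  assumes f: "L12 f" and g: "L12 g"
  shows "integrable lborel (\<lambda>x. f x * cnj (g x))"
  using square_integrable_mult[of f lborel "\<lambda>x. cnj (g x)"] L12_D[OF f] L12_D[OF g]
  by (simp add: measurable_compose[OF _ cnj_measurable])

lemma norm_square_add_le: "(norm (a + b))\<^sup>2 \<le> 2 * (norm a)\<^sup>2 + 2 * (norm b)\<^sup>2"
  for a b :: "'a::real_normed_vector"
proof -
  have "(norm (a + b))\<^sup>2 \<le> (norm a + norm b)\<^sup>2"
    by (intro power_mono norm_triangle_ineq) auto
  also have "\<dots> \<le> 2 * (norm a)\<^sup>2 + 2 * (norm b)\<^sup>2"
    using sum_squares_bound[of "norm a" "norm b"] by (simp add: power2_sum)
  finally show ?thesis .
qed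

lemma norm_square_diff_le: "(norm (a - b))\<^sup>2 \<le> 2 * (norm a)\<^sup>2 + 2 * (norm b)\<^sup>2"
  for a b :: "'a::real_normed_vector"
  using norm_square_add_le[of a "- b"] by simp

lemma L12_diff: 
  assumes "L12 f" "L12 g"
  shows "L12 (\<lambda>x. f x - g x)"
proof -
  note * = L12_D[OF assms(1)] L12_D[OF assms(2)]
  note [measurable] = *(3,6)
  have "integrable lborel (\<lambda>x. (norm (f x - g x))\<^sup>2)"
    by (rule Bochner_Integration.integrable_bound[where f = "\<lambda>x. 2 * (norm (f x))\<^sup>2 + 2 * (norm (g x))\<^sup>2"])
       (use * norm_square_diff_le in auto)
  then show ?thesis using * by (simp add: L12_def)
qed

lemma norm_correlation_le:
  assumes f: "L12 f" and g: "L12 g"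
  shows "norm (correlation f g t) \<le> (LINT x|lborel. (norm (f x))\<^sup>2) + (LINT x|lborel. (norm (g x))\<^sup>2)"
proof -
  note gt = L12_shift[OF g, of t]
  note [measurable] = L12_D(3)[OF f] L12_D(3)[OF g]
  have "norm (correlation f g t) \<le> (LINT x|lborel. norm (f x * cnj (g (x - t))))"
    unfolding correlation_def by (rule integral_norm_bound)
  also have "\<dots> \<le> (LINT x|lborel. (norm (f x))\<^sup>2 + (norm (g (x - t)))\<^sup>2)"
  proof (rule integral_mono)
    show "norm (f x * cnj (g (x - t))) \<le> (norm (f x))\<^sup>2 + (norm (g (x - t)))\<^sup>2" for x
      using mult_le_sum_power2[of "norm (f x)" "norm (g (x - t))"] by (simp add: norm_mult)
  qed (use L12_D[OF f] L12_D[OF gt] L12_mult_integrable[OF f gt] in auto)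
  also have "\<dots> = (LINT x|lborel. (norm (f x))\<^sup>2) + (LINT x|lborel. (norm (g (x - t)))\<^sup>2)"
    using L12_D[OF f] L12_D[OF gt] by simp
  also have "(LINT x|lborel. (norm (g (x - t)))\<^sup>2) = (LINT x|lborel. (norm (g x))\<^sup>2)"
    using integral_lborel_shift[of "\<lambda>x. (norm (g x))\<^sup>2" "- t"] by (simp add: algebra_simps)
  finally show ?thesis .
qed

text \<open>The input is the L1 continuity of translations, so \<open>f\<close> is cut at a height
  \<open>M\<close>: where \<open>f\<close> is bounded, the L1 distance of the translates suffices,
  and on the small tail a weighted inequality trades the tail of \<open>f\<close> against the
  bounded L2 norm of the difference.\<close>

lemma correlation_tendsto:
  assumes f: "L12 f" and g: "L12 g" and X: "X \<longlonglongrightarrow> 0"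
  shows "(\<lambda>n. correlation f g (X n)) \<longlonglongrightarrow> correlation f g 0"
proof (rule LIMSEQ_I)
  fix r :: real assume r: "0 < r"
  note F = L12_D[OF f] and G = L12_D[OF g]
  note [measurable] = F(3) G(3)
  define B where "B = (LINT x|lborel. (norm (g x))\<^sup>2)"
  have B: "B \<ge> 0" unfolding B_def by simp
  \<comment> \<open>The squared L2 norm of \<open>g (x - X n) - g x\<close> is at most
    \<open>4 * B\<close>; this choice keeps \<open>\<eta> * (4 * B)\<close> below
    \<open>r/2\<close>, and the summand 1 covers \<open>B = 0\<close>.\<close>
  define \<eta> where "\<eta> = r / (8 * B + 1)"
  have \<eta>: "\<eta> > 0" "8 * B * \<eta> < r"
    using r B by (auto simp: \<eta>_def field_simps add_nonneg_pos)
  let ?tail = "\<lambda>M x. indicator {x. norm (f x) > M} x * (norm (f x))\<^sup>2"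
  have "(\<lambda>n. LINT x|lborel. ?tail (real n) x) \<longlonglongrightarrow> (LINT x|(lborel::'a measure). 0)"
  proof (rule integral_dominated_convergence[where w = "\<lambda>x. (norm (f x))\<^sup>2"])
    show "AE x in lborel. (\<lambda>n. ?tail (real n) x) \<longlonglongrightarrow> 0"
    proof (rule AE_I2)
      fix x
      have "eventually (\<lambda>n. norm (f x) \<le> real n) sequentially"
        by (rule eventually_at_top_linorderI[of "nat \<lceil>norm (f x)\<rceil>"]) linarith
      then have "eventually (\<lambda>n. ?tail (real n) x = 0) sequentially"
        by eventually_elim auto
      then show "(\<lambda>n. ?tail (real n) x) \<longlonglongrightarrow> 0"
        by (rule tendsto_eventually)
    qed
  qed (use F in \<open>auto simp: indicator_def\<close>)
  then have "eventually (\<lambda>n. (LINT x|lborel. ?tail (real n) x) < \<eta> * (r/4)) sequentially"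
    using r \<eta> by (intro order_tendstoD) auto
  then obtain M :: nat where M: "(LINT x|lborel. ?tail (real M) x) < \<eta> * (r/4)"
    by (auto simp: eventually_sequentially)
  have "(\<lambda>n. LINT x|lborel. norm (g (x - X n) - g (x - 0))) \<longlonglongrightarrow> 0"
    by (rule translation_continuous_L1[OF G(1) X])
  then have "eventually (\<lambda>n. (LINT x|lborel. norm (g (x - X n) - g (x - 0))) < r / (4 * (real M + 1))) sequentially"
    using r by (intro order_tendstoD) auto
  then obtain N where N: "\<And>n. n \<ge> N \<Longrightarrow> (LINT x|lborel. norm (g (x - X n) - g x)) < r / (4 * (real M + 1))"
    by (auto simp: eventually_sequentially)
  show "\<exists>no. \<forall>n\<ge>no. norm (correlation f g (X n) - correlation f g 0) < r"
  proof (intro exI allI impI)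
    fix n assume n: "N \<le> n"
    note gX = L12_shift[OF g, of "X n"]
    let ?D = "\<lambda>x. g (x - X n) - g x"
    note D = L12_D[OF L12_diff[OF gX g]]
    have iX: "integrable lborel (\<lambda>x. f x * cnj (g (x - X n)))" and i0: "integrable lborel (\<lambda>x. f x * cnj (g x))"
      using L12_mult_integrable[OF f gX] L12_mult_integrable[OF f g] by auto
    have it: "integrable lborel (?tail (real M))"
      by (rule Bochner_Integration.integrable_bound[OF F(2)]) (auto simp: indicator_def)
    have "correlation f g (X n) - correlation f g 0 = (LINT x|lborel. f x * cnj (?D x))"
      unfolding correlation_def using iX i0 by (simp add: right_diff_distrib)
    also have "norm \<dots> \<le> (LINT x|lborel. norm (f x * cnj (?D x)))"
      by (rule integral_norm_bound)
    also have "\<dots> \<le> (LINT x|lborel. real M * norm (?D x) + inverse \<eta> * ?tail (real M) x + \<eta> * (norm (?D x))\<^sup>2)"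
    proof (rule integral_mono)
      show "integrable lborel (\<lambda>x. norm (f x * cnj (?D x)))"
        using iX i0 by (simp add: right_diff_distrib)
      show "integrable lborel (\<lambda>x. real M * norm (?D x) + inverse \<eta> * ?tail (real M) x + \<eta> * (norm (?D x))\<^sup>2)"
        using D it by auto
      fix x
      show "norm (f x * cnj (?D x)) \<le> real M * norm (?D x) + inverse \<eta> * ?tail (real M) x + \<eta> * (norm (?D x))\<^sup>2"
      proof (cases "norm (f x) > real M")
        case True
        define a where "a = norm (f x)"
        define b where "b = norm (?D x)"
        \<comment> \<open>Arithmetic and geometric mean with weight \<open>\<eta>\<close>; the
          factor \<open>inverse \<eta>\<close> on the tail has been anticipated in the choice of
          \<open>M\<close>.\<close>
        have "0 \<le> (a - \<eta> * b)\<^sup>2" by simp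
        then have "2 * (\<eta> * (a * b)) \<le> a\<^sup>2 + \<eta>\<^sup>2 * b\<^sup>2"
          by (simp add: power2_diff power_mult_distrib algebra_simps)
        then have "2 * (a * b) \<le> inverse \<eta> * a\<^sup>2 + \<eta> * b\<^sup>2"
          using \<eta> by (simp add: field_simps power2_eq_square)
        moreover have "0 \<le> a * b" "0 \<le> real M * b" by (auto simp: a_def b_def)
        ultimately have "a * b \<le> real M * b + inverse \<eta> * a\<^sup>2 + \<eta> * b\<^sup>2" by linarith
        then show ?thesis using True by (simp add: norm_mult a_def b_def flip: complex_cnj_diff)
      next
        case False
        then have "norm (f x * cnj (?D x)) \<le> real M * norm (?D x)"
          by (simp add: norm_mult mult_right_mono flip: complex_cnj_diff)
        moreover have "0 \<le> \<eta> * (norm (?D x))\<^sup>2" using \<eta> by simp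
        ultimately have "norm (f x * cnj (?D x)) \<le> real M * norm (?D x) + inverse \<eta> * 0 + \<eta> * (norm (?D x))\<^sup>2"
          unfolding mult_zero_right by linarith
        moreover have "?tail (real M) x = 0" using False by simp
        ultimately show ?thesis by (simp only:)
      qed
    qed
    also have "\<dots> = real M * (LINT x|lborel. norm (?D x)) + inverse \<eta> * (LINT x|lborel. ?tail (real M) x)
        + \<eta> * (LINT x|lborel. (norm (?D x))\<^sup>2)"
      using D it by simp
    also have "\<dots> < r/4 + r/4 + r/2"
    proof (rule add_less_le_mono[OF add_le_less_mono])
      have "real M * (LINT x|lborel. norm (?D x)) \<le> real M * (r / (4 * (real M + 1)))"
        using N[OF n] by (intro mult_left_mono) auto
      also have "\<dots> \<le> r/4" using r by (simp add: field_simps)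
      finally show "real M * (LINT x|lborel. norm (?D x)) \<le> r/4" .
      show "inverse \<eta> * (LINT x|lborel. ?tail (real M) x) < r/4"
        using M \<eta> by (simp add: field_simps)
      have "(LINT x|lborel. (norm (?D x))\<^sup>2) \<le> (LINT x|lborel. 2 * (norm (g (x - X n)))\<^sup>2 + 2 * (norm (g x))\<^sup>2)"
        using D G L12_D[OF gX] by (intro integral_mono norm_square_diff_le) auto
      also have "\<dots> = 2 * (LINT x|lborel. (norm (g (x - X n)))\<^sup>2) + 2 * B"
        using G L12_D[OF gX] by (simp add: B_def)
      also have "(LINT x|lborel. (norm (g (x - X n)))\<^sup>2) = B"
        using integral_lborel_shift[of "\<lambda>x. (norm (g x))\<^sup>2" "- X n"] by (simp add: B_def algebra_simps)
      finally have "\<eta> * (LINT x|lborel. (norm (?D x))\<^sup>2) \<le> \<eta> * (4 * B)"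
        using \<eta> by (intro mult_left_mono) auto
      then show "\<eta> * (LINT x|lborel. (norm (?D x))\<^sup>2) \<le> r/2"
        using \<eta>(2) by (simp add: mult_ac)
    qed
    finally show "norm (correlation f g (X n) - correlation f g 0) < r"
      by simp
  qed
qed

section \<open>Parseval's identity\<close>

lemma (in pair_sigma_finite) integrable_tensor:
  fixes f :: "_ \<Rightarrow> 'c::{real_normed_field, banach, second_countable_topology}"
  assumes f: "integrable M1 f" and g: "integrable M2 g"
  shows "integrable (M1 \<Otimes>\<^sub>M M2) (\<lambda>(x, y). f x * g y)"
proof (rule Fubini_integrable)
  have [measurable]: "f \<in> borel_measurable M1" "g \<in> borel_measurable M2"
    using f g by auto
  show "(\<lambda>(x, y). f x * g y) \<in> borel_measurable (M1 \<Otimes>\<^sub>M M2)" by measurable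
  show "integrable M1 (\<lambda>x. LINT y|M2. norm (case (x, y) of (x, y) \<Rightarrow> f x * g y))"
    using f by (simp add: norm_mult)
  show "AE x in M1. integrable M2 (\<lambda>y. case (x, y) of (x, y) \<Rightarrow> f x * g y)"
    using g by simp
qed

lemma (in pair_sigma_finite) integral_tensor:
  fixes f :: "_ \<Rightarrow> 'c::{real_normed_field, banach, second_countable_topology}"
  assumes f: "integrable M1 f" and g: "integrable M2 g"
  shows "(LINT z|(M1 \<Otimes>\<^sub>M M2). (case z of (x, y) \<Rightarrow> f x * g y)) = (LINT x|M1. f x) * (LINT y|M2. g y)"
  using integral_fst[OF integrable_tensor[OF f g]] by simp

lemma pair_sigma_finite_lborel: "pair_sigma_finite (lborel :: 'a::euclidean_space measure) (lborel :: 'b::euclidean_space measure)"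
  by (intro pair_sigma_finite.intro lborel.sigma_finite_measure_axioms)

lemma pair_sigma_finite_lborel3:
  "pair_sigma_finite (lborel :: 'a::euclidean_space measure)
     ((lborel :: 'b::euclidean_space measure) \<Otimes>\<^sub>M (lborel :: 'c::euclidean_space measure))"
  by (simp add: lborel_prod pair_sigma_finite_lborel)

text \<open>The Gaussian makes the triple integral over \<open>k\<close>, \<open>x\<close>,
  \<open>y\<close> absolutely convergent. Integrating over \<open>x\<close> and \<open>y\<close>
  first gives the product of the transforms; integrating over \<open>k\<close> first gives an
  approximate identity in \<open>x - y\<close>, that is, an average of correlations over shifts of
  size \<open>r\<close>.\<close>

lemma smoothed_parseval:
  fixes f g :: "'a::euclidean_space \<Rightarrow> complex"
  assumes f: "L12 f" and g: "L12 g" and r: "r > 0"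
  shows "(LINT k|lborel. fourier f k * cnj (fourier g k) * of_real (gaussian (r *\<^sub>R k))) =
    (LINT t|lborel. of_real (gaussian t) * correlation f g (r *\<^sub>R t))"
proof -
  interpret Q: pair_sigma_finite "lborel :: 'a measure" "(lborel :: 'a measure) \<Otimes>\<^sub>M (lborel :: 'a measure)"
    by (rule pair_sigma_finite_lborel3)
  note F = L12_D[OF f] and G = L12_D[OF g]
  note [measurable] = F(3) G(3)
  have cg: "integrable lborel (\<lambda>y. cnj (g y))" using G by simp
  define H :: "'a \<Rightarrow> 'a \<times> 'a \<Rightarrow> complex" where
    "H k = (\<lambda>(x, y). ee (k \<bullet> (x - y)) * of_real (gaussian (r *\<^sub>R k)) * (f x * cnj (g y)))" for k
  have Hm: "case_prod H \<in> borel_measurable (lborel \<Otimes>\<^sub>M (lborel \<Otimes>\<^sub>M lborel))"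
    unfolding H_def split_beta by measurable
  have fg: "integrable (lborel \<Otimes>\<^sub>M lborel) (\<lambda>(x, y). f x * cnj (g y))"
    by (rule lborel_pair.integrable_tensor) (use F cg in auto)
  have gr: "integrable lborel (\<lambda>k::'a. gaussian (r *\<^sub>R k))"
    by (rule integrable_lborel_scale[OF gaussian_integrable r])
  have "integrable (lborel \<Otimes>\<^sub>M (lborel \<Otimes>\<^sub>M lborel))
     (\<lambda>(k, z). complex_of_real (gaussian (r *\<^sub>R (k::'a))) * (case z of (x, y) \<Rightarrow> f x * cnj (g y)))"
    by (rule Q.integrable_tensor) (use gr fg in \<open>auto simp: complex_of_real_integrable_eq\<close>)
  then have Hi: "integrable (lborel \<Otimes>\<^sub>M (lborel \<Otimes>\<^sub>M lborel)) (case_prod H)"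
    by (rule Bochner_Integration.integrable_bound) (use Hm in \<open>auto simp: H_def norm_mult\<close>)
  have L: "(LINT z|(lborel \<Otimes>\<^sub>M lborel). H k z) = fourier f k * cnj (fourier g k) * of_real (gaussian (r *\<^sub>R k))" for k
  proof -
    have "(LINT z|(lborel \<Otimes>\<^sub>M lborel). H k z) =
      (LINT z|(lborel \<Otimes>\<^sub>M lborel). of_real (gaussian (r *\<^sub>R k)) * (case z of (x, y) \<Rightarrow> (ee (k \<bullet> x) * f x) * cnj (ee (k \<bullet> y) * g y)))"
      by (intro Bochner_Integration.integral_cong refl)
         (auto simp: H_def inner_diff_right cnj_ee mult_ac simp flip: ee_add)
    also have "\<dots> = of_real (gaussian (r *\<^sub>R k)) * (LINT z|(lborel \<Otimes>\<^sub>M lborel). (case z of (x, y) \<Rightarrow> (ee (k \<bullet> x) * f x) * cnj (ee (k \<bullet> y) * g y)))"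
      by simp
    also have "(LINT z|(lborel \<Otimes>\<^sub>M lborel). (case z of (x, y) \<Rightarrow> (ee (k \<bullet> x) * f x) * cnj (ee (k \<bullet> y) * g y))) =
      fourier f k * (LINT y|lborel. cnj (ee (k \<bullet> y) * g y))"
      unfolding fourier_def
      by (rule lborel_pair.integral_tensor) (intro fourier_integrable F integrable_cnj G)+
    also have "(LINT y|lborel. cnj (ee (k \<bullet> y) * g y)) = cnj (fourier g k)"
      unfolding fourier_def by (rule Bochner_Integration.integral_cnj)
    finally show ?thesis by (simp only: mult_ac)
  qed
  have R: "(LINT k|lborel. H k z) = (case z of (x, y) \<Rightarrow> f x * cnj (g y) * of_real (gaussian ((x - y) /\<^sub>R r) / r ^ DIM('a)))" for z
    using fourier_gaussian_scaled[OF r, of "fst z - snd z"]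
    by (simp add: H_def split_beta mult_ac)
  have Ri: "integrable (lborel \<Otimes>\<^sub>M lborel) (\<lambda>(x, y). f x * cnj (g y) * of_real (gaussian ((x - y) /\<^sub>R r) / r ^ DIM('a)))"
    using Q.integrable_snd[OF Hi] unfolding R .
  have inner: "(LINT y|lborel. f x * cnj (g y) * of_real (gaussian ((x - y) /\<^sub>R r) / r ^ DIM('a))) =
     (LINT t|lborel. of_real (gaussian t) * (f x * cnj (g (x - r *\<^sub>R t))))" for x
  proof -
    let ?F = "\<lambda>u. f x * cnj (g (x - u)) * of_real (gaussian (u /\<^sub>R r) / r ^ DIM('a))"
    have "(LINT y|lborel. ?F (x - y)) = (LINT u|lborel. ?F u)"
      by (rule integral_lborel_reflect) measurable
    also have "\<dots> = r ^ DIM('a) *\<^sub>R (LINT t|lborel. ?F (r *\<^sub>R t))"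
      by (rule integral_lborel_scale) (use r in auto)
    also have "\<dots> = (LINT t|lborel. r ^ DIM('a) *\<^sub>R ?F (r *\<^sub>R t))"
      by simp
    also have "\<dots> = (LINT t|lborel. of_real (gaussian t) * (f x * cnj (g (x - r *\<^sub>R t))))"
      using r by (intro Bochner_Integration.integral_cong refl) (simp add: scaleR_conv_of_real field_simps)
    finally show ?thesis by simp
  qed
  define C where "C = (LINT x|lborel. (norm (f x))\<^sup>2) + (LINT x|lborel. (norm (g x))\<^sup>2)"
  have TI: "integrable (lborel \<Otimes>\<^sub>M lborel) (\<lambda>(t, x). of_real (gaussian t) * (f x * cnj (g (x - r *\<^sub>R t))))"
  proof (rule lborel_pair.Fubini_integrable)
    \<comment> \<open>The correlation bound, applied to the moduli of \<open>f\<close> and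
      \<open>g\<close>, bounds the inner integral by \<open>C\<close> uniformly in the shift, which
      leaves an integrable Gaussian.\<close>
    have nf: "L12 (\<lambda>x. of_real (norm (f x)))" and ng: "L12 (\<lambda>x. of_real (norm (g x)))"
      using F G by (auto simp: L12_def complex_of_real_integrable_eq)
    have "correlation (\<lambda>x. of_real (norm (f x))) (\<lambda>x. of_real (norm (g x))) s =
      of_real (LINT x|lborel. norm (f x) * norm (g (x - s)))" for s
      unfolding correlation_def by (simp flip: integral_complex_of_real)
    then have b: "\<bar>LINT x|lborel. norm (f x) * norm (g (x - s))\<bar> \<le> C" for s
      using norm_correlation_le[OF nf ng, of s] by (simp add: C_def)
    show "integrable lborel (\<lambda>t. LINT x|lborel. norm (case (t, x) of (t, x) \<Rightarrow> of_real (gaussian t) * (f x * cnj (g (x - r *\<^sub>R t)))))"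
    proof (rule Bochner_Integration.integrable_bound)
      show "integrable lborel (\<lambda>t::'a. gaussian t * C)" by (simp add: gaussian_integrable)
      show "(\<lambda>t. LINT x|lborel. norm (case (t, x) of (t, x) \<Rightarrow> of_real (gaussian t) * (f x * cnj (g (x - r *\<^sub>R t))))) \<in> borel_measurable lborel"
        by measurable
      show "AE t in lborel. norm (LINT x|lborel. norm (case (t, x) of (t, x) \<Rightarrow> of_real (gaussian t) * (f x * cnj (g (x - r *\<^sub>R t))))) \<le> norm (gaussian t * C)"
        using b by (intro AE_I2) (auto simp: norm_mult abs_mult intro!: mult_left_mono order_trans[OF _ abs_ge_self])
    qed
    show "AE t in lborel. integrable lborel (\<lambda>x. case (t, x) of (t, x) \<Rightarrow> of_real (gaussian t) * (f x * cnj (g (x - r *\<^sub>R t))))"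
      using L12_mult_integrable[OF f L12_shift[OF g]] by auto
  qed measurable
  have "(LINT k|lborel. fourier f k * cnj (fourier g k) * of_real (gaussian (r *\<^sub>R k))) = (LINT k|lborel. LINT z|(lborel \<Otimes>\<^sub>M lborel). H k z)"
    by (simp add: L)
  also have "\<dots> = (LINT z|(lborel \<Otimes>\<^sub>M lborel). LINT k|lborel. H k z)"
    using Q.Fubini_integral[OF Hi] by simp
  also have "\<dots> = (LINT x|lborel. LINT y|lborel. f x * cnj (g y) * of_real (gaussian ((x - y) /\<^sub>R r) / r ^ DIM('a)))"
    unfolding R using lborel_pair.integral_fst[OF Ri] by simp
  also have "\<dots> = (LINT x|lborel. LINT t|lborel. of_real (gaussian t) * (f x * cnj (g (x - r *\<^sub>R t))))"
    by (simp only: inner)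
  also have "\<dots> = (LINT t|lborel. LINT x|lborel. of_real (gaussian t) * (f x * cnj (g (x - r *\<^sub>R t))))"
    using lborel_pair.Fubini_integral[OF TI] .
  also have "\<dots> = (LINT t|lborel. of_real (gaussian t) * correlation f g (r *\<^sub>R t))"
    by (simp add: correlation_def)
  finally show ?thesis .
qed

lemma smoothed_correlation_tendsto:
  fixes f g :: "'a::euclidean_space \<Rightarrow> complex"
  assumes f: "L12 f" and g: "L12 g"
  shows "(\<lambda>n. LINT t|lborel. of_real (gaussian t) * correlation f g (inverse (real (Suc n)) *\<^sub>R t)) \<longlonglongrightarrow> correlation f g 0"
proof -
  note [measurable] = L12_D(3)[OF f] L12_D(3)[OF g]
  define C where "C = (LINT x|lborel. (norm (f x))\<^sup>2) + (LINT x|lborel. (norm (g x))\<^sup>2)"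
  have C: "norm (correlation f g t) \<le> C" for t
    unfolding C_def by (rule norm_correlation_le[OF f g])
  have "(\<lambda>n. LINT t|lborel. of_real (gaussian t) * correlation f g (inverse (real (Suc n)) *\<^sub>R t)) \<longlonglongrightarrow>
    (LINT t|lborel. of_real (gaussian (t::'a)) * correlation f g 0)"
  proof (rule integral_dominated_convergence[where w = "\<lambda>t. gaussian t * C"])
    show "AE t in lborel. (\<lambda>n. of_real (gaussian t) * correlation f g (inverse (real (Suc n)) *\<^sub>R t)) \<longlonglongrightarrow> of_real (gaussian t) * correlation f g 0"
    proof (intro AE_I2 tendsto_mult tendsto_const correlation_tendsto[OF f g])
      fix t :: 'a
      have "(\<lambda>n. inverse (real (Suc n)) *\<^sub>R t) \<longlonglongrightarrow> 0 *\<^sub>R t"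
        by (intro tendsto_intros LIMSEQ_inverse_real_of_nat)
      then show "(\<lambda>n. inverse (real (Suc n)) *\<^sub>R t) \<longlonglongrightarrow> 0" by simp
    qed
    show "AE t in lborel. norm (of_real (gaussian t) * correlation f g (inverse (real (Suc n)) *\<^sub>R t)) \<le> gaussian t * C" for n
      using C by (intro AE_I2) (auto simp: norm_mult intro!: mult_left_mono)
  qed (use gaussian_integrable in auto)
  also have "(LINT t|lborel. complex_of_real (gaussian (t::'a)) * correlation f g 0) = (LINT t|lborel. complex_of_real (gaussian (t::'a))) * correlation f g 0"
    using gaussian_integrable by (intro integral_mult_left_zero)
  also have "(LINT t|lborel. complex_of_real (gaussian (t::'a))) = 1"
    using gaussian_integral by simp
  finally show ?thesis by simp
qed

lemma gaussian_scale_mono: "0 \<le> r \<Longrightarrow> r \<le> s \<Longrightarrow> gaussian (s *\<^sub>R x) \<le> gaussian (r *\<^sub>R x)"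
  by (auto simp: gaussian_def intro!: power_mono mult_right_mono)

lemma gaussian_scale_tendsto: "(\<lambda>n. gaussian (inverse (real (Suc n)) *\<^sub>R k)) \<longlonglongrightarrow> 1"
proof -
  have "(\<lambda>n. gaussian (inverse (real (Suc n)) *\<^sub>R k)) \<longlonglongrightarrow> exp (- pi * (norm (0 *\<^sub>R k))\<^sup>2)"
    unfolding gaussian_def by (intro tendsto_intros LIMSEQ_inverse_real_of_nat)
  then show ?thesis by simp
qed

text \<open>Dominated convergence in Parseval's identity presupposes this integrability. It comes
  from monotone convergence: the Gaussian cut-offs increase to 1, and the cut-off integrals converge
  to the correlation at 0.\<close>

lemma fourier_square_integrable:
  fixes f :: "'a::euclidean_space \<Rightarrow> complex"
  assumes f: "L12 f"
  shows "integrable lborel (\<lambda>k. (norm (fourier f k))\<^sup>2)"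
proof -
  note F = L12_D[OF f]
  note [measurable] = F(3)
  define \<gamma> where "\<gamma> n k = gaussian (inverse (real (Suc n)) *\<^sub>R (k::'a))" for n k
  have [measurable]: "\<gamma> n \<in> borel_measurable borel" for n unfolding \<gamma>_def by measurable
  have g0: "0 \<le> \<gamma> n k" for n k by (simp add: \<gamma>_def)
  define S where "S = (LINT x|lborel. norm (f x))"
  have int: "integrable lborel (\<lambda>k. (norm (fourier f k))\<^sup>2 * \<gamma> n k)" for n
  proof (rule Bochner_Integration.integrable_bound)
    show "integrable lborel (\<lambda>k. S\<^sup>2 * \<gamma> n k)"
      unfolding \<gamma>_def by (intro integrable_mult_right integrable_lborel_scale gaussian_integrable) auto
    show "AE k in lborel. norm ((norm (fourier f k))\<^sup>2 * \<gamma> n k) \<le> norm (S\<^sup>2 * \<gamma> n k)"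
      using norm_fourier_le[of f] g0 by (intro AE_I2) (auto simp: abs_mult S_def intro!: mult_right_mono power_mono)
  qed measurable
  have lim: "(\<lambda>n. of_real (LINT k|lborel. (norm (fourier f k))\<^sup>2 * \<gamma> n k) :: complex) \<longlonglongrightarrow> correlation f f 0"
  proof -
    have "of_real (LINT k|lborel. (norm (fourier f k))\<^sup>2 * \<gamma> n k) =
      (LINT k|lborel. fourier f k * cnj (fourier f k) * of_real (\<gamma> n k))" for n
      by (simp flip: integral_complex_of_real add: complex_norm_square[symmetric])
    then show ?thesis
      using smoothed_correlation_tendsto[OF f f]
      by (simp add: \<gamma>_def smoothed_parseval[OF f f])
  qed
  show ?thesis
  proof (rule integrable_monotone_convergence[where f = "\<lambda>n k. (norm (fourier f k))\<^sup>2 * \<gamma> n k"])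
    show "integrable lborel (\<lambda>k. (norm (fourier f k))\<^sup>2 * \<gamma> n k)" for n by (rule int)
    show "AE k in lborel. mono (\<lambda>n. (norm (fourier f k))\<^sup>2 * \<gamma> n k)"
      by (intro AE_I2 monoI mult_left_mono) (auto simp: \<gamma>_def intro!: gaussian_scale_mono le_imp_inverse_le)
    show "AE k in lborel. (\<lambda>n. (norm (fourier f k))\<^sup>2 * \<gamma> n k) \<longlonglongrightarrow> (norm (fourier f k))\<^sup>2"
    proof (rule AE_I2)
      fix k
      have "(\<lambda>n. (norm (fourier f k))\<^sup>2 * \<gamma> n k) \<longlonglongrightarrow> (norm (fourier f k))\<^sup>2 * 1"
        unfolding \<gamma>_def by (intro tendsto_intros gaussian_scale_tendsto)
      then show "(\<lambda>n. (norm (fourier f k))\<^sup>2 * \<gamma> n k) \<longlonglongrightarrow> (norm (fourier f k))\<^sup>2" by simp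
    qed
    show "(\<lambda>n. LINT k|lborel. (norm (fourier f k))\<^sup>2 * \<gamma> n k) \<longlonglongrightarrow> Re (correlation f f 0)"
      using tendsto_Re[OF lim] by simp
  qed measurable
qed

text \<open>The smoothed identity is passed to the limit on both sides: by dominated convergence in
  momentum space, by continuity of the correlation at 0 in position space.\<close>

theorem parseval:
  fixes f g :: "'a::euclidean_space \<Rightarrow> complex"
  assumes f: "L12 f" and g: "L12 g"
  shows "integrable lborel (\<lambda>k. fourier f k * cnj (fourier g k))"
    and "(LINT k|lborel. fourier f k * cnj (fourier g k)) = (LINT x|lborel. f x * cnj (g x))"
proof -
  note [measurable] = L12_D(3)[OF f] L12_D(3)[OF g]
  show int: "integrable lborel (\<lambda>k. fourier f k * cnj (fourier g k))"
    by (rule square_integrable_mult) (use fourier_square_integrable f g in auto)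
  have "(\<lambda>n. LINT k|lborel. fourier f k * cnj (fourier g k) * of_real (gaussian (inverse (real (Suc n)) *\<^sub>R k)))
    \<longlonglongrightarrow> (LINT k|lborel. fourier f k * cnj (fourier g k))"
  proof (rule integral_dominated_convergence[where w = "\<lambda>k. norm (fourier f k * cnj (fourier g k))"])
    show "AE k in lborel. (\<lambda>n. fourier f k * cnj (fourier g k) * of_real (gaussian (inverse (real (Suc n)) *\<^sub>R k))) \<longlonglongrightarrow> fourier f k * cnj (fourier g k)"
    proof (rule AE_I2)
      fix k
      have "(\<lambda>n. fourier f k * cnj (fourier g k) * of_real (gaussian (inverse (real (Suc n)) *\<^sub>R k))) \<longlonglongrightarrow> fourier f k * cnj (fourier g k) * of_real 1"
        by (intro tendsto_intros gaussian_scale_tendsto)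
      then show "(\<lambda>n. fourier f k * cnj (fourier g k) * of_real (gaussian (inverse (real (Suc n)) *\<^sub>R k))) \<longlonglongrightarrow> fourier f k * cnj (fourier g k)" by simp
    qed
    show "AE k in lborel. norm (fourier f k * cnj (fourier g k) * of_real (gaussian (inverse (real (Suc n)) *\<^sub>R k))) \<le> norm (fourier f k * cnj (fourier g k))" for n
      by (intro AE_I2) (auto simp: norm_mult intro!: mult_left_le)
  qed (use int in auto)
  moreover have "(\<lambda>n. LINT k|lborel. fourier f k * cnj (fourier g k) * of_real (gaussian (inverse (real (Suc n)) *\<^sub>R k)))
    \<longlonglongrightarrow> correlation f g 0"
    using smoothed_correlation_tendsto[OF f g] by (subst smoothed_parseval[OF f g]) auto
  ultimately show "(LINT k|lborel. fourier f k * cnj (fourier g k)) = (LINT x|lborel. f x * cnj (g x))"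
    using LIMSEQ_unique by (fastforce simp: correlation_def)
qed

section \<open>The kernel\<close>

text \<open>Borel sets with pointwise symmetry: a Lebesgue measurable \<open>E\<close> will be
  replaced by such a set, equal to it almost everywhere, which leaves the kernel unchanged.\<close>

locale spectral_set =
  fixes E :: "'a::euclidean_space set"
  assumes E_borel [measurable]: "E \<in> sets borel"
    and E_sym: "- x \<in> E \<longleftrightarrow> x \<in> E"
    and E_measure: "emeasure lborel E = 1"
begin

text \<open>The law of the momentum of an occupied state. As \<open>E\<close> has measure 1,
  averages over \<open>E\<close> are expectations, and several momenta can be treated as
  independent.\<close>

definition U :: "'a measure" where
  "U = density lborel (\<lambda>x. ennreal (indicator E x))"

lemma sets_U [measurable_cong, simp]: "sets U = sets borel"
  by (simp add: U_def)

lemma space_U [simp]: "space U = UNIV"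
  by (simp add: U_def)

lemma prob_space_U: "prob_space U"
  by (rule prob_spaceI) (simp add: U_def emeasure_density E_measure ennreal_indicator)

sublocale U: prob_space U
  by (rule prob_space_U)

sublocale UU: pair_prob_space U U ..

sublocale UUU: pair_prob_space "U \<Otimes>\<^sub>M U" U ..

sublocale UUL: pair_sigma_finite "U \<Otimes>\<^sub>M U" "lborel :: 'b::euclidean_space measure" ..

lemma integral_U:
  fixes f :: "'a \<Rightarrow> 'b::{banach, second_countable_topology}"
  assumes [measurable]: "f \<in> borel_measurable borel"
  shows "(LINT x|U. f x) = (LINT x|lborel. indicator E x *\<^sub>R f x)"
  unfolding U_def by (subst integral_density) (auto simp: indicator_def)

lemma indicator_E_integrable: "integrable lborel (indicator E :: 'a \<Rightarrow> real)"
  by (rule integrable_real_indicator) (auto simp: E_measure)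

lemma integral_U_ee: "(LINT p|U. ee (p \<bullet> x)) = fourier (\<lambda>y. indicator E y) x"
  by (subst integral_U)
     (auto simp: fourier_def inner_commute scaleR_conv_of_real indicator_def intro!: Bochner_Integration.integral_cong)

definition K :: "'a \<Rightarrow> real" where
  "K x = Re (fourier (\<lambda>y. indicator E y) x)"

lemma L12_indicator: "L12 (\<lambda>y. indicator E y :: complex)"
proof -
  have "(\<lambda>y. indicator E y :: complex) = (\<lambda>y. of_real (indicator E y))"
    by (auto simp: indicator_def)
  moreover have "(\<lambda>x. (norm (complex_of_real (indicator E x)))\<^sup>2) = indicator E"
    by (auto simp: indicator_def)
  ultimately show ?thesis
    using indicator_E_integrable by (auto simp: L12_def complex_of_real_integrable_eq)
qed

text \<open>Conjugation replaces \<open>x\<close> by \<open>- x\<close>, and so does reflecting the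
  variable of integration, because \<open>E = - E\<close>; hence the transform is real and
  even.\<close>

lemma fourier_indicator_eq: "fourier (\<lambda>y. indicator E y) x = of_real (K x)"
  and K_minus [simp]: "K (- x) = K x"
proof -
  let ?F = "fourier (\<lambda>y. indicator E y :: complex)"
  have "cnj (?F x) = (LINT y|lborel. cnj (ee (x \<bullet> y) * indicator E y))"
    unfolding fourier_def by (rule Bochner_Integration.integral_cnj[symmetric])
  also have "\<dots> = ?F (- x)"
    unfolding fourier_def by (intro Bochner_Integration.integral_cong refl) (auto simp: cnj_ee indicator_def)
  finally have 1: "cnj (?F x) = ?F (- x)" .
  have "?F (- x) = (LINT y|lborel. ee (x \<bullet> (0 - y)) * indicator E (0 - y))"
    unfolding fourier_def by (intro Bochner_Integration.integral_cong refl) (auto simp: indicator_def E_sym)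
  also have "\<dots> = ?F x"
    unfolding fourier_def by (rule integral_lborel_reflect) auto
  finally have 2: "?F (- x) = ?F x" .
  then show "K (- x) = K x" by (simp add: K_def)
  show "fourier (\<lambda>y. indicator E y) x = of_real (K x)"
    using 1 2 by (simp add: K_def complex_eq_iff)
qed

lemma K_minus_commute: "K (x - y) = K (y - x)"
  using K_minus[of "x - y"] by simp

lemma K_continuous: "continuous_on UNIV K"
  unfolding K_def by (intro continuous_intros fourier_continuous L12_D[OF L12_indicator])

lemma K_measurable [measurable]: "K \<in> borel_measurable borel"
  by (rule borel_measurable_continuous_onI[OF K_continuous])

lemma integral_U_ee_eq: "(LINT p|U. ee (p \<bullet> x)) = of_real (K x)"
  by (simp add: integral_U_ee fourier_indicator_eq)

lemma K_bound [simp]: "\<bar>K x\<bar> \<le> 1"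
proof -
  have "norm (fourier (\<lambda>y. indicator E y) x) \<le> (LINT y|lborel. norm (indicator E y :: complex))"
    by (rule norm_fourier_le)
  also have "(\<lambda>y. norm (indicator E y :: complex)) = indicator E"
    by (auto simp: indicator_def)
  also have "(LINT y|lborel. indicator E y) = (1::real)"
    by (simp add: measure_def E_measure)
  finally show ?thesis by (simp add: fourier_indicator_eq)
qed

lemma K_0 [simp]: "K 0 = 1"
  using integral_U_ee_eq[of 0] U.prob_space by simp

lemma fourier_modulate: "fourier (\<lambda>y. ee (a \<bullet> y) * f y) x = fourier f (x + a)"
  unfolding fourier_def by (simp add: inner_add_left ee_add mult_ac)

lemma L12_modulate: "L12 f \<Longrightarrow> L12 (\<lambda>y. ee (a \<bullet> y) * f y)"
  unfolding L12_def by (auto simp: norm_mult fourier_integrable)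

text \<open>A translate of \<open>K\<close> is the transform of a modulated indicator. Since an
  indicator equals its square, Parseval's identity shows that \<open>K\<close> reproduces itself: it
  is the kernel of a projection.\<close>

lemma K_mult_integrable: "integrable lborel (\<lambda>z. K (z + a) * K (z + b))"
  and K_mult_integral: "(LINT z|lborel. K (z + a) * K (z + b)) = K (a - b)"
proof -
  let ?f = "\<lambda>a y. ee (a \<bullet> y) * indicator E y :: complex"
  have F: "fourier (?f a) z = of_real (K (z + a))" for a z
    by (simp add: fourier_modulate fourier_indicator_eq)
  have L: "L12 (?f a)" for a by (intro L12_modulate L12_indicator)
  have c: "fourier (?f a) z * cnj (fourier (?f b) z) = of_real (K (z + a) * K (z + b))" for z
    by (simp add: F)
  show "integrable lborel (\<lambda>z. K (z + a) * K (z + b))"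
    using parseval(1)[OF L L, of a b] unfolding c complex_of_real_integrable_eq .
  have "of_real (LINT z|lborel. K (z + a) * K (z + b)) = (LINT y|lborel. ?f a y * cnj (?f b y))"
    using parseval(2)[OF L L, of a b] unfolding c by (simp del: of_real_mult)
  also have "\<dots> = fourier (\<lambda>y. indicator E y) (a - b)"
    unfolding fourier_def
    by (intro Bochner_Integration.integral_cong refl)
       (auto simp: cnj_ee inner_diff_left indicator_def simp flip: ee_add)
  finally show "(LINT z|lborel. K (z + a) * K (z + b)) = K (a - b)"
    by (simp add: fourier_indicator_eq)
qed

lemma K_square_integrable: "integrable lborel (\<lambda>z. (K (z + a))\<^sup>2)"
  and K_square_integral: "(LINT z|lborel. (K (z + a))\<^sup>2) = 1"
  using K_mult_integrable[of a a] K_mult_integral[of a a] by (simp_all add: power2_eq_square)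

section \<open>Products of kernels along cycles\<close>

definition A :: "'a \<Rightarrow> real" where
  "A c = (LINT z|lborel. (K z)\<^sup>2 * (K (z + c))\<^sup>2)"

text \<open>Up to the sign of \<open>a\<close>, the product of kernels along a 4-cycle that
  alternates between two pairs, integrated over their separation \<open>z\<close>. With one argument
  0 it becomes \<open>A\<close>, which comes from two transpositions.\<close>

definition C :: "'a \<Rightarrow> 'a \<Rightarrow> real" where
  "C a b = (LINT z|lborel. K z * K (z + a) * K (z + b) * K (z + (a + b)))"

text \<open>The exponent is \<open>- (p \<bullet> a) - s \<bullet> b + q \<bullet> (a + b)\<close>,
  so the three independent momenta separate.\<close>

lemma integral_UUU_ee:
  "(LINT ((p, s), q)|((U \<Otimes>\<^sub>M U) \<Otimes>\<^sub>M U). ee ((q - p) \<bullet> a + (q - s) \<bullet> b)) = of_real (K a * K b * K (a + b))"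
proof -
  have int: "integrable U (\<lambda>p. ee (p \<bullet> x))" for x :: 'a
    by (rule U.integrable_const_bound[where B = 1]) auto
  have ps: "integrable (U \<Otimes>\<^sub>M U) (\<lambda>(p, s). ee (p \<bullet> (- a)) * ee (s \<bullet> (- b)))"
    by (rule UU.integrable_tensor[OF int int])
  have "(LINT ((p, s), q)|((U \<Otimes>\<^sub>M U) \<Otimes>\<^sub>M U). ee ((q - p) \<bullet> a + (q - s) \<bullet> b)) =
    (LINT (z, q)|((U \<Otimes>\<^sub>M U) \<Otimes>\<^sub>M U). (case z of (p, s) \<Rightarrow> ee (p \<bullet> (- a)) * ee (s \<bullet> (- b))) * ee (q \<bullet> (a + b)))"
    by (intro Bochner_Integration.integral_cong refl)
       (auto simp: inner_diff_left inner_add_right algebra_simps simp flip: ee_add)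
  also have "\<dots> = (LINT z|(U \<Otimes>\<^sub>M U). (case z of (p, s) \<Rightarrow> ee (p \<bullet> (- a)) * ee (s \<bullet> (- b)))) * (LINT q|U. ee (q \<bullet> (a + b)))"
    by (rule UUU.integral_tensor[OF ps int])
  also have "(LINT z|(U \<Otimes>\<^sub>M U). (case z of (p, s) \<Rightarrow> ee (p \<bullet> (- a)) * ee (s \<bullet> (- b)))) =
     (LINT p|U. ee (p \<bullet> (- a))) * (LINT s|U. ee (s \<bullet> (- b)))"
    by (rule UU.integral_tensor[OF int int])
  finally show ?thesis unfolding integral_U_ee_eq by simp
qed

text \<open>With \<open>q\<close> and \<open>s + p - q\<close> both in \<open>E\<close>, the
  integral over \<open>q\<close> is an inner product of a modulated and a reflected indicator.
  Parseval's identity replaces it by an integral over \<open>y\<close> in which \<open>p\<close> and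
  \<open>s\<close> occur only in exponentials, and these average to \<open>K (y + a)\<close> and
  \<open>K (y + b)\<close>.\<close>

lemma integral_UUU_indicator_ee:
  "(LINT ((p, s), q)|((U \<Otimes>\<^sub>M U) \<Otimes>\<^sub>M U). indicator E (s + p - q) *\<^sub>R ee ((q - p) \<bullet> a + (q - s) \<bullet> b)) = of_real (C a b)"
proof -
  let ?f = "\<lambda>y. ee ((a + b) \<bullet> y) * indicator E y :: complex"
  let ?g = "\<lambda>c y. indicator E (c - y) :: complex"
  let ?h = "\<lambda>y::'a. K y * K (y + (a + b))"
  have int: "integrable U (\<lambda>p. ee (p \<bullet> x))" for x :: 'a
    by (rule U.integrable_const_bound[where B = 1]) auto
  have Lf: "L12 ?f" by (intro L12_modulate L12_indicator)
  have Lg: "L12 (?g c)" for c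
    using integrable_lborel_reflect[OF L12_D(1)[OF L12_indicator], of c]
      integrable_lborel_reflect[OF L12_D(2)[OF L12_indicator], of c] by (simp add: L12_def)
  have Ff: "fourier ?f y = of_real (K (y + (a + b)))" for y
    by (simp add: fourier_modulate fourier_indicator_eq)
  have Fg: "fourier (?g c) y = ee (y \<bullet> c) * of_real (K y)" for c y
  proof -
    have "fourier (?g c) y = (LINT x|lborel. (\<lambda>u. ee (y \<bullet> (c - u)) * indicator E u) (c - x))"
      by (simp add: fourier_def)
    also have "\<dots> = (LINT u|lborel. ee (y \<bullet> (c - u)) * indicator E u)"
      by (rule integral_lborel_reflect) measurable
    also have "\<dots> = (LINT u|lborel. ee (y \<bullet> c) * (ee ((- y) \<bullet> u) * indicator E u))"
      by (intro Bochner_Integration.integral_cong refl) (auto simp: inner_diff_right mult_ac simp flip: ee_add)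
    also have "\<dots> = ee (y \<bullet> c) * fourier (\<lambda>y. indicator E y) (- y)"
      unfolding fourier_def by (rule integral_mult_right_zero)
    finally show ?thesis by (simp add: fourier_indicator_eq)
  qed
  have q: "(LINT q|U. indicator E (c - q) *\<^sub>R ee (q \<bullet> (a + b))) = (LINT y|lborel. of_real (?h y) * ee (- (y \<bullet> c)))" for c
  proof -
    have "(LINT q|U. indicator E (c - q) *\<^sub>R ee (q \<bullet> (a + b))) = (LINT y|lborel. ?f y * cnj (?g c y))"
      by (subst integral_U) (auto simp: inner_commute indicator_def intro!: Bochner_Integration.integral_cong)
    also have "\<dots> = (LINT y|lborel. fourier ?f y * cnj (fourier (?g c) y))"
      by (rule parseval(2)[OF Lf Lg, symmetric])
    also have "\<dots> = (LINT y|lborel. of_real (?h y) * ee (- (y \<bullet> c)))"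
      unfolding Ff Fg by (simp add: cnj_ee mult_ac)
    finally show ?thesis .
  qed
  let ?G = "\<lambda>z y. (case z of (p, s) \<Rightarrow> ee (p \<bullet> (- (y + a))) * ee (s \<bullet> (- (y + b)))) * of_real (?h y)"
  have hi: "integrable lborel ?h"
    using K_mult_integrable[of 0 "a + b"] by simp
  have Gi: "integrable ((U \<Otimes>\<^sub>M U) \<Otimes>\<^sub>M lborel) (case_prod ?G)"
  proof (rule Bochner_Integration.integrable_bound)
    show "integrable ((U \<Otimes>\<^sub>M U) \<Otimes>\<^sub>M lborel) (\<lambda>(z, y). 1 * ?h y)"
      by (rule UUL.integrable_tensor) (use hi in auto)
    show "case_prod ?G \<in> borel_measurable ((U \<Otimes>\<^sub>M U) \<Otimes>\<^sub>M lborel)"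
      unfolding split_beta by measurable
  qed (auto simp: norm_mult)
  have mult: "(\<lambda>((p, s), q). indicator E (s + p - q) *\<^sub>R ee ((q - p) \<bullet> a + (q - s) \<bullet> b)) \<in> borel_measurable ((U \<Otimes>\<^sub>M U) \<Otimes>\<^sub>M U)"
    unfolding split_beta by measurable
  have Ii: "integrable ((U \<Otimes>\<^sub>M U) \<Otimes>\<^sub>M U) (\<lambda>((p, s), q). indicator E (s + p - q) *\<^sub>R ee ((q - p) \<bullet> a + (q - s) \<bullet> b))"
    by (rule UUU.P.integrable_const_bound[where B = 1]) (use mult in \<open>auto simp: indicator_def\<close>)
  have "(LINT ((p, s), q)|((U \<Otimes>\<^sub>M U) \<Otimes>\<^sub>M U). indicator E (s + p - q) *\<^sub>R ee ((q - p) \<bullet> a + (q - s) \<bullet> b)) =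
    (LINT z|(U \<Otimes>\<^sub>M U). LINT q|U. (case z of (p, s) \<Rightarrow> indicator E (s + p - q) *\<^sub>R ee ((q - p) \<bullet> a + (q - s) \<bullet> b)))"
    using UUU.integral_fst'[OF Ii] by (simp add: split_beta)
  also have "\<dots> = (LINT z|(U \<Otimes>\<^sub>M U). LINT y|lborel. ?G z y)"
  proof (rule Bochner_Integration.integral_cong[OF refl])
    fix z :: "'a \<times> 'a"
    obtain p s where z: "z = (p, s)" by (cases z)
    have "(LINT q|U. indicator E (s + p - q) *\<^sub>R ee ((q - p) \<bullet> a + (q - s) \<bullet> b)) =
      (LINT q|U. ee (- (p \<bullet> a) - s \<bullet> b) * (indicator E (s + p - q) *\<^sub>R ee (q \<bullet> (a + b))))"
      by (intro Bochner_Integration.integral_cong refl)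
         (auto simp: indicator_def inner_diff_left inner_add_right algebra_simps simp flip: ee_add)
    also have "\<dots> = ee (- (p \<bullet> a) - s \<bullet> b) * (LINT y|lborel. of_real (?h y) * ee (- (y \<bullet> (s + p))))"
      by (simp only: integral_mult_right_zero q)
    also have "\<dots> = (LINT y|lborel. ee (- (p \<bullet> a) - s \<bullet> b) * (of_real (?h y) * ee (- (y \<bullet> (s + p)))))"
      by (rule integral_mult_right_zero[symmetric])
    also have "\<dots> = (LINT y|lborel. ?G z y)"
    proof (intro Bochner_Integration.integral_cong refl)
      fix y :: 'a
      have "- (p \<bullet> a) - s \<bullet> b + - (y \<bullet> (s + p)) = p \<bullet> (- (y + a)) + s \<bullet> (- (y + b))"
        by (simp add: inner_diff_right inner_add_right inner_commute)
      then have "ee (- (p \<bullet> a) - s \<bullet> b) * ee (- (y \<bullet> (s + p))) = ee (p \<bullet> (- (y + a))) * ee (s \<bullet> (- (y + b)))"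
        by (simp flip: ee_add)
      then show "ee (- (p \<bullet> a) - s \<bullet> b) * (of_real (?h y) * ee (- (y \<bullet> (s + p)))) = ?G z y"
        unfolding z prod.case by (metis mult.assoc mult.commute)
    qed
    finally show "(LINT q|U. (case z of (p, s) \<Rightarrow> indicator E (s + p - q) *\<^sub>R ee ((q - p) \<bullet> a + (q - s) \<bullet> b))) = (LINT y|lborel. ?G z y)"
      by (simp add: z)
  qed
  also have "\<dots> = (LINT y|lborel. LINT z|(U \<Otimes>\<^sub>M U). ?G z y)"
    by (rule UUL.Fubini_integral[OF Gi, symmetric])
  also have "\<dots> = (LINT y|lborel. of_real (K y * K (y + a) * K (y + b) * K (y + (a + b))))"
  proof (intro Bochner_Integration.integral_cong refl)
    fix y
    have "(LINT z|(U \<Otimes>\<^sub>M U). ?G z y) = (LINT p|U. ee (p \<bullet> (- (y + a)))) * (LINT s|U. ee (s \<bullet> (- (y + b)))) * of_real (?h y)"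
      by (simp only: integral_mult_left_zero UU.integral_tensor[OF int int])
    then show "(LINT z|(U \<Otimes>\<^sub>M U). ?G z y) = of_real (K y * K (y + a) * K (y + b) * K (y + (a + b)))"
      unfolding integral_U_ee_eq K_minus by (simp add: mult_ac)
  qed
  also have "\<dots> = of_real (C a b)"
    unfolding C_def by (rule integral_complex_of_real)
  finally show ?thesis .
qed

end

section \<open>The limiting variance in momentum space\<close>

locale even_potential = spectral_set E for E :: "'a::euclidean_space set" +
  fixes v :: "'a \<Rightarrow> real"
  assumes v_borel [measurable]: "v \<in> borel_measurable borel"
    and v_int: "integrable lborel v"
    and v_sq: "integrable lborel (\<lambda>x. (v x)\<^sup>2)"
    and v_even: "v (- x) = v x"
begin

definition vh :: "'a \<Rightarrow> real" where
  "vh k = Re (fourier (\<lambda>x. of_real (v x)) k)"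

lemma L12_v: "L12 (\<lambda>x. of_real (v x))"
  using v_int v_sq by (simp add: L12_def complex_of_real_integrable_eq)

lemma fourier_v: "fourier (\<lambda>x. of_real (v x)) k = of_real (vh k)"
  and vh_minus [simp]: "vh (- k) = vh k"
proof -
  let ?F = "fourier (\<lambda>x. of_real (v x))"
  have "cnj (?F k) = (LINT y|lborel. cnj (ee (k \<bullet> y) * of_real (v y)))"
    unfolding fourier_def by (rule Bochner_Integration.integral_cnj[symmetric])
  also have "\<dots> = ?F (- k)"
    unfolding fourier_def by (intro Bochner_Integration.integral_cong refl) (auto simp: cnj_ee)
  finally have 1: "cnj (?F k) = ?F (- k)" .
  have "?F (- k) = (LINT y|lborel. ee (k \<bullet> (0 - y)) * of_real (v (0 - y)))"
    unfolding fourier_def by (intro Bochner_Integration.integral_cong refl) (auto simp: v_even)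
  also have "\<dots> = ?F k"
    unfolding fourier_def by (rule integral_lborel_reflect) auto
  finally have 2: "?F (- k) = ?F k" .
  then show "vh (- k) = vh k" by (simp add: vh_def)
  show "?F k = of_real (vh k)"
    using 1 2 by (simp add: vh_def complex_eq_iff)
qed

lemma vh_continuous: "continuous_on UNIV vh"
  unfolding vh_def by (intro continuous_intros fourier_continuous L12_D[OF L12_v])

lemma vh_measurable [measurable]: "vh \<in> borel_measurable borel"
  by (rule borel_measurable_continuous_onI[OF vh_continuous])

lemma vh_bounded: "\<bar>vh k\<bar> \<le> (LINT x|lborel. \<bar>v x\<bar>)"
  using norm_fourier_le[of "\<lambda>x. of_real (v x)" k] by (simp add: fourier_v)

lemma vv_integrable: "integrable (lborel \<Otimes>\<^sub>M lborel) (\<lambda>(a, b). v a * v b)"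
  by (rule lborel_pair.integrable_tensor[OF v_int v_int])

lemma vh_mult: "complex_of_real (vh k * vh l) = (LINT (a, b)|(lborel \<Otimes>\<^sub>M lborel). ee (k \<bullet> a + l \<bullet> b) * of_real (v a * v b))"
proof -
  have "complex_of_real (vh k * vh l) = fourier (\<lambda>x. of_real (v x)) k * fourier (\<lambda>x. of_real (v x)) l"
    by (simp add: fourier_v)
  also have "\<dots> = (LINT (a, b)|(lborel \<Otimes>\<^sub>M lborel). (ee (k \<bullet> a) * of_real (v a)) * (ee (l \<bullet> b) * of_real (v b)))"
    unfolding fourier_def
    by (rule lborel_pair.integral_tensor[symmetric]) (intro fourier_integrable L12_D[OF L12_v])+
  finally show ?thesis by (simp add: ee_add mult_ac)
qed

text \<open>\<open>F\<close> is the characteristic function, weighted by \<open>w\<close>, of the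
  momenta \<open>s x\<close> and \<open>t x\<close>. Writing out both transforms of \<open>v\<close>
  and exchanging the integrals, as \<open>\<bar>w x\<bar> \<le> 1\<close> and the integrability of
  \<open>v\<close> permit, carries an average over momenta into position space.\<close>

lemma integral_vh_mult:
  assumes "prob_space Q" and [measurable]: "w \<in> borel_measurable Q" and w: "\<And>x. \<bar>w x\<bar> \<le> 1"
    and [measurable]: "s \<in> measurable Q borel" "t \<in> measurable Q borel"
    and F: "\<And>a b. (LINT x|Q. w x *\<^sub>R ee (s x \<bullet> a + t x \<bullet> b)) = of_real (F a b)"
  shows "integrable (lborel \<Otimes>\<^sub>M lborel) (\<lambda>(a, b). v a * v b * F a b)"
    and "(LINT x|Q. w x * (vh (s x) * vh (t x))) = (LINT (a, b)|(lborel \<Otimes>\<^sub>M lborel). v a * v b * F a b)"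
proof -
  interpret Q: prob_space Q by fact
  interpret QL: pair_sigma_finite Q "(lborel :: 'a measure) \<Otimes>\<^sub>M (lborel :: 'a measure)" ..
  let ?G = "\<lambda>x z. (case z of (a, b) \<Rightarrow> w x *\<^sub>R ee (s x \<bullet> a + t x \<bullet> b) * of_real (v a * v b))"
  have Gi: "integrable (Q \<Otimes>\<^sub>M (lborel \<Otimes>\<^sub>M lborel)) (case_prod ?G)"
  proof (rule Bochner_Integration.integrable_bound)
    show "integrable (Q \<Otimes>\<^sub>M (lborel \<Otimes>\<^sub>M lborel)) (\<lambda>(x, z). 1 * (case z of (a, b) \<Rightarrow> v a * v b))"
      by (rule QL.integrable_tensor) (use vv_integrable in auto)
    show "case_prod ?G \<in> borel_measurable (Q \<Otimes>\<^sub>M (lborel \<Otimes>\<^sub>M lborel))"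
      unfolding split_beta by measurable
    show "AE x in Q \<Otimes>\<^sub>M (lborel \<Otimes>\<^sub>M lborel). norm (case_prod ?G x) \<le> norm (case x of (x, z) \<Rightarrow> 1 * (case z of (a, b) \<Rightarrow> v a * v b))"
      using w by (intro AE_I2) (auto simp: norm_mult abs_mult simp del: mult_scaleR_left intro!: mult_left_le_one_le)
  qed
  have L: "(LINT z|(lborel \<Otimes>\<^sub>M lborel). ?G x z) = of_real (w x * (vh (s x) * vh (t x)))" for x
  proof -
    have "(LINT z|(lborel \<Otimes>\<^sub>M lborel). ?G x z) = (LINT z|(lborel \<Otimes>\<^sub>M lborel). of_real (w x) * (case z of (a, b) \<Rightarrow> ee (s x \<bullet> a + t x \<bullet> b) * of_real (v a * v b)))"
      by (intro Bochner_Integration.integral_cong refl) (auto simp: scaleR_conv_of_real)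
    also have "\<dots> = of_real (w x) * of_real (vh (s x) * vh (t x))"
      by (simp only: integral_mult_right_zero vh_mult)
    finally show ?thesis by simp
  qed
  have R: "(LINT x|Q. ?G x z) = of_real (case z of (a, b) \<Rightarrow> v a * v b * F a b)" for z
  proof (cases z)
    case (Pair a b)
    have "(LINT x|Q. w x *\<^sub>R ee (s x \<bullet> a + t x \<bullet> b) * of_real (v a * v b)) = of_real (F a b) * of_real (v a * v b)"
      by (simp only: integral_mult_left_zero F)
    then show ?thesis by (simp only: Pair prod.case) (simp add: mult_ac)
  qed
  have "integrable (lborel \<Otimes>\<^sub>M lborel) (\<lambda>z. complex_of_real (case z of (a, b) \<Rightarrow> v a * v b * F a b))"
    using QL.integrable_snd[OF Gi] unfolding R .
  then show "integrable (lborel \<Otimes>\<^sub>M lborel) (\<lambda>(a, b). v a * v b * F a b)"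
    by (simp only: complex_of_real_integrable_eq)
  have "of_real (LINT x|Q. w x * (vh (s x) * vh (t x))) = (LINT x|Q. LINT z|(lborel \<Otimes>\<^sub>M lborel). ?G x z)"
    unfolding L by (rule integral_complex_of_real[symmetric])
  also have "\<dots> = (LINT z|(lborel \<Otimes>\<^sub>M lborel). LINT x|Q. ?G x z)"
    by (rule QL.Fubini_integral[OF Gi, symmetric])
  also have "\<dots> = of_real (LINT z|(lborel \<Otimes>\<^sub>M lborel). (case z of (a, b) \<Rightarrow> v a * v b * F a b))"
    unfolding R by (rule integral_complex_of_real)
  finally show "(LINT x|Q. w x * (vh (s x) * vh (t x))) = (LINT (a, b)|(lborel \<Otimes>\<^sub>M lborel). v a * v b * F a b)"
    by (simp only: of_real_eq_iff)
qed

abbreviation "Q \<equiv> (U \<Otimes>\<^sub>M U) \<Otimes>\<^sub>M U"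

lemma bounded_integrable_Q:
  assumes [measurable]: "f \<in> borel_measurable Q" and "\<And>x. \<bar>f x :: real\<bar> \<le> B"
  shows "integrable Q f"
  by (rule UUU.P.integrable_const_bound[where B = B]) (use assms in auto)

lemma vh_mult_bounded: "\<bar>vh k * vh l\<bar> \<le> (LINT x|lborel. \<bar>v x\<bar>) * (LINT x|lborel. \<bar>v x\<bar>)"
  unfolding abs_mult by (intro mult_mono vh_bounded) auto

text \<open>Expanding the square leaves three instances of the previous transfer. In the two pure
  squares both copies of \<open>v\<close> see the same momentum, so \<open>a\<close> and
  \<open>b\<close> enter \<open>F\<close> only through \<open>a + b\<close>.\<close>

lemma integral_vh_diff_square:
  assumes w[measurable]: "w \<in> borel_measurable Q" and w1: "\<And>x. \<bar>w x\<bar> \<le> 1"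
    and F: "\<And>a b. (LINT ((p, s), q)|Q. w ((p, s), q) *\<^sub>R ee ((q - p) \<bullet> a + (q - s) \<bullet> b)) = of_real (F a b)"
  shows "integrable (lborel \<Otimes>\<^sub>M lborel) (\<lambda>(a, b). v a * v b * (F (a + b) 0 + F 0 (a + b) - 2 * F a b))" (is ?I)
    and "(LINT ((p, s), q)|Q. w ((p, s), q) * (vh (q - p) - vh (q - s))\<^sup>2) =
      (LINT (a, b)|(lborel \<Otimes>\<^sub>M lborel). v a * v b * (F (a + b) 0 + F 0 (a + b) - 2 * F a b))" (is ?E)
proof -
  let ?s = "\<lambda>x. snd x - fst (fst x) :: 'a" and ?t = "\<lambda>x. snd x - snd (fst x) :: 'a"
  have F': "(LINT x|Q. w x *\<^sub>R ee (?s x \<bullet> a + ?t x \<bullet> b)) = of_real (F a b)" for a b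
    unfolding F[symmetric] by (intro Bochner_Integration.integral_cong refl) auto
  have pQ: "prob_space Q" by (rule UUU.P.prob_space_axioms)
  note 1 = integral_vh_mult[OF pQ w w1, of ?s ?s "\<lambda>a b. F (a + b) 0"]
  note 2 = integral_vh_mult[OF pQ w w1, of ?t ?t "\<lambda>a b. F 0 (a + b)"]
  note 3 = integral_vh_mult[OF pQ w w1, of ?s ?t F]
  have 1: "integrable (lborel \<Otimes>\<^sub>M lborel) (\<lambda>(a, b). v a * v b * F (a + b) 0)"
    "(LINT x|Q. w x * (vh (?s x) * vh (?s x))) = (LINT (a, b)|(lborel \<Otimes>\<^sub>M lborel). v a * v b * F (a + b) 0)"
    by (rule 1; simp add: F'[symmetric] inner_add_right)+
  have 2: "integrable (lborel \<Otimes>\<^sub>M lborel) (\<lambda>(a, b). v a * v b * F 0 (a + b))"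
    "(LINT x|Q. w x * (vh (?t x) * vh (?t x))) = (LINT (a, b)|(lborel \<Otimes>\<^sub>M lborel). v a * v b * F 0 (a + b))"
    by (rule 2; simp add: F'[symmetric] inner_add_right)+
  have 3: "integrable (lborel \<Otimes>\<^sub>M lborel) (\<lambda>(a, b). v a * v b * F a b)"
    "(LINT x|Q. w x * (vh (?s x) * vh (?t x))) = (LINT (a, b)|(lborel \<Otimes>\<^sub>M lborel). v a * v b * F a b)"
    by (rule 3; simp add: F')+
  have eq: "(\<lambda>(a, b). v a * v b * (F (a + b) 0 + F 0 (a + b) - 2 * F a b)) =
    (\<lambda>z. (case z of (a, b) \<Rightarrow> v a * v b * F (a + b) 0) + (case z of (a, b) \<Rightarrow> v a * v b * F 0 (a + b))
        - 2 * (case z of (a, b) \<Rightarrow> v a * v b * F a b))"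
    by (auto simp: fun_eq_iff algebra_simps)
  show ?I unfolding eq using 1 2 3 by simp
  let ?B = "(LINT x|lborel. \<bar>v x\<bar>) * (LINT x|lborel. \<bar>v x\<bar>)"
  have int: "integrable Q (\<lambda>x. w x * (vh (f x) * vh (g x)))"
    if [measurable]: "f \<in> measurable Q borel" "g \<in> measurable Q borel" for f g
  proof (rule bounded_integrable_Q[where B = ?B])
    fix x
    have "\<bar>w x * (vh (f x) * vh (g x))\<bar> \<le> 1 * ?B"
      unfolding abs_mult[of "w x"] by (intro mult_mono w1 vh_mult_bounded) auto
    then show "\<bar>w x * (vh (f x) * vh (g x))\<bar> \<le> ?B" by simp
  qed measurable
  have "(LINT ((p, s), q)|Q. w ((p, s), q) * (vh (q - p) - vh (q - s))\<^sup>2) =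
    (LINT x|Q. w x * (vh (?s x) * vh (?s x)) + w x * (vh (?t x) * vh (?t x)) - 2 * (w x * (vh (?s x) * vh (?t x))))"
    by (intro Bochner_Integration.integral_cong refl)
       (auto simp: split_beta power2_eq_square algebra_simps)
  also have "\<dots> = (LINT x|Q. w x * (vh (?s x) * vh (?s x))) + (LINT x|Q. w x * (vh (?t x) * vh (?t x)))
     - 2 * (LINT x|Q. w x * (vh (?s x) * vh (?t x)))"
    using int[of ?s ?s] int[of ?t ?t] int[of ?s ?t] by simp
  also have "\<dots> = (LINT (a, b)|(lborel \<Otimes>\<^sub>M lborel). v a * v b * (F (a + b) 0 + F 0 (a + b) - 2 * F a b))"
    unfolding 1 2 3 eq using 1(1) 2(1) 3(1) by simp
  finally show ?E .
qed

end

lemma integral_diff_diff_add: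
  fixes f g h k :: "'a \<Rightarrow> real"
  assumes "integrable M f" "integrable M g" "integrable M h" "integrable M k"
  shows "(LINT x|M. f x - g x - h x + k x) = (LINT x|M. f x) - (LINT x|M. g x) - (LINT x|M. h x) + (LINT x|M. k x)"
  using assms by simp

section \<open>The limit as a total excitation weight\<close>

context even_potential
begin

text \<open>The first integral comes from two pairs with the same points, the second from pairs with
  one common point or none, after the cancellations in
  \<open>limit_variance_assembled\<close>.\<close>

definition limit_variance :: real where
  "limit_variance = (LINT x|lborel. 2 * (v x)\<^sup>2 * (1 - (K x)\<^sup>2)) +
    (LINT (a, b)|(lborel \<Otimes>\<^sub>M lborel). v a * v b *
      (2 * A (a + b) - 2 * C a b - 4 * (K (a + b))\<^sup>2 + 4 * (K a * K b * K (a + b))))"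

text \<open>Squared amplitude for moving particles from momenta \<open>p\<close>, \<open>s\<close>
  to \<open>p + k\<close>, \<open>s - k\<close>. The subtracted term is the exchange process, in
  which \<open>p\<close> ends at \<open>s - k\<close>: the transfer is then
  \<open>s - k - p\<close>, and \<open>vh\<close> is even. The minus sign is that of
  fermions.\<close>

definition excitation :: "'a \<times> 'a \<Rightarrow> 'a \<Rightarrow> real" where
  "excitation = (\<lambda>(p, s) k. (vh k - vh (k + p - s))\<^sup>2)"

lemma excitation_measurable [measurable]:
  "case_prod excitation \<in> borel_measurable ((borel \<Otimes>\<^sub>M borel) \<Otimes>\<^sub>M borel)"
  unfolding excitation_def split_beta by measurable

lemma excitation_nonneg: "0 \<le> excitation z k"
  by (auto simp: excitation_def split: prod.split)

text \<open>In the variable \<open>k\<close> the difference is the transform of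
  \<open>v x * (1 - ee ((p - s) \<bullet> x))\<close>; Parseval's identity evaluates its squared
  norm.\<close>

lemma excitation_integral:
  "integrable lborel (excitation (p, s))"
  "(LINT k|lborel. excitation (p, s) k) = (LINT x|lborel. (v x)\<^sup>2 * (2 - 2 * Re (ee (p \<bullet> x) * ee (s \<bullet> - x))))"
proof -
  let ?f = "\<lambda>x. complex_of_real (v x) - ee ((p - s) \<bullet> x) * of_real (v x)"
  have L: "L12 ?f"
    by (intro L12_diff L12_v L12_modulate)
  have i: "integrable lborel (\<lambda>y. ee (k \<bullet> y) * complex_of_real (v y))" for k
    by (rule fourier_integrable[OF L12_D(1)[OF L12_v]])
  have F: "fourier ?f k = of_real (vh k - vh (k + p - s))" for k
  proof -
    have "fourier ?f k = (LINT y|lborel. ee (k \<bullet> y) * of_real (v y) - ee ((k + (p - s)) \<bullet> y) * of_real (v y))"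
      unfolding fourier_def
      by (intro Bochner_Integration.integral_cong refl) (simp add: inner_add_left[of _ "p - s"] ee_add right_diff_distrib mult.assoc)
    also have "\<dots> = fourier (\<lambda>x. of_real (v x)) k - fourier (\<lambda>x. of_real (v x)) (k + (p - s))"
      unfolding fourier_def by (rule Bochner_Integration.integral_diff[OF i i])
    finally show ?thesis by (simp add: fourier_v add_diff_eq)
  qed
  have W: "fourier ?f k * cnj (fourier ?f k) = of_real (excitation (p, s) k)" for k
    unfolding F by (simp add: excitation_def power2_eq_square)
  show "integrable lborel (excitation (p, s))"
    using parseval(1)[OF L L] unfolding W complex_of_real_integrable_eq by simp
  have "of_real (LINT k|lborel. excitation (p, s) k) = (LINT x|lborel. ?f x * cnj (?f x))"
    using parseval(2)[OF L L] unfolding W by simp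
  also have "\<dots> = (LINT x|lborel. of_real ((v x)\<^sup>2 * (2 - 2 * Re (ee (p \<bullet> x) * ee (s \<bullet> - x)))))"
  proof (intro Bochner_Integration.integral_cong refl)
    fix x
    let ?e = "ee ((p - s) \<bullet> x)"
    have e: "ee (p \<bullet> x) * ee (s \<bullet> - x) = ?e"
      by (simp add: inner_diff_left flip: ee_add)
    have f: "?f x = of_real (v x) * (1 - ?e)"
      by (simp add: algebra_simps)
    have "?f x * cnj (?f x) = of_real ((norm (?f x))\<^sup>2)"
      by (rule complex_norm_square[symmetric])
    also have "(norm (?f x))\<^sup>2 = (v x)\<^sup>2 * (norm (1 - ?e))\<^sup>2"
      unfolding f by (simp add: norm_mult power_mult_distrib)
    also have "(norm (1 - ?e))\<^sup>2 = 2 - 2 * Re ?e"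
    proof -
      have "(Re ?e)\<^sup>2 + (Im ?e)\<^sup>2 = 1"
        using cmod_power2[of ?e] by simp
      then show ?thesis by (simp add: cmod_power2 power2_diff)
    qed
    finally show "?f x * cnj (?f x) = of_real ((v x)\<^sup>2 * (2 - 2 * Re (ee (p \<bullet> x) * ee (s \<bullet> - x))))"
      by (simp only: e)
  qed
  also have "\<dots> = of_real (LINT x|lborel. (v x)\<^sup>2 * (2 - 2 * Re (ee (p \<bullet> x) * ee (s \<bullet> - x))))"
    by (rule integral_complex_of_real)
  finally show "(LINT k|lborel. excitation (p, s) k) = (LINT x|lborel. (v x)\<^sup>2 * (2 - 2 * Re (ee (p \<bullet> x) * ee (s \<bullet> - x))))"
    by (simp only: of_real_eq_iff)
qed

text \<open>Averaged over independent \<open>p\<close> and \<open>s\<close>, the phase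
  \<open>ee ((p - s) \<bullet> x)\<close> becomes \<open>(K x)\<^sup>2\<close>, which produces the
  pair term of \<open>limit_variance\<close>. Integrability in all three momenta is seen on the
  position side, where \<open>4 * (v x)\<^sup>2\<close> dominates.\<close>

lemma excitation_integrable: "integrable ((U \<Otimes>\<^sub>M U) \<Otimes>\<^sub>M lborel) (case_prod excitation)"
  and excitation_total: "(LINT z|((U \<Otimes>\<^sub>M U) \<Otimes>\<^sub>M lborel). case_prod excitation z) = (LINT x|lborel. 2 * (v x)\<^sup>2 * (1 - (K x)\<^sup>2))"
proof -
  let ?g = "\<lambda>z x. (v x)\<^sup>2 * (2 - 2 * Re (case z of (p, s) \<Rightarrow> ee (p \<bullet> x) * ee (s \<bullet> - x)))"
  have g: "(LINT k|lborel. excitation z k) = (LINT x|lborel. ?g z x)" for z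
    using excitation_integral(2)[of "fst z" "snd z"] by (simp add: split_beta)
  have ei: "integrable lborel (excitation z)" for z
    using excitation_integral(1)[of "fst z" "snd z"] by simp
  have gb: "norm (?g z x) \<le> 4 * (v x)\<^sup>2" for z x
  proof -
    have "\<bar>Re (case z of (p, s) \<Rightarrow> ee (p \<bullet> x) * ee (s \<bullet> - x))\<bar> \<le> 1"
      using abs_Re_le_cmod[of "case z of (p, s) \<Rightarrow> ee (p \<bullet> x) * ee (s \<bullet> - x)"] by (auto simp: norm_mult split: prod.splits)
    then have "\<bar>2 - 2 * Re (case z of (p, s) \<Rightarrow> ee (p \<bullet> x) * ee (s \<bullet> - x))\<bar> \<le> 4"
      by linarith
    from mult_left_mono[OF this, of "(v x)\<^sup>2"] show ?thesis by (simp add: abs_mult mult.commute)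
  qed
  have gi: "integrable ((U \<Otimes>\<^sub>M U) \<Otimes>\<^sub>M lborel) (case_prod ?g)"
  proof (rule Bochner_Integration.integrable_bound)
    show "integrable ((U \<Otimes>\<^sub>M U) \<Otimes>\<^sub>M lborel) (\<lambda>(z, x). 4 * (v x)\<^sup>2)"
      by (rule UUL.integrable_tensor) (use v_sq in auto)
    show "case_prod ?g \<in> borel_measurable ((U \<Otimes>\<^sub>M U) \<Otimes>\<^sub>M lborel)"
      unfolding split_beta by measurable
    show "AE x in (U \<Otimes>\<^sub>M U) \<Otimes>\<^sub>M lborel. norm (case_prod ?g x) \<le> norm (case x of (z, x) \<Rightarrow> 4 * (v x)\<^sup>2)"
      using gb by (intro AE_I2) (auto simp del: abs_mult)
  qed
  show i: "integrable ((U \<Otimes>\<^sub>M U) \<Otimes>\<^sub>M lborel) (case_prod excitation)"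
  proof (rule UUL.Fubini_integrable)
    show "case_prod excitation \<in> borel_measurable ((U \<Otimes>\<^sub>M U) \<Otimes>\<^sub>M lborel)" by measurable
    show "integrable (U \<Otimes>\<^sub>M U) (\<lambda>z. LINT k|lborel. norm (case (z, k) of (z, k) \<Rightarrow> excitation z k))"
      using UUL.integrable_fst[OF gi] by (simp add: excitation_nonneg g)
  qed (simp add: ei)
  have "(LINT z|((U \<Otimes>\<^sub>M U) \<Otimes>\<^sub>M lborel). case_prod excitation z) = (LINT z|(U \<Otimes>\<^sub>M U). LINT k|lborel. excitation z k)"
    by (rule UUL.integral_fst[OF i, symmetric])
  also have "\<dots> = (LINT x|lborel. LINT z|(U \<Otimes>\<^sub>M U). ?g z x)"
    unfolding g by (rule UUL.Fubini_integral[OF gi, symmetric])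
  also have "\<dots> = (LINT x|lborel. 2 * (v x)\<^sup>2 * (1 - (K x)\<^sup>2))"
  proof (intro Bochner_Integration.integral_cong refl)
    fix x :: 'a
    let ?h = "\<lambda>z. case z of (p, s) \<Rightarrow> ee (p \<bullet> x) * ee (s \<bullet> - x)"
    have int: "integrable U (\<lambda>p. ee (p \<bullet> x))" for x :: 'a
      by (rule U.integrable_const_bound[where B = 1]) auto
    have hi: "integrable (U \<Otimes>\<^sub>M U) ?h" by (rule UU.integrable_tensor[OF int int])
    have "(LINT z|(U \<Otimes>\<^sub>M U). ?h z) = of_real (K x) * of_real (K x)"
      unfolding UU.integral_tensor[OF int int] integral_U_ee_eq by simp
    then have "(LINT z|(U \<Otimes>\<^sub>M U). Re (?h z)) = (K x)\<^sup>2"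
      using hi by (simp add: power2_eq_square)
    then have "(LINT z|(U \<Otimes>\<^sub>M U). 2 - 2 * Re (?h z)) = 2 - 2 * (K x)\<^sup>2"
      using hi UU.P.prob_space by simp
    moreover have "(LINT z|(U \<Otimes>\<^sub>M U). ?g z x) = (v x)\<^sup>2 * (LINT z|(U \<Otimes>\<^sub>M U). 2 - 2 * Re (?h z))"
      by (rule integral_mult_right_zero)
    ultimately show "(LINT z|(U \<Otimes>\<^sub>M U). ?g z x) = 2 * (v x)\<^sup>2 * (1 - (K x)\<^sup>2)"
      by (simp only:) (simp add: algebra_simps)
  qed
  finally show "(LINT z|((U \<Otimes>\<^sub>M U) \<Otimes>\<^sub>M lborel). case_prod excitation z) = (LINT x|lborel. 2 * (v x)\<^sup>2 * (1 - (K x)\<^sup>2))" .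
qed

text \<open>Pauli exclusion: neither final momentum may lie in \<open>E\<close>. The form as a
  product of differences prepares inclusion and exclusion.\<close>

definition unoccupied :: "'a \<times> 'a \<Rightarrow> 'a \<Rightarrow> real" where
  "unoccupied = (\<lambda>(p, s) k. (1 - indicator E (p + k)) * (1 - indicator E (s - k)))"

lemma integral_excitation_restricted:
  fixes h :: "'a \<times> 'a \<Rightarrow> 'a \<Rightarrow> real"
  assumes [measurable]: "case_prod h \<in> borel_measurable ((borel \<Otimes>\<^sub>M borel) \<Otimes>\<^sub>M borel)"
    and h: "\<And>z k. \<bar>h z k\<bar> \<le> 1"
  shows "integrable ((U \<Otimes>\<^sub>M U) \<Otimes>\<^sub>M lborel) (\<lambda>(z, k). h z k * excitation z k)"
proof (rule Bochner_Integration.integrable_bound[OF excitation_integrable])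
  show "AE x in (U \<Otimes>\<^sub>M U) \<Otimes>\<^sub>M lborel. norm (case x of (z, k) \<Rightarrow> h z k * excitation z k) \<le> norm (case_prod excitation x)"
    using h excitation_nonneg by (intro AE_I2) (auto simp: abs_mult intro!: mult_left_le_one_le)
qed measurable

text \<open>Substituting \<open>q = p + k\<close> turns the condition \<open>p + k \<in> E\<close>
  into a third momentum with law \<open>U\<close>, independent of \<open>p\<close> and
  \<open>s\<close>, and the excitation into
  \<open>(vh (q - p) - vh (q - s))\<^sup>2\<close>.\<close>

lemma integral_excitation_reflected:
  fixes w :: "'a \<Rightarrow> 'a \<Rightarrow> 'a \<Rightarrow> real"
  assumes [measurable]: "(\<lambda>((p, s), k). w p s k) \<in> borel_measurable ((borel \<Otimes>\<^sub>M borel) \<Otimes>\<^sub>M borel)"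
    and w: "\<And>p s q. \<bar>w p s q\<bar> \<le> 1"
  shows "(LINT (z, k)|((U \<Otimes>\<^sub>M U) \<Otimes>\<^sub>M lborel). (case z of (p, s) \<Rightarrow> w p s (p + k) * indicator E (p + k)) * excitation z k) =
    (LINT ((p, s), q)|Q. w p s q * (vh (q - p) - vh (q - s))\<^sup>2)"
proof -
  let ?B = "(LINT x|lborel. \<bar>v x\<bar>)"
  let ?H = "\<lambda>z k. (case z of (p, s) \<Rightarrow> w p s (p + k) * indicator E (p + k)) * excitation z k"
  let ?R = "\<lambda>z q. case z of (p, s) \<Rightarrow> w p s q * (vh (q - p) - vh (q - s))\<^sup>2"
  have wm [measurable]: "(\<lambda>x. w (f x) (g x) (h x)) \<in> borel_measurable N"
    if "f \<in> measurable N borel" "g \<in> measurable N borel" "h \<in> measurable N borel" for f g h and N :: "'c measure"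
    using measurable_compose[OF measurable_Pair[OF measurable_Pair[OF that(1,2)] that(3)] assms(1)] by simp
  have Hi: "integrable ((U \<Otimes>\<^sub>M U) \<Otimes>\<^sub>M lborel) (case_prod ?H)"
    by (rule integral_excitation_restricted)
       (use w in \<open>auto simp: split_beta indicator_def abs_mult\<close>)
  have Ri: "integrable Q (case_prod ?R)"
  proof (rule bounded_integrable_Q[where B = "(2 * ?B)\<^sup>2"])
    show "case_prod ?R \<in> borel_measurable Q" unfolding split_beta by measurable
    fix x :: "('a \<times> 'a) \<times> 'a"
    obtain p s q where x: "x = ((p, s), q)" by (metis surj_pair)
    have "\<bar>vh (q - p) - vh (q - s)\<bar> \<le> 2 * ?B"
      using vh_bounded[of "q - p"] vh_bounded[of "q - s"] by linarith
    then have "(vh (q - p) - vh (q - s))\<^sup>2 \<le> (2 * ?B)\<^sup>2"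
      using power_mono[OF _ abs_ge_zero, of _ _ 2] by fastforce
    then have "\<bar>w p s q\<bar> * (vh (q - p) - vh (q - s))\<^sup>2 \<le> 1 * (2 * ?B)\<^sup>2"
      by (intro mult_mono w) auto
    then show "\<bar>case_prod ?R x\<bar> \<le> (2 * ?B)\<^sup>2" by (simp add: x abs_mult)
  qed
  have "(LINT (z, k)|((U \<Otimes>\<^sub>M U) \<Otimes>\<^sub>M lborel). ?H z k) = (LINT z|(U \<Otimes>\<^sub>M U). LINT k|lborel. ?H z k)"
    by (rule UUL.integral_fst[OF Hi, symmetric])
  also have "\<dots> = (LINT z|(U \<Otimes>\<^sub>M U). LINT q|U. ?R z q)"
  proof (rule Bochner_Integration.integral_cong[OF refl])
    fix z :: "'a \<times> 'a"
    obtain p s where z: "z = (p, s)" by (cases z)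
    have "(LINT q|U. w p s q * (vh (q - p) - vh (q - s))\<^sup>2) = (LINT q|lborel. indicator E q *\<^sub>R (w p s q * (vh (q - p) - vh (q - s))\<^sup>2))"
      by (rule integral_U) measurable
    also have "\<dots> = (LINT k|lborel. indicator E (p + k) *\<^sub>R (w p s (p + k) * (vh (p + k - p) - vh (p + k - s))\<^sup>2))"
      by (rule integral_lborel_shift[symmetric]) measurable
    finally show "(LINT k|lborel. ?H z k) = (LINT q|U. ?R z q)"
      by (simp add: z excitation_def algebra_simps)
  qed
  also have "\<dots> = (LINT x|Q. case_prod ?R x)"
    by (rule UUU.integral_fst[OF Ri])
  also have "\<dots> = (LINT ((p, s), q)|Q. w p s q * (vh (q - p) - vh (q - s))\<^sup>2)"
    by (intro Bochner_Integration.integral_cong refl) auto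
  finally show ?thesis .
qed

text \<open>Inclusion and exclusion over the two final momenta. No condition gives the pair term;
  the two single conditions agree and together give
  \<open>- 4 * (K (a + b))\<^sup>2 + 4 * (K a * K b * K (a + b))\<close>; both conditions at once
  give \<open>2 * A (a + b) - 2 * C a b\<close>.\<close>

theorem limit_variance_eq:
  "limit_variance = (LINT (z, k)|((U \<Otimes>\<^sub>M U) \<Otimes>\<^sub>M lborel). unoccupied z k * excitation z k)"
proof -
  let ?N = "(U \<Otimes>\<^sub>M U) \<Otimes>\<^sub>M (lborel :: 'a measure)"
  let ?h1 = "\<lambda>z k. case z of (p, s) \<Rightarrow> (indicator E (p + k) :: real)"
  let ?h2 = "\<lambda>z k. case z of (p, s) \<Rightarrow> (indicator E (s - k) :: real)"
  let ?h3 = "\<lambda>z k. case z of (p, s) \<Rightarrow> indicator E (s - k) * (indicator E (p + k) :: real)"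
  have i: "integrable ?N (\<lambda>(z, k). ?h1 z k * excitation z k)" "integrable ?N (\<lambda>(z, k). ?h2 z k * excitation z k)"
      "integrable ?N (\<lambda>(z, k). ?h3 z k * excitation z k)"
    by (rule integral_excitation_restricted; (unfold split_beta)?; auto simp: indicator_def)+
  have sep: "(LINT (z, k)|?N. unoccupied z k * excitation z k) =
    (LINT x|?N. case_prod excitation x) - (LINT (z, k)|?N. ?h1 z k * excitation z k) -
    (LINT (z, k)|?N. ?h2 z k * excitation z k) + (LINT (z, k)|?N. ?h3 z k * excitation z k)"
  proof -
    have "(LINT (z, k)|?N. unoccupied z k * excitation z k) =
      (LINT x|?N. case_prod excitation x - (case x of (z, k) \<Rightarrow> ?h1 z k * excitation z k) -
        (case x of (z, k) \<Rightarrow> ?h2 z k * excitation z k) + (case x of (z, k) \<Rightarrow> ?h3 z k * excitation z k))"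
      by (intro Bochner_Integration.integral_cong refl) (auto simp: unoccupied_def algebra_simps split: prod.splits)
    also have "\<dots> = (LINT x|?N. case_prod excitation x) - (LINT (z, k)|?N. ?h1 z k * excitation z k) -
      (LINT (z, k)|?N. ?h2 z k * excitation z k) + (LINT (z, k)|?N. ?h3 z k * excitation z k)"
      by (rule integral_diff_diff_add) (use i excitation_integrable in auto)
    finally show ?thesis .
  qed
  have K3: "(LINT ((p, s), q)|Q. 1 *\<^sub>R ee ((q - p) \<bullet> a + (q - s) \<bullet> b)) = of_real (K a * K b * K (a + b))" for a b
    using integral_UUU_ee[of a b] by simp
  have one: "(LINT ((p, s), q)|Q. 1 * (vh (q - p) - vh (q - s))\<^sup>2) =
     (LINT (a, b)|(lborel \<Otimes>\<^sub>M lborel). v a * v b * (K (a + b) * K 0 * K (a + b + 0) + K 0 * K (a + b) * K (0 + (a + b)) - 2 * (K a * K b * K (a + b))))"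
    and one_i: "integrable (lborel \<Otimes>\<^sub>M lborel) (\<lambda>(a, b). v a * v b * (K (a + b) * K 0 * K (a + b + 0) + K 0 * K (a + b) * K (0 + (a + b)) - 2 * (K a * K b * K (a + b))))"
    using integral_vh_diff_square[of "\<lambda>_. 1" "\<lambda>a b. K a * K b * K (a + b)", OF _ _ K3] by simp_all
  have h1: "(LINT (z, k)|?N. ?h1 z k * excitation z k) = (LINT ((p, s), q)|Q. 1 * (vh (q - p) - vh (q - s))\<^sup>2)"
  proof -
    have "(\<lambda>((p :: 'a, s :: 'a), k :: 'a). 1 :: real) \<in> borel_measurable ((borel \<Otimes>\<^sub>M borel) \<Otimes>\<^sub>M borel)"
      unfolding split_beta by measurable
    from integral_excitation_reflected[OF this] show ?thesis by (simp add: split_beta)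
  qed
  \<comment> \<open>Reflecting \<open>k\<close> to \<open>s - p - k\<close> exchanges the two final
    momenta; the excitation is invariant because \<open>vh\<close> is even.\<close>
  have h2: "(LINT (z, k)|?N. ?h2 z k * excitation z k) = (LINT (z, k)|?N. ?h1 z k * excitation z k)"
  proof -
    have "(LINT k|lborel. ?h2 z k * excitation z k) = (LINT k|lborel. ?h1 z k * excitation z k)" for z
    proof -
      obtain p s where z: "z = (p, s)" by (cases z)
      let ?F = "\<lambda>k. indicator E (s - k) * (vh k - vh (k + p - s))\<^sup>2"
      have "(LINT k|lborel. ?F k) = (LINT k|lborel. ?F (s - p - k))"
        by (rule integral_lborel_reflect[symmetric]) measurable
      also have "\<dots> = (LINT k|lborel. indicator E (p + k) * (vh k - vh (k + p - s))\<^sup>2)"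
      proof (intro Bochner_Integration.integral_cong refl)
        fix k
        have "vh (s - p - k) = vh (k + p - s)" using vh_minus[of "k + p - s"] by (simp add: algebra_simps)
        moreover have "s - (s - p - k) = p + k" "s - p - k + p - s = - k" by simp_all
        ultimately show "?F (s - p - k) = indicator E (p + k) * (vh k - vh (k + p - s))\<^sup>2"
          by (simp add: power2_commute add.commute)
      qed
      finally show ?thesis by (simp add: z excitation_def)
    qed
    then show ?thesis
      using UUL.integral_fst[OF i(1)] UUL.integral_fst[OF i(2)] by simp
  qed
  \<comment> \<open>For \<open>q = p + k\<close> the other final momentum \<open>s - k\<close> is
    \<open>s + p - q\<close>.\<close>
  have h3: "(LINT (z, k)|?N. ?h3 z k * excitation z k) = (LINT ((p, s), q)|Q. indicator E (s + p - q) * (vh (q - p) - vh (q - s))\<^sup>2)"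
  proof -
    have m: "(\<lambda>((p, s), k). indicator E (s + p - k) :: real) \<in> borel_measurable ((borel \<Otimes>\<^sub>M borel) \<Otimes>\<^sub>M borel)"
      unfolding split_beta by measurable
    have "(LINT (z, k)|?N. (case z of (p, s) \<Rightarrow> indicator E (s + p - (p + k)) * indicator E (p + k)) * excitation z k) =
      (LINT ((p, s), q)|Q. indicator E (s + p - q) * (vh (q - p) - vh (q - s))\<^sup>2)"
      by (rule integral_excitation_reflected[OF m]) (auto simp: indicator_def)
    then show ?thesis by (simp add: split_beta)
  qed
  have A_0: "C c 0 = A c" "C 0 c = A c" for c
    unfolding A_def C_def by (intro Bochner_Integration.integral_cong refl; simp add: power2_eq_square)+
  have two: "(LINT ((p, s), q)|Q. indicator E (s + p - q) * (vh (q - p) - vh (q - s))\<^sup>2) =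
     (LINT (a, b)|(lborel \<Otimes>\<^sub>M lborel). v a * v b * (C (a + b) 0 + C 0 (a + b) - 2 * C a b))"
    and two_i: "integrable (lborel \<Otimes>\<^sub>M lborel) (\<lambda>(a, b). v a * v b * (C (a + b) 0 + C 0 (a + b) - 2 * C a b))"
  proof -
    let ?w = "\<lambda>((p, s), q). indicator E (s + p - q) :: real"
    have w: "?w \<in> borel_measurable Q" unfolding split_beta by measurable
    have F: "(LINT ((p, s), q)|Q. ?w ((p, s), q) *\<^sub>R ee ((q - p) \<bullet> a + (q - s) \<bullet> b)) = of_real (C a b)" for a b
      using integral_UUU_indicator_ee[of a b] by simp
    have w1: "\<bar>?w x\<bar> \<le> 1" for x by (auto simp: indicator_def split_beta)
    show "(LINT ((p, s), q)|Q. indicator E (s + p - q) * (vh (q - p) - vh (q - s))\<^sup>2) =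
     (LINT (a, b)|(lborel \<Otimes>\<^sub>M lborel). v a * v b * (C (a + b) 0 + C 0 (a + b) - 2 * C a b))"
     and "integrable (lborel \<Otimes>\<^sub>M lborel) (\<lambda>(a, b). v a * v b * (C (a + b) 0 + C 0 (a + b) - 2 * C a b))"
      using integral_vh_diff_square[of ?w C, OF w w1 F] by simp_all
  qed
  have "(LINT (a, b)|(lborel \<Otimes>\<^sub>M lborel). v a * v b *
      (2 * A (a + b) - 2 * C a b - 4 * (K (a + b))\<^sup>2 + 4 * (K a * K b * K (a + b)))) =
    (LINT x|(lborel \<Otimes>\<^sub>M lborel). (case x of (a, b) \<Rightarrow> v a * v b * (C (a + b) 0 + C 0 (a + b) - 2 * C a b)) -
      2 * (case x of (a, b) \<Rightarrow> v a * v b * (K (a + b) * K 0 * K (a + b + 0) + K 0 * K (a + b) * K (0 + (a + b)) - 2 * (K a * K b * K (a + b)))))"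
    by (intro Bochner_Integration.integral_cong refl) (auto simp: A_0 power2_eq_square algebra_simps)
  also have "\<dots> = (LINT (a, b)|(lborel \<Otimes>\<^sub>M lborel). v a * v b * (C (a + b) 0 + C 0 (a + b) - 2 * C a b)) -
     2 * (LINT (a, b)|(lborel \<Otimes>\<^sub>M lborel). v a * v b * (K (a + b) * K 0 * K (a + b + 0) + K 0 * K (a + b) * K (0 + (a + b)) - 2 * (K a * K b * K (a + b))))"
    using one_i two_i by simp
  finally show ?thesis
    unfolding limit_variance_def sep excitation_total h2 h1 h3 one two by simp
qed

end

section \<open>Positivity\<close>

text \<open>A translation by \<open>t n\<close> with \<open>k n \<bullet> t n = 1/2\<close>, half a
  wavelength, reverses the sign of the exponential. Hence twice the transform is bounded by the L1
  distance between \<open>f\<close> and its translate, and \<open>t n\<close> tends to 0.\<close>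

lemma riemann_lebesgue:
  fixes f :: "'a::euclidean_space \<Rightarrow> complex"
  assumes f: "integrable lborel f" and k: "filterlim (\<lambda>n. norm (k n)) at_top sequentially"
  shows "(\<lambda>n. fourier f (k n)) \<longlonglongrightarrow> 0"
proof -
  have [measurable]: "f \<in> borel_measurable borel" using f by auto
  define t where "t n = k n /\<^sub>R (2 * (norm (k n))\<^sup>2)" for n
  have "(\<lambda>n. inverse (2 * norm (k n))) \<longlonglongrightarrow> 0"
    by (intro tendsto_inverse_0_at_top filterlim_tendsto_pos_mult_at_top[OF tendsto_const _ k]) auto
  moreover have "norm (t n) = inverse (2 * norm (k n))" for n
    by (simp add: t_def power2_eq_square divide_simps)
  ultimately have "(\<lambda>n. norm (t n)) \<longlonglongrightarrow> 0"
    by (simp only:)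
  then have "t \<longlonglongrightarrow> 0"
    by (rule tendsto_norm_zero_cancel)
  then have "(\<lambda>n. LINT x|lborel. norm (f (x - t n) - f (x - 0))) \<longlonglongrightarrow> 0"
    by (rule translation_continuous_L1[OF f])
  then have lim: "(\<lambda>n. (LINT x|lborel. norm (f (x - t n) - f x)) / 2) \<longlonglongrightarrow> 0"
    using tendsto_divide[OF _ tendsto_const, of _ 0 sequentially "2::real"] by fastforce
  have "eventually (\<lambda>n. norm (k n) > 0) sequentially"
    using k unfolding filterlim_at_top_dense by blast
  then have "eventually (\<lambda>n. norm (fourier f (k n)) \<le> (LINT x|lborel. norm (f (x - t n) - f x)) / 2) sequentially"
  proof eventually_elim
    case (elim n)
    have kt: "k n \<bullet> t n = 1/2"
      using elim by (simp add: t_def power2_norm_eq_inner)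
    have shift: "integrable lborel (\<lambda>x. f (x - t n))"
      using integrable_lborel_shift[OF f, of "- t n"] by (simp add: algebra_simps)
    have "fourier f (k n) = (LINT x|lborel. ee (k n \<bullet> (- t n + x)) * f (- t n + x))"
      unfolding fourier_def by (rule integral_lborel_shift[symmetric]) measurable
    also have "\<dots> = (LINT x|lborel. - (ee (k n \<bullet> x) * f (x - t n)))"
    proof (intro Bochner_Integration.integral_cong refl)
      fix x
      have "ee (k n \<bullet> (- t n + x)) = ee (- (1/2)) * ee (k n \<bullet> x)"
        by (simp add: inner_diff_right kt flip: ee_add)
      also have "ee (- (1/2)) = - 1" by (simp add: ee_def complex_eq_iff)
      finally show "ee (k n \<bullet> (- t n + x)) * f (- t n + x) = - (ee (k n \<bullet> x) * f (x - t n))"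
        by simp
    qed
    finally have "fourier f (k n) + fourier f (k n) = (LINT x|lborel. ee (k n \<bullet> x) * f x) - (LINT x|lborel. ee (k n \<bullet> x) * f (x - t n))"
      by (simp add: fourier_def)
    also have "\<dots> = (LINT x|lborel. ee (k n \<bullet> x) * f x - ee (k n \<bullet> x) * f (x - t n))"
      by (rule Bochner_Integration.integral_diff[symmetric]) (intro fourier_integrable f shift)+
    also have "norm \<dots> \<le> (LINT x|lborel. norm (ee (k n \<bullet> x) * f x - ee (k n \<bullet> x) * f (x - t n)))"
      by (rule integral_norm_bound)
    also have "\<dots> = (LINT x|lborel. norm (f (x - t n) - f x))"
      by (intro Bochner_Integration.integral_cong refl) (simp add: norm_mult norm_minus_commute flip: right_diff_distrib)
    finally have "norm (2 * fourier f (k n)) \<le> (LINT x|lborel. norm (f (x - t n) - f x))"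
      by simp
    then show ?case by (simp add: norm_mult)
  qed
  then show ?thesis
    by (rule Lim_null_comparison[OF _ lim])
qed

lemma continuous_AE_zero:
  fixes f :: "'a::euclidean_space \<Rightarrow> real"
  assumes f: "continuous_on UNIV f" and ae: "AE x in lborel. f x = 0"
  shows "f x = 0"
proof (rule ccontr)
  assume "f x \<noteq> 0"
  moreover have o: "open {x. f x \<noteq> 0}"
    using f by (intro open_Collect_neq continuous_intros)
  ultimately obtain e where e: "e > 0" "ball x e \<subseteq> {x. f x \<noteq> 0}"
    by (auto simp: open_contains_ball)
  have "emeasure lborel {x. f x \<noteq> 0} = 0"
    using ae o by (subst (asm) AE_iff_measurable[of "{x. f x \<noteq> 0}"]) auto
  then have "emeasure lborel (ball x e) = 0"
    using emeasure_mono[OF e(2), of lborel] o by (simp add: borel_open)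
  then have "measure lborel (ball x e) = 0" by (simp add: measure_def)
  with content_ball_pos[OF e(1), of x] show False by simp
qed

section \<open>Momenta with prescribed vacancies\<close>

context spectral_set
begin

text \<open>With \<open>s = p - w\<close>: \<open>p\<close> and \<open>s\<close> lie in
  \<open>E\<close>, the final momenta \<open>p + k\<close> and \<open>s - k\<close> do not. The
  transfers compared by the excitation are then \<open>k\<close> and \<open>k + w\<close>.\<close>

definition vacancy :: "'a \<Rightarrow> 'a \<Rightarrow> 'a \<Rightarrow> real" where
  "vacancy k w p = indicator E p * indicator E (p - w) * (1 - indicator E (p + k)) * (1 - indicator E (p - (w + k)))"

definition vacancy_measure :: "'a \<Rightarrow> 'a \<Rightarrow> real" where
  "vacancy_measure k w = (LINT p|lborel. vacancy k w p)"

lemma vacancy_bounds: "0 \<le> vacancy k w p" "vacancy k w p \<le> indicator E p"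
  by (auto simp: vacancy_def indicator_def)

lemma vacancy_measurable [measurable]:
  "(\<lambda>((k, w), p). vacancy k w p) \<in> borel_measurable ((borel \<Otimes>\<^sub>M borel) \<Otimes>\<^sub>M borel)"
  "vacancy k w \<in> borel_measurable borel"
  unfolding vacancy_def split_beta by measurable

lemma vacancy_integrable: "integrable lborel (vacancy k w)"
  by (rule Bochner_Integration.integrable_bound[OF indicator_E_integrable]) (use vacancy_bounds in auto)

text \<open>The difference of two products of indicators is at most the sum of the differences of
  the factors, and each of these tends to 0 by continuity of translations in L1. This continuity
  serves twice: to pass from almost every to every \<open>(k, w)\<close>, and to move
  \<open>w\<close> off a multiple of \<open>k\<close>.\<close>

lemma vacancy_measure_tendsto:
  assumes k: "k \<longlonglongrightarrow> k'" and w: "w \<longlonglongrightarrow> w'"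
  shows "(\<lambda>n. vacancy_measure (k n) (w n)) \<longlonglongrightarrow> vacancy_measure k' w'"
proof -
  let ?i = "indicator E :: 'a \<Rightarrow> real"
  let ?d = "\<lambda>s t. LINT p|lborel. norm (?i (p - s) - ?i (p - t))"
  have d: "(\<lambda>n. ?d (s n) t) \<longlonglongrightarrow> 0" if "s \<longlonglongrightarrow> t" for s t
    by (rule translation_continuous_L1[OF indicator_E_integrable that])
  have i: "integrable lborel (\<lambda>p. ?i (p - s))" for s
    using integrable_lborel_shift[OF indicator_E_integrable, of "- s"] by (simp add: algebra_simps)
  have "(\<lambda>n. ?d (w n) w' + ?d (- k n) (- k') + ?d (w n + k n) (w' + k')) \<longlonglongrightarrow> 0 + 0 + 0"
    by (intro tendsto_add d tendsto_minus k w)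
  then have lim: "(\<lambda>n. ?d (w n) w' + ?d (- k n) (- k') + ?d (w n + k n) (w' + k')) \<longlonglongrightarrow> 0"
    by simp
  have "norm (vacancy_measure (k n) (w n) - vacancy_measure k' w') \<le> ?d (w n) w' + ?d (- k n) (- k') + ?d (w n + k n) (w' + k')" for n
  proof -
    have "norm (vacancy_measure (k n) (w n) - vacancy_measure k' w') = norm (LINT p|lborel. vacancy (k n) (w n) p - vacancy k' w' p)"
      unfolding vacancy_measure_def using vacancy_integrable by simp
    also have "\<dots> \<le> (LINT p|lborel. norm (vacancy (k n) (w n) p - vacancy k' w' p))"
      by (rule integral_norm_bound)
    also have "\<dots> \<le> (LINT p|lborel. norm (?i (p - w n) - ?i (p - w')) + norm (?i (p - (- k n)) - ?i (p - (- k'))) +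
        norm (?i (p - (w n + k n)) - ?i (p - (w' + k'))))"
    proof (rule integral_mono)
      show "integrable lborel (\<lambda>p. norm (vacancy (k n) (w n) p - vacancy k' w' p))"
        using vacancy_integrable by (intro integrable_norm Bochner_Integration.integrable_diff)
    qed (use i[of "w n"] i[of w'] i[of "- k n"] i[of "- k'"] i[of "w n + k n"] i[of "w' + k'"]
           in \<open>auto simp: vacancy_def indicator_def\<close>)
    also have "\<dots> = ?d (w n) w' + ?d (- k n) (- k') + ?d (w n + k n) (w' + k')"
      using i[of "w n"] i[of w'] i[of "- k n"] i[of "- k'"] i[of "w n + k n"] i[of "w' + k'"] by simp
    finally show ?thesis .
  qed
  then have "(\<lambda>n. vacancy_measure (k n) (w n) - vacancy_measure k' w') \<longlonglongrightarrow> 0"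
    by (intro Lim_null_comparison[OF _ lim]) auto
  then show ?thesis by (simp add: LIM_zero_iff)
qed

lemma vacancy_measure_continuous: "continuous_on UNIV (\<lambda>(k, w). vacancy_measure k w)"
proof -
  have "isCont (\<lambda>(k, w). vacancy_measure k w) x" for x
    unfolding continuous_at_sequentially o_def split_beta
    by (auto intro!: vacancy_measure_tendsto tendsto_fst tendsto_snd)
  then show ?thesis by (simp add: continuous_at_imp_continuous_on)
qed

text \<open>If the shift carried \<open>E\<close> into itself, equality of measures would make
  \<open>E\<close> invariant almost everywhere, and \<open>K x\<close> would equal
  \<open>ee (- (x \<bullet> k)) * K x\<close>. But \<open>K\<close> does not vanish near 0, while
  the phase differs from 1 for small positive multiples \<open>x\<close> of
  \<open>k\<close>.\<close>

lemma not_shift_invariant: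
  assumes k: "k \<noteq> 0"
  shows "\<not> (AE p in lborel. p \<in> E \<longrightarrow> p + k \<in> E)"
proof
  assume ae: "AE p in lborel. p \<in> E \<longrightarrow> p + k \<in> E"
  let ?i = "indicator E :: 'a \<Rightarrow> real"
  have ik: "integrable lborel (\<lambda>p. ?i (k + p))"
    by (rule integrable_lborel_shift[OF indicator_E_integrable])
  have eq: "(LINT p|lborel. ?i (k + p)) = (LINT p|lborel. ?i p)"
    by (rule integral_lborel_shift) measurable
  have "(LINT p|lborel. ?i (k + p) - ?i p) = 0"
    using ik indicator_E_integrable eq by simp
  moreover have "AE p in lborel. 0 \<le> ?i (k + p) - ?i p"
    using ae by eventually_elim (auto simp: indicator_def add.commute)
  ultimately have "AE p in lborel. ?i (k + p) - ?i p = 0"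
    using integral_nonneg_eq_0_iff_AE[of lborel "\<lambda>p. ?i (k + p) - ?i p"] ik indicator_E_integrable by auto
  then have ae_eq: "AE p in lborel. indicator E (k + p) = (indicator E p :: complex)"
    by eventually_elim (auto simp: indicator_def split: if_splits)
  have Kx: "of_real (K x) = ee (- (x \<bullet> k)) * of_real (K x)" for x
  proof -
    have "of_real (K x) = (LINT p|lborel. ee (x \<bullet> p) * indicator E p)"
      by (simp add: fourier_indicator_eq[symmetric] fourier_def)
    also have "\<dots> = (LINT p|lborel. ee (x \<bullet> p) * indicator E (k + p))"
      using ae_eq by (intro integral_cong_AE) auto
    also have "\<dots> = (LINT p|lborel. (\<lambda>u. ee (x \<bullet> (u - k)) * indicator E u) (k + p))"
      by simp
    also have "\<dots> = (LINT u|lborel. ee (x \<bullet> (u - k)) * indicator E u)"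
      by (rule integral_lborel_shift) measurable
    also have "\<dots> = (LINT u|lborel. ee (- (x \<bullet> k)) * (ee (x \<bullet> u) * indicator E u))"
      by (intro Bochner_Integration.integral_cong refl) (simp add: inner_diff_right flip: ee_add mult.assoc)
    also have "\<dots> = ee (- (x \<bullet> k)) * of_real (K x)"
      by (simp only: integral_mult_right_zero fourier_def[symmetric] fourier_indicator_eq)
    finally show ?thesis .
  qed
  have "isCont K 0"
    using K_continuous by (simp add: continuous_on_eq_continuous_at)
  from this[unfolded continuous_at_eps_delta, rule_format, of 1]
  obtain d where d: "d > 0" "\<And>x. dist x 0 < d \<Longrightarrow> dist (K x) (K 0) < 1"
    by auto
  then have d: "d > 0" "\<And>x. norm x < d \<Longrightarrow> K x \<noteq> 0"
    by (force simp: dist_real_def)+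
  \<comment> \<open>The first bound keeps \<open>t *\<^sub>R k\<close> where \<open>K\<close> is
    nonzero; the second keeps the angle \<open>2 * pi * (t * (norm k)\<^sup>2)\<close> positive and
    at most \<open>pi\<close>, where the cosine is below 1.\<close>
  define t where "t = min (d / (2 * norm k)) (1 / (2 * (norm k)\<^sup>2))"
  have t: "t > 0" "t \<le> d / (2 * norm k)" "t \<le> 1 / (2 * (norm k)\<^sup>2)" using k d by (auto simp: t_def)
  have "norm (t *\<^sub>R k) \<le> d / 2" using t k by (simp add: field_simps)
  then have "K (t *\<^sub>R k) \<noteq> 0" using d by simp
  then have "ee (- ((t *\<^sub>R k) \<bullet> k)) = 1"
    using Kx[of "t *\<^sub>R k"] by simp
  then have "Re (ee (- ((t *\<^sub>R k) \<bullet> k))) = 1" by simp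
  then have "cos (2 * pi * (t * (norm k)\<^sup>2)) = 1"
    by (simp add: ee_def power2_norm_eq_inner)
  moreover have "0 < t * (norm k)\<^sup>2" "t * (norm k)\<^sup>2 \<le> 1/2"
    using t k by (auto simp: field_simps)
  then have "cos (2 * pi * (t * (norm k)\<^sup>2)) < cos 0"
    by (intro cos_monotone_0_pi) auto
  ultimately show False by simp
qed

text \<open>On the line \<open>p + \<int> k\<close>, the point \<open>p\<close> is the upper end of a maximal run of points of \<open>E\<close>, and
  \<open>p - n k\<close> is the lower end of that run.\<close>

lemma vacancy_measure_pos:
  assumes k: "k \<noteq> 0"
  shows "\<exists>n::nat. vacancy_measure k (real n *\<^sub>R k) > 0"
proof (rule ccontr)
  assume "\<not> (\<exists>n::nat. vacancy_measure k (real n *\<^sub>R k) > 0)"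
  then have "vacancy_measure k (real n *\<^sub>R k) = 0" for n
    using Bochner_Integration.integral_nonneg[of lborel "vacancy k (real n *\<^sub>R k)"] vacancy_bounds
    by (metis antisym not_less vacancy_measure_def)
  then have "AE p in lborel. vacancy k (real n *\<^sub>R k) p = 0" for n
    using integral_nonneg_eq_0_iff_AE[OF vacancy_integrable, of k "real n *\<^sub>R k"] vacancy_bounds
    by (auto simp: vacancy_measure_def)
  then have "AE p in lborel. \<forall>n. vacancy k (real n *\<^sub>R k) p = 0"
    by (simp add: AE_all_countable)
  \<comment> \<open>If all vacancy sets are null, a run with upper end \<open>p\<close> has no lower
    end: \<open>p - n k\<close> in \<open>E\<close> forces \<open>p - (n + 1) k\<close> in
    \<open>E\<close>.\<close>
  then have run: "AE p in lborel. p \<in> E \<and> p + k \<notin> E \<longrightarrow> (\<forall>n. p - real n *\<^sub>R k \<in> E)"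
  proof eventually_elim
    case (elim p)
    show ?case
    proof (intro impI allI)
      fix n assume p: "p \<in> E \<and> p + k \<notin> E"
      show "p - real n *\<^sub>R k \<in> E"
      proof (induction n)
        case (Suc n)
        have "p - (real n *\<^sub>R k + k) \<in> E"
          using elim[rule_format, of n] p Suc by (auto simp: vacancy_def indicator_def split: if_splits)
        then show ?case by (simp add: algebra_simps)
      qed (use p in simp)
    qed
  qed
  define B where "B = {p. p + k \<notin> E \<and> (\<forall>n::nat. p - real n *\<^sub>R k \<in> E)}"
  have [measurable]: "B \<in> sets borel" unfolding B_def by measurable
  \<comment> \<open>The translates of \<open>B\<close> by \<open>- n k\<close> are disjoint subsets
    of \<open>E\<close> of equal measure, so the finite measure of \<open>E\<close> makes
    \<open>B\<close> null.\<close>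
  define S where "S n = {q. q + real n *\<^sub>R k \<in> B}" for n
  have [measurable]: "S n \<in> sets borel" for n unfolding S_def by measurable
  have eS: "emeasure lborel (S n) = emeasure lborel B" for n
  proof -
    have "emeasure lborel B = (\<integral>\<^sup>+x. indicator B (real n *\<^sub>R k + x) \<partial>lborel)"
      by (subst nn_integral_lborel_shift) auto
    also have "\<dots> = (\<integral>\<^sup>+x. indicator (S n) x \<partial>lborel)"
      by (intro nn_integral_cong) (auto simp: S_def indicator_def add.commute)
    finally show ?thesis by simp
  qed
  have disj: "disjoint_family S"
  proof -
    have False if "i < j" "q \<in> S i" "q \<in> S j" for i j q
    proof -
      \<comment> \<open>The point \<open>q + (i + 1) k\<close> lies one step above the upper end
        reached from \<open>S i\<close>, hence outside \<open>E\<close>, and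
        \<open>j - i - 1\<close> steps below the one reached from \<open>S j\<close>, hence
        inside.\<close>
      have "q + real j *\<^sub>R k - real (j - i - 1) *\<^sub>R k \<in> E" using that(3) by (auto simp: S_def B_def)
      moreover have "q + real i *\<^sub>R k + k \<notin> E" using that(2) by (auto simp: S_def B_def)
      moreover have "q + real j *\<^sub>R k - real (j - i - 1) *\<^sub>R k = q + real i *\<^sub>R k + k"
        using that(1) by (simp add: of_nat_diff algebra_simps)
      ultimately show False by (simp only:)
    qed
    then show ?thesis
      unfolding disjoint_family_on_def by (metis disjoint_iff linorder_neqE_nat)
  qed
  have "(\<Union>n. S n) \<subseteq> E"
  proof
    fix q assume "q \<in> (\<Union>n. S n)"
    then obtain n where "q + real n *\<^sub>R k \<in> B" by (auto simp: S_def)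
    then have "q + real n *\<^sub>R k - real n *\<^sub>R k \<in> E" unfolding B_def by blast
    then show "q \<in> E" by simp
  qed
  then have "emeasure lborel (\<Union>n. S n) \<le> 1"
    using emeasure_mono[of "\<Union>n. S n" E lborel] by (simp add: E_measure)
  then have le: "(\<Sum>n. emeasure lborel B) \<le> 1"
    using suminf_emeasure[of S lborel] disj by (simp add: eS image_subset_iff)
  have "emeasure lborel B = 0"
  proof (rule ccontr)
    assume "emeasure lborel B \<noteq> 0"
    moreover have "emeasure lborel B \<le> 1"
      using sum_le_suminf[of "\<lambda>_. emeasure lborel B" "{0}"] le by simp
    ultimately obtain b where b: "emeasure lborel B = ennreal b" "b > 0"
      by (cases "emeasure lborel B") (auto simp: less_le top_unique)
    obtain N :: nat where N: "1 < real N * b"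
      using reals_Archimedean3[OF b(2)] by blast
    have "(\<Sum>n<N. emeasure lborel B) \<le> (\<Sum>n. emeasure lborel B)"
      by (rule sum_le_suminf) auto
    with le have "ennreal (real N * b) \<le> 1"
      using b by (simp add: ennreal_mult ennreal_of_nat_eq_real_of_nat)
    with N show False by simp
  qed
  then have "AE p in lborel. p \<notin> B"
    by (subst AE_iff_measurable[of B]) auto
  \<comment> \<open>Almost no point of \<open>E\<close> is an upper end, so the shift by
    \<open>k\<close> carries \<open>E\<close> into itself.\<close>
  with run have "AE p in lborel. p \<in> E \<longrightarrow> p + k \<in> E"
    by eventually_elim (auto simp: B_def)
  with not_shift_invariant[OF k] show False by simp
qed

end

section \<open>Positivity from a level set of the transform\<close>

context even_potential
begin

text \<open>The limit is the integral of the left-hand side over \<open>k\<close> and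
  \<open>w = p - s\<close>. The integrand is nonnegative and continuous, so a vanishing integral
  forces it to vanish at every \<open>(k, w)\<close>, in particular at the single points used in the
  extremal argument.\<close>

lemma excitation_vacancy_zero:
  assumes zero: "limit_variance = 0"
  shows "(vh k - vh (k + w))\<^sup>2 * vacancy_measure k w = 0"
proof -
  let ?g = "\<lambda>z k. unoccupied z k * excitation z k"
  let ?G = "\<lambda>p w k. vacancy k w p * (vh k - vh (k + w))\<^sup>2"
  let ?h = "\<lambda>(k, w). (vh k - vh (k + w))\<^sup>2 * vacancy_measure k w"
  have bm [measurable]: "case_prod unoccupied \<in> borel_measurable ((borel \<Otimes>\<^sub>M borel) \<Otimes>\<^sub>M borel)"
    unfolding unoccupied_def split_beta by measurable
  have b01: "0 \<le> unoccupied z k" "\<bar>unoccupied z k\<bar> \<le> 1" for z k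
    by (auto simp: unoccupied_def indicator_def split: prod.splits)
  have gi: "integrable ((U \<Otimes>\<^sub>M U) \<Otimes>\<^sub>M lborel) (\<lambda>(z, k). ?g z k)"
    by (rule integral_excitation_restricted) (use b01 in auto)
  have gm [measurable]: "(\<lambda>(z, k). ?g z k) \<in> borel_measurable ((borel \<Otimes>\<^sub>M borel) \<Otimes>\<^sub>M borel)"
    by measurable
  have "(\<integral>\<^sup>+x. ennreal (case x of (z, k) \<Rightarrow> ?g z k) \<partial>((U \<Otimes>\<^sub>M U) \<Otimes>\<^sub>M lborel)) = ennreal limit_variance"
    unfolding limit_variance_eq
    by (rule nn_integral_eq_integral[OF gi]) (use b01 excitation_nonneg in \<open>auto intro!: AE_I2\<close>)
  then have "0 = (\<integral>\<^sup>+x. ennreal (case x of (z, k) \<Rightarrow> ?g z k) \<partial>((U \<Otimes>\<^sub>M U) \<Otimes>\<^sub>M lborel))"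
    by (simp add: zero)
  also have "\<dots> = (\<integral>\<^sup>+z. \<integral>\<^sup>+k. ennreal (?g z k) \<partial>lborel \<partial>(U \<Otimes>\<^sub>M U))"
    by (subst lborel.nn_integral_fst[symmetric]) auto
  also have "\<dots> = (\<integral>\<^sup>+p. \<integral>\<^sup>+s. \<integral>\<^sup>+k. ennreal (?g (p, s) k) \<partial>lborel \<partial>U \<partial>U)"
    by (subst U.nn_integral_fst[symmetric]) auto
  also have "\<dots> = (\<integral>\<^sup>+p. indicator E p * (\<integral>\<^sup>+s. indicator E s * (\<integral>\<^sup>+k. ennreal (?g (p, s) k) \<partial>lborel) \<partial>lborel) \<partial>lborel)"
    unfolding U_def by (simp add: nn_integral_density ennreal_indicator)
  \<comment> \<open>With \<open>s = p - w\<close> the excitation no longer depends on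
    \<open>p\<close>, so integrating over \<open>p\<close> innermost will produce
    \<open>vacancy_measure\<close>.\<close>
  also have "\<dots> = (\<integral>\<^sup>+p. indicator E p * (\<integral>\<^sup>+w. indicator E (p - w) * (\<integral>\<^sup>+k. ennreal (?g (p, p - w) k) \<partial>lborel) \<partial>lborel) \<partial>lborel)"
  proof -
    have "(\<integral>\<^sup>+s. indicator E s * (\<integral>\<^sup>+k. ennreal (?g (p, s) k) \<partial>lborel) \<partial>lborel) =
      (\<integral>\<^sup>+w. indicator E (p - w) * (\<integral>\<^sup>+k. ennreal (?g (p, p - w) k) \<partial>lborel) \<partial>lborel)" for p
      by (rule nn_integral_lborel_reflect[symmetric]) measurable
    then show ?thesis by simp
  qed
  also have "\<dots> = (\<integral>\<^sup>+p. \<integral>\<^sup>+w. \<integral>\<^sup>+k. ennreal (?G p w k) \<partial>lborel \<partial>lborel \<partial>lborel)"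
  proof (intro nn_integral_cong)
    fix p
    show "indicator E p * (\<integral>\<^sup>+w. indicator E (p - w) * (\<integral>\<^sup>+k. ennreal (?g (p, p - w) k) \<partial>lborel) \<partial>lborel) =
      (\<integral>\<^sup>+w. \<integral>\<^sup>+k. ennreal (?G p w k) \<partial>lborel \<partial>lborel)"
    proof (cases "p \<in> E")
      case True
      have "indicator E (p - w) * (\<integral>\<^sup>+k. ennreal (?g (p, p - w) k) \<partial>lborel) = (\<integral>\<^sup>+k. ennreal (?G p w k) \<partial>lborel)" for w
      proof (cases "p - w \<in> E")
        case True
        have "?g (p, p - w) k = ?G p w k" for k
          using True \<open>p \<in> E\<close> by (simp add: unoccupied_def excitation_def vacancy_def diff_diff_add algebra_simps)
        then show ?thesis using True by simp
      qed (simp add: vacancy_def)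
      then show ?thesis using True by simp
    qed (simp add: vacancy_def)
  qed
  also have "\<dots> = (\<integral>\<^sup>+w. \<integral>\<^sup>+p. \<integral>\<^sup>+k. ennreal (?G p w k) \<partial>lborel \<partial>lborel \<partial>lborel)"
    unfolding vacancy_def by (rule lborel_pair.Fubini'[symmetric]) measurable
  also have "\<dots> = (\<integral>\<^sup>+w. \<integral>\<^sup>+k. \<integral>\<^sup>+p. ennreal (?G p w k) \<partial>lborel \<partial>lborel \<partial>lborel)"
    unfolding vacancy_def by (intro nn_integral_cong lborel_pair.Fubini'[symmetric]) measurable
  also have "\<dots> = (\<integral>\<^sup>+w. \<integral>\<^sup>+k. ennreal (?h (k, w)) \<partial>lborel \<partial>lborel)"
  proof (intro nn_integral_cong)
    fix w k
    have "(\<integral>\<^sup>+p. ennreal (?G p w k) \<partial>lborel) = ennreal (LINT p|lborel. ?G p w k)"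
      by (rule nn_integral_eq_integral) (use vacancy_integrable vacancy_bounds in auto)
    then show "(\<integral>\<^sup>+p. ennreal (?G p w k) \<partial>lborel) = ennreal (?h (k, w))"
      by (simp add: vacancy_measure_def mult.commute)
  qed
  finally have h0: "(\<integral>\<^sup>+w. \<integral>\<^sup>+k. ennreal (?h (k, w)) \<partial>lborel \<partial>lborel) = 0" ..
  have c: "continuous_on UNIV ?h"
    using vacancy_measure_continuous unfolding split_beta
    by (intro continuous_intros continuous_on_compose2[OF vh_continuous]) auto
  then have hm [measurable]: "?h \<in> borel_measurable borel"
    by (rule borel_measurable_continuous_onI)
  have hp: "0 \<le> ?h x" for x
    by (auto simp: vacancy_measure_def vacancy_bounds intro!: mult_nonneg_nonneg Bochner_Integration.integral_nonneg split: prod.splits)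
  have "(\<integral>\<^sup>+x. ennreal (?h x) \<partial>(lborel \<Otimes>\<^sub>M lborel)) = 0"
    unfolding h0[symmetric] by (rule lborel_pair.nn_integral_snd[symmetric]) (use hm in \<open>simp add: lborel_prod\<close>)
  then have "(\<integral>\<^sup>+x. ennreal (?h x) \<partial>lborel) = 0"
    by (simp only: lborel_prod)
  then have "AE x in lborel. ?h x = 0"
    using hp by (subst (asm) nn_integral_0_iff_AE) (auto simp: antisym_conv)
  then show ?thesis
    using continuous_AE_zero[OF c, of "(k, w)"] by simp
qed

theorem limit_variance_pos:
  assumes nz: "\<not> (AE x in lborel. v x = 0)"
  shows "limit_variance > 0"
proof (rule ccontr)
  assume "\<not> limit_variance > 0"
  moreover have "limit_variance \<ge> 0"
    unfolding limit_variance_eq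
    by (intro Bochner_Integration.integral_nonneg)
       (auto simp: unoccupied_def excitation_nonneg indicator_def intro!: mult_nonneg_nonneg)
  ultimately have zero: "limit_variance = 0" by simp
  have "\<exists>k. vh k \<noteq> 0"
  proof (rule ccontr)
    assume "\<nexists>k. vh k \<noteq> 0"
    then have "(LINT x|lborel. complex_of_real (v x) * cnj (of_real (v x))) = 0"
      using parseval(2)[OF L12_v L12_v] by (simp add: fourier_v)
    then have "(LINT x|lborel. complex_of_real ((v x)\<^sup>2)) = 0"
      by (simp add: power2_eq_square)
    then have "(LINT x|lborel. (v x)\<^sup>2) = 0" by (simp del: of_real_power)
    then have "AE x in lborel. (v x)\<^sup>2 = 0"
      using integral_nonneg_eq_0_iff_AE[OF v_sq] by auto
    with nz show False by simp
  qed
  then obtain k0 where k0: "vh k0 \<noteq> 0" by blast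
  \<comment> \<open>At \<open>k = 0\<close> no vacancy is possible, so the extremal argument has to
    start from a nonzero point; if \<open>k0 = 0\<close>, continuity of \<open>vh\<close> provides
    one nearby.\<close>
  have "\<exists>k. k \<noteq> 0 \<and> vh k \<noteq> 0"
  proof (cases "k0 = 0")
    case True
    obtain b :: 'a where b: "b \<in> Basis" using nonempty_Basis by blast
    have "(\<lambda>n. inverse (real (Suc n)) *\<^sub>R b) \<longlonglongrightarrow> 0 *\<^sub>R b"
      by (intro tendsto_intros LIMSEQ_inverse_real_of_nat)
    then have "(\<lambda>n. vh (inverse (real (Suc n)) *\<^sub>R b)) \<longlonglongrightarrow> vh (0 *\<^sub>R b)"
      by (intro continuous_on_tendsto_compose[OF vh_continuous]) auto
    then have "eventually (\<lambda>n. vh (inverse (real (Suc n)) *\<^sub>R b) \<noteq> 0) sequentially"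
      by (rule tendsto_imp_eventually_ne) (use k0 True in simp)
    then obtain n where "vh (inverse (real (Suc n)) *\<^sub>R b) \<noteq> 0"
      by (auto simp: eventually_sequentially)
    moreover have "inverse (real (Suc n)) *\<^sub>R b \<noteq> 0"
      using nonzero_Basis[OF b] by simp
    ultimately show ?thesis by blast
  next
    case False
    with k0 show ?thesis by blast
  qed
  then obtain k1 where k1: "k1 \<noteq> 0" "vh k1 \<noteq> 0" by blast
  \<comment> \<open>The value \<open>vh k1\<close> is nonzero, so by the Riemann-Lebesgue lemma this
    level set is bounded, and a point of maximal norm exists.\<close>
  define S where "S = {k. vh k = vh k1}"
  have "closed S"
    unfolding S_def by (rule closed_Collect_eq[OF vh_continuous continuous_on_const])
  moreover have "bounded S"
  proof (rule ccontr)
    assume "\<not> bounded S"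
    then have "\<forall>n::nat. \<exists>k\<in>S. norm k > real n"
      unfolding bounded_iff by (metis not_le)
    then obtain k where k: "\<And>n. k n \<in> S" "\<And>n. norm (k n) > real n" by metis
    have "filterlim (\<lambda>n. norm (k n)) at_top sequentially"
      by (rule filterlim_at_top_mono[OF filterlim_real_sequentially]) (auto intro!: always_eventually less_imp_le k(2))
    from riemann_lebesgue[OF L12_D(1)[OF L12_v] this] have "(\<lambda>n. of_real (vh (k n)) :: complex) \<longlonglongrightarrow> 0"
      by (simp add: fourier_v)
    moreover have "vh (k n) = vh k1" for n using k(1) by (simp add: S_def)
    ultimately show False using k1 by (simp add: LIMSEQ_const_iff)
  qed
  ultimately have "compact S" by (simp add: compact_eq_bounded_closed)
  moreover have "S \<noteq> {}" by (auto simp: S_def)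
  ultimately obtain k where k: "k \<in> S" "\<And>l. l \<in> S \<Longrightarrow> norm l \<le> norm k"
    using continuous_attains_sup[of S norm] by (auto intro: continuous_intros)
  have "norm k1 \<le> norm k" using k(2)[of k1] by (simp add: S_def)
  then have "k \<noteq> 0" using k1 by auto
  from vacancy_measure_pos[OF this] obtain n :: nat where n: "vacancy_measure k (real n *\<^sub>R k) > 0" ..
  \<comment> \<open>For \<open>n = 0\<close> the choice \<open>w = n k\<close> would yield a trivial
    equation. The extra multiple of \<open>k\<close> makes \<open>k + w j\<close> strictly longer
    than \<open>k\<close>, and for large \<open>j\<close> the vacancy measure stays
    positive.\<close>
  define w where "w j = real n *\<^sub>R k + inverse (real (Suc j)) *\<^sub>R k" for j
  have "w \<longlonglongrightarrow> real n *\<^sub>R k + 0 *\<^sub>R k"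
    unfolding w_def by (intro tendsto_intros LIMSEQ_inverse_real_of_nat)
  then have "(\<lambda>j. vacancy_measure k (w j)) \<longlonglongrightarrow> vacancy_measure k (real n *\<^sub>R k)"
    by (intro vacancy_measure_tendsto) auto
  from order_tendstoD(1)[OF this n] obtain j where j: "vacancy_measure k (w j) > 0"
    by (auto simp: eventually_sequentially)
  then have "vh (k + w j) = vh k"
    using excitation_vacancy_zero[OF zero, of k "w j"] by simp
  then have "k + w j \<in> S" using k(1) by (simp add: S_def)
  from k(2)[OF this] have "norm (k + w j) \<le> norm k" .
  moreover have "k + w j = (1 + real n + inverse (real (Suc j))) *\<^sub>R k"
    by (simp add: w_def algebra_simps)
  then have "norm (k + w j) = (1 + real n + inverse (real (Suc j))) * norm k"
    by simp
  moreover have "(1 + real n + inverse (real (Suc j))) * norm k > 1 * norm k"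
    using \<open>k \<noteq> 0\<close> by (intro mult_strict_right_mono) (auto simp: add_pos_pos add_nonneg_pos)
  ultimately show False by simp
qed

end

section \<open>Campbell formulas\<close>

lemma finite_distinct_tuples: "finite F \<Longrightarrow> finite (distinct_tuples n F)"
  by (rule finite_subset[of _ "{..<n} \<rightarrow>\<^sub>E F"]) (auto simp: distinct_tuples_def intro!: finite_PiE)

lemma sum_distinct_tuples_Suc:
  assumes F: "finite F"
  shows "(\<Sum>x\<in>distinct_tuples (Suc n) F. G x) = (\<Sum>x\<in>distinct_tuples n F. \<Sum>a\<in>F - x ` {..<n}. G (x(n := a)))"
proof -
  have "(\<Sum>x\<in>distinct_tuples n F. \<Sum>a\<in>F - x ` {..<n}. G (x(n := a))) =
    (\<Sum>(x, a)\<in>(SIGMA x:distinct_tuples n F. F - x ` {..<n}). G (x(n := a)))"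
    using F by (intro sum.Sigma finite_distinct_tuples ballI) auto
  also have "\<dots> = (\<Sum>x\<in>distinct_tuples (Suc n) F. G x)"
  \<comment> \<open>Index \<open>n\<close> is reset to \<open>undefined\<close> because tuples of
    length \<open>n\<close> are extensional on \<open>{..<n}\<close>.\<close>
  proof (rule sum.reindex_bij_witness[where i = "\<lambda>x. (x(n := undefined), x n)" and j = "\<lambda>(x, a). x(n := a)"])
    fix y assume y: "y \<in> distinct_tuples (Suc n) F"
    then have "inj_on y (insert n {..<n})" by (simp add: distinct_tuples_def lessThan_Suc)
    then have "inj_on y {..<n}" "y n \<notin> y ` {..<n}" by auto
    then show "(y(n := undefined), y n) \<in> (SIGMA x:distinct_tuples n F. F - x ` {..<n})"
      using y by (auto simp: distinct_tuples_def PiE_iff extensional_def inj_on_def)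
  next
    fix z assume z: "z \<in> (SIGMA x:distinct_tuples n F. F - x ` {..<n})"
    then obtain x a where x: "z = (x, a)" "x \<in> distinct_tuples n F" "a \<in> F" "a \<notin> x ` {..<n}" by auto
    have "x n = undefined" using x(2) by (auto simp: distinct_tuples_def PiE_iff extensional_def)
    then show "((case z of (x, a) \<Rightarrow> x(n := a))(n := undefined), (case z of (x, a) \<Rightarrow> x(n := a)) n) = z"
      using x \<open>x n = undefined\<close> by (auto simp: fun_eq_iff)
    show "(case z of (x, a) \<Rightarrow> x(n := a)) \<in> distinct_tuples (Suc n) F"
      using x by (auto simp: distinct_tuples_def PiE_iff extensional_def inj_on_def lessThan_Suc)
  qed auto
  finally show ?thesis ..
qed

lemma distinct_tuples_0: "distinct_tuples 0 F = {\<lambda>_. undefined}"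
  by (auto simp: distinct_tuples_def)

lemma sum_distinct_tuples_2:
  assumes F: "finite F"
  shows "(\<Sum>x\<in>distinct_tuples 2 F. g (x 0) (x 1)) = (\<Sum>a\<in>F. \<Sum>b\<in>F - {a}. g a b)"
  using F by (simp add: numeral_2_eq_2 sum_distinct_tuples_Suc distinct_tuples_0 lessThan_Suc)

lemma sum_distinct_tuples_3:
  assumes F: "finite F"
  shows "(\<Sum>x\<in>distinct_tuples 3 F. g (x 0) (x 1) (x 2)) = (\<Sum>a\<in>F. \<Sum>b\<in>F - {a}. \<Sum>c\<in>F - {a, b}. g a b c)"
  using F by (simp add: numeral_3_eq_3 numeral_2_eq_2 sum_distinct_tuples_Suc distinct_tuples_0 lessThan_Suc insert_commute)

lemma sum_distinct_tuples_4:
  assumes F: "finite F"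
  shows "(\<Sum>x\<in>distinct_tuples 4 F. g (x 0) (x 1) (x 2) (x 3)) =
    (\<Sum>a\<in>F. \<Sum>b\<in>F - {a}. \<Sum>c\<in>F - {a, b}. \<Sum>d\<in>F - {a, b, c}. g a b c d)"
  using F by (simp add: eval_nat_numeral sum_distinct_tuples_Suc distinct_tuples_0 lessThan_Suc insert_commute)

text \<open>The terms are sorted by the number of points that the two pairs have in common.\<close>

lemma square_pair_sum:
  fixes w :: "'a \<Rightarrow> 'a \<Rightarrow> real"
  assumes F: "finite F" and sym: "\<And>a b. w a b = w b a"
  shows "(\<Sum>a\<in>F. \<Sum>b\<in>F - {a}. w a b)\<^sup>2 =
    (\<Sum>a\<in>F. \<Sum>b\<in>F - {a}. \<Sum>c\<in>F - {a, b}. \<Sum>d\<in>F - {a, b, c}. w a b * w c d) +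
    4 * (\<Sum>a\<in>F. \<Sum>b\<in>F - {a}. \<Sum>c\<in>F - {a, b}. w a b * w b c) +
    2 * (\<Sum>a\<in>F. \<Sum>b\<in>F - {a}. (w a b)\<^sup>2)"
proof -
  let ?T = "\<Sum>c\<in>F. \<Sum>d\<in>F - {c}. w c d"
  \<comment> \<open>Relative to a fixed pair \<open>(a, b)\<close>, the pair \<open>(c, d)\<close>
    shares both points in 2 orders, shares one point in 4 ways for each further point, or shares
    none.\<close>
  have dec: "?T = 2 * w a b + (\<Sum>c\<in>F - {a, b}. 2 * w a c + 2 * w b c) + (\<Sum>c\<in>F - {a, b}. \<Sum>d\<in>F - {a, b, c}. w c d)"
    if a: "a \<in> F" and b: "b \<in> F - {a}" for a b
  proof -
    have rem: "(\<Sum>x\<in>F - S. f x) = f b + (\<Sum>x\<in>F - insert b S. f x)" if "b \<in> F" "b \<notin> S" for b S and f :: "'a \<Rightarrow> real"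
    proof -
      have "F - insert b S = (F - S) - {b}" by auto
      then show ?thesis using that F by (simp add: sum.remove)
    qed
    have in1: "(\<Sum>d\<in>F - {c}. w c d) = w a c + w b c + (\<Sum>d\<in>F - {a, b, c}. w c d)" if c: "c \<in> F - {a, b}" for c
    proof -
      have "(\<Sum>d\<in>F - {c}. w c d) = w c a + (\<Sum>d\<in>F - {a, c}. w c d)"
        using a c by (intro rem) auto
      also have "(\<Sum>d\<in>F - {a, c}. w c d) = w c b + (\<Sum>d\<in>F - {b, a, c}. w c d)"
        using a b c by (intro rem) auto
      finally show ?thesis by (simp add: insert_commute sym[of c a] sym[of c b])
    qed
    have ina: "(\<Sum>d\<in>F - {a}. w a d) = w a b + (\<Sum>c\<in>F - {a, b}. w a c)"
      using rem[of b "{a}" "w a"] b by (simp add: insert_commute)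
    have inb: "(\<Sum>d\<in>F - {b}. w b d) = w a b + (\<Sum>c\<in>F - {a, b}. w b c)"
      using rem[of a "{b}" "w b"] a b by (auto simp: insert_commute sym[of b a])
    have "?T = (\<Sum>d\<in>F - {a}. w a d) + (\<Sum>c\<in>F - {a}. \<Sum>d\<in>F - {c}. w c d)"
      using rem[of a "{}" "\<lambda>c. \<Sum>d\<in>F - {c}. w c d"] a by simp
    also have "(\<Sum>c\<in>F - {a}. \<Sum>d\<in>F - {c}. w c d) = (\<Sum>d\<in>F - {b}. w b d) + (\<Sum>c\<in>F - {a, b}. \<Sum>d\<in>F - {c}. w c d)"
      using rem[of b "{a}" "\<lambda>c. \<Sum>d\<in>F - {c}. w c d"] b by (simp add: insert_commute)
    also have "(\<Sum>c\<in>F - {a, b}. \<Sum>d\<in>F - {c}. w c d) = (\<Sum>c\<in>F - {a, b}. w a c + w b c + (\<Sum>d\<in>F - {a, b, c}. w c d))"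
      by (intro sum.cong refl in1)
    finally show ?thesis
      unfolding ina inb by (simp add: sum.distrib sum_distrib_left[symmetric])
  qed
  \<comment> \<open>Exchanging the names \<open>a\<close> and \<open>b\<close> puts the common point
    in the middle, so the two kinds of triples merge with total factor 4.\<close>
  have swap: "(\<Sum>a\<in>F. \<Sum>b\<in>F - {a}. \<Sum>c\<in>F - {a, b}. w a b * w a c) = (\<Sum>a\<in>F. \<Sum>b\<in>F - {a}. \<Sum>c\<in>F - {a, b}. w a b * w b c)"
  proof -
    have r: "(\<Sum>a\<in>F. \<Sum>b\<in>F - {a}. f a b) = (\<Sum>a\<in>F. \<Sum>b\<in>F. if b = a then 0 else f a b)" for f :: "'a \<Rightarrow> 'a \<Rightarrow> real"
      using F by (intro sum.cong refl sum.mono_neutral_cong_left) auto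
    have "(\<Sum>a\<in>F. \<Sum>b\<in>F - {a}. \<Sum>c\<in>F - {a, b}. w a b * w a c) =
      (\<Sum>b\<in>F. \<Sum>a\<in>F. if b = a then 0 else \<Sum>c\<in>F - {a, b}. w a b * w a c)"
      unfolding r by (rule sum.swap)
    also have "\<dots> = (\<Sum>b\<in>F. \<Sum>a\<in>F - {b}. \<Sum>c\<in>F - {b, a}. w b a * w a c)"
      unfolding r
    proof (intro sum.cong refl)
      fix b a
      show "(if b = a then 0 else \<Sum>c\<in>F - {a, b}. w a b * w a c) = (if a = b then 0 else \<Sum>c\<in>F - {b, a}. w b a * w a c)"
        by (simp add: sym[of b a] insert_commute)
    qed
    finally show ?thesis .
  qed
  have "?T\<^sup>2 = (\<Sum>a\<in>F. \<Sum>b\<in>F - {a}. w a b * ?T)"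
    by (simp add: power2_eq_square sum_distrib_right)
  also have "\<dots> = (\<Sum>a\<in>F. \<Sum>b\<in>F - {a}. w a b *
    (2 * w a b + (\<Sum>c\<in>F - {a, b}. 2 * w a c + 2 * w b c) + (\<Sum>c\<in>F - {a, b}. \<Sum>d\<in>F - {a, b, c}. w c d)))"
  proof (intro sum.cong refl)
    fix a b assume "a \<in> F" "b \<in> F - {a}"
    from dec[OF this] show "w a b * ?T = w a b *
      (2 * w a b + (\<Sum>c\<in>F - {a, b}. 2 * w a c + 2 * w b c) + (\<Sum>c\<in>F - {a, b}. \<Sum>d\<in>F - {a, b, c}. w c d))"
      by (rule arg_cong)
  qed
  also have "\<dots> = 2 * (\<Sum>a\<in>F. \<Sum>b\<in>F - {a}. (w a b)\<^sup>2) +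
    2 * (\<Sum>a\<in>F. \<Sum>b\<in>F - {a}. \<Sum>c\<in>F - {a, b}. w a b * w a c) +
    2 * (\<Sum>a\<in>F. \<Sum>b\<in>F - {a}. \<Sum>c\<in>F - {a, b}. w a b * w b c) +
    (\<Sum>a\<in>F. \<Sum>b\<in>F - {a}. \<Sum>c\<in>F - {a, b}. \<Sum>d\<in>F - {a, b, c}. w a b * w c d)"
    by (simp add: distrib_left sum.distrib sum_distrib_left power2_eq_square mult_ac)
  finally show ?thesis unfolding swap by simp
qed

text \<open>Pairs inside \<open>L\<close> alone contribute, so the infinite sum has finite support
  and becomes an iterated sum to which \<open>square_pair_sum\<close> applies.\<close>

lemma pair_energy_finite:
  assumes "finite (\<gamma> \<inter> L)"
  shows "pair_energy v L \<gamma> = (\<Sum>a\<in>\<gamma> \<inter> L. \<Sum>b\<in>\<gamma> \<inter> L - {a}. v (a - b))"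
proof -
  let ?F = "\<gamma> \<inter> L"
  let ?P = "SIGMA a:?F. ?F - {a}"
  have fin: "finite ?P" using assms by auto
  have "pair_energy v L \<gamma> = (\<Sum>\<^sub>\<infinity>(x, y)\<in>?P. indicator L x * indicator L y * v (x - y))"
    unfolding pair_energy_def
    by (rule infsum_cong_neutral) (auto simp: indicator_def)
  also have "\<dots> = (\<Sum>(x, y)\<in>?P. indicator L x * indicator L y * v (x - y))"
    using fin by (rule infsum_finite)
  also have "\<dots> = (\<Sum>(x, y)\<in>?P. v (x - y))"
    by (intro sum.cong refl) auto
  also have "\<dots> = (\<Sum>a\<in>?F. \<Sum>b\<in>?F - {a}. v (a - b))"
    using assms by (intro sum.Sigma[symmetric]) auto
  finally show ?thesis .
qed

section \<open>Measurability and Campbell's formula\<close>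

abbreviation Tup :: "nat \<Rightarrow> (nat \<Rightarrow> 'a::euclidean_space) measure" where
  "Tup n \<equiv> PiM {..<n} (\<lambda>_. lborel)"

context
  fixes M :: "'a::euclidean_space set measure"
  assumes M: "point_process M"
begin

lemma space_point_process: "space M = configurations"
proof -
  have "space M = space (configuration_space :: 'a set measure)"
    using M sets_eq_imp_space_eq unfolding point_process_def by blast
  then show ?thesis by (simp add: configuration_space_def space_measure_of_conv)
qed

lemma finite_configuration: "\<gamma> \<in> space M \<Longrightarrow> bounded L \<Longrightarrow> finite (\<gamma> \<inter> L)"
  by (simp add: space_point_process configurations_def)

lemma measurable_card_Int:
  assumes D: "D \<in> sets borel" "bounded D"
  shows "(\<lambda>\<gamma>. card (\<gamma> \<inter> D)) \<in> measurable M (count_space UNIV)"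
proof (rule measurableI)
  fix X :: "nat set"
  have "(\<lambda>\<gamma>. card (\<gamma> \<inter> D)) -` X \<inter> configurations \<in> sets (configuration_space :: 'a set measure)"
    unfolding configuration_space_def using D by (intro in_measure_of) auto
  then show "(\<lambda>\<gamma>. card (\<gamma> \<inter> D)) -` X \<inter> space M \<in> sets M"
    using M by (simp add: space_point_process point_process_def)
qed simp

text \<open>The sigma-algebra of configurations is generated by counts in bounded sets. On boxes the
  number of tuples is a product of such counts, and boxes generate the product sigma-algebra, so a
  Dynkin argument reaches all \<open>X\<close>; boundedness of \<open>L\<close> keeps the counts
  finite, as the complement step requires.\<close>

lemma measurable_card_tuples:
  assumes L: "L \<in> sets borel" "bounded L" and X: "X \<in> sets (Tup n)"
  shows "(\<lambda>\<gamma>. real (card (({..<n} \<rightarrow>\<^sub>E \<gamma> \<inter> L) \<inter> X))) \<in> borel_measurable M"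
proof -
  let ?T = "\<lambda>\<gamma>. {..<n} \<rightarrow>\<^sub>E \<gamma> \<inter> L"
  let ?\<Omega> = "\<Pi>\<^sub>E i\<in>{..<n}. space (lborel :: 'a measure)"
  let ?G = "{(\<Pi>\<^sub>E i\<in>{..<n}. Y i) |Y. (\<forall>i. Y i \<in> sets (lborel :: 'a measure)) \<and> finite {i. Y i \<noteq> space (lborel :: 'a measure)}}"
  have finT: "finite (?T \<gamma>)" if "\<gamma> \<in> space M" for \<gamma>
    using finite_configuration[OF that L(2)] by (intro finite_PiE) auto
  have box: "(\<lambda>\<gamma>. real (card (?T \<gamma> \<inter> (\<Pi>\<^sub>E i\<in>{..<n}. Y i)))) \<in> borel_measurable M"
    if Y: "\<forall>i. Y i \<in> sets (lborel :: 'a measure)" for Y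
  proof -
    have eq: "real (card (?T \<gamma> \<inter> (\<Pi>\<^sub>E i\<in>{..<n}. Y i))) = (\<Prod>i<n. real (card (\<gamma> \<inter> (L \<inter> Y i))))" for \<gamma> :: "'a set"
      by (simp add: PiE_Int card_PiE Int_assoc)
    have m: "(\<lambda>\<gamma>. real (card (\<gamma> \<inter> (L \<inter> Y i)))) \<in> borel_measurable M" for i
    proof -
      have "(\<lambda>\<gamma>. card (\<gamma> \<inter> (L \<inter> Y i))) \<in> measurable M (count_space UNIV)"
        using L Y by (intro measurable_card_Int) (auto intro: bounded_subset)
      from measurable_compose[OF this, of real borel] show ?thesis by simp
    qed
    show ?thesis unfolding eq using m by measurable
  qed
  have stable: "Int_stable ?G"
  proof (rule Int_stableI)
    fix a b assume "a \<in> ?G" "b \<in> ?G"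
    then obtain Y Z where Y: "a = (\<Pi>\<^sub>E i\<in>{..<n}. Y i)" "\<forall>i. Y i \<in> sets (lborel :: 'a measure)" "finite {i. Y i \<noteq> UNIV}"
      and Z: "b = (\<Pi>\<^sub>E i\<in>{..<n}. Z i)" "\<forall>i. Z i \<in> sets (lborel :: 'a measure)" "finite {i. Z i \<noteq> UNIV}"
      by auto
    have "{i. Y i \<inter> Z i \<noteq> UNIV} \<subseteq> {i. Y i \<noteq> UNIV} \<union> {i. Z i \<noteq> UNIV}" by auto
    then have "finite {i. Y i \<inter> Z i \<noteq> UNIV}" using Y Z by (meson finite_UnI finite_subset)
    then show "a \<inter> b \<in> ?G"
      using Y Z by (auto simp: PiE_Int intro!: exI[of _ "\<lambda>i. Y i \<inter> Z i"])
  qed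
  have sub: "?G \<subseteq> Pow ?\<Omega>" by auto
  have "X \<in> sigma_sets ?\<Omega> ?G"
    using X by (simp only: sets_PiM_finite)
  from stable sub this show ?thesis
  proof (induction rule: sigma_sets_induct_disjoint)
    case (basic A)
    then show ?case using box by auto
  next
    case empty
    then show ?case by simp
  next
    case (compl A)
    have eq: "real (card (?T \<gamma> \<inter> (?\<Omega> - A))) = real (card (?T \<gamma> \<inter> (\<Pi>\<^sub>E i\<in>{..<n}. UNIV))) - real (card (?T \<gamma> \<inter> A))"
      if "\<gamma> \<in> space M" for \<gamma>
    proof -
      have "?T \<gamma> \<inter> (?\<Omega> - A) = ?T \<gamma> - (?T \<gamma> \<inter> A)" by auto
      moreover have "?T \<gamma> \<inter> (\<Pi>\<^sub>E i\<in>{..<n}. UNIV) = ?T \<gamma>" by auto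
      ultimately show ?thesis using finT[OF that]
        by (simp add: card_Diff_subset of_nat_diff card_mono)
    qed
    then show ?case
      using compl(2) box[of "\<lambda>_. UNIV"]
      by (intro measurable_cong[THEN iffD2, OF eq] borel_measurable_diff) auto
  next
    case (union A)
    have "real (card (?T \<gamma> \<inter> (\<Union>i. A i))) = (\<Sum>i. real (card (?T \<gamma> \<inter> A i)))" if g: "\<gamma> \<in> space M" for \<gamma>
    proof -
      \<comment> \<open>Counting measure on the finite set of tuples turns the disjoint union into a
        convergent series of real numbers.\<close>
      interpret C: finite_measure "count_space (?T \<gamma>)"
        using finT[OF g] by (rule finite_measure_count_space)
      have m: "measure (count_space (?T \<gamma>)) B = real (card B)" if "B \<subseteq> ?T \<gamma>" for B
        using that finT[OF g] finite_subset by (simp add: measure_def emeasure_count_space)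
      have "disjoint_family (\<lambda>i. ?T \<gamma> \<inter> A i)"
        using union(1) unfolding disjoint_family_on_def by blast
      then have "(\<lambda>i. measure (count_space (?T \<gamma>)) (?T \<gamma> \<inter> A i)) sums measure (count_space (?T \<gamma>)) (\<Union>i. ?T \<gamma> \<inter> A i)"
        by (intro C.finite_measure_UNION) auto
      moreover have "(\<Union>i. ?T \<gamma> \<inter> A i) = ?T \<gamma> \<inter> (\<Union>i. A i)" by blast
      ultimately have "(\<lambda>i. real (card (?T \<gamma> \<inter> A i))) sums real (card (?T \<gamma> \<inter> (\<Union>i. A i)))"
        by (simp only: m Int_lower1)
      then show ?thesis by (rule sums_unique)
    qed
    then show ?case
      using union(3) by (subst measurable_cong) auto
  qed
qed

text \<open>Indicators are covered by the counts of tuples; sums, multiples and increasing limits of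
  nonnegative functions commute with the sum over tuples.\<close>

lemma measurable_sum_tuples:
  fixes G :: "(nat \<Rightarrow> 'a) \<Rightarrow> ennreal"
  assumes L: "L \<in> sets borel" "bounded L" and G: "G \<in> borel_measurable (Tup n)"
  shows "(\<lambda>\<gamma>. \<Sum>x\<in>{..<n} \<rightarrow>\<^sub>E \<gamma> \<inter> L. G x) \<in> borel_measurable M"
proof -
  let ?T = "\<lambda>\<gamma>. {..<n} \<rightarrow>\<^sub>E \<gamma> \<inter> L"
  have finT: "finite (?T \<gamma>)" if "\<gamma> \<in> space M" for \<gamma>
    using finite_configuration[OF that L(2)] by (intro finite_PiE) auto
  have T: "x \<in> space (Tup n)" if "x \<in> ?T \<gamma>" for x \<gamma>
    using that by (auto simp: space_PiM)
  from G show ?thesis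
  proof (induction rule: borel_measurable_induct)
    case (cong f g)
    then have "(\<Sum>x\<in>?T \<gamma>. f x) = (\<Sum>x\<in>?T \<gamma>. g x)" for \<gamma>
      using T by (intro sum.cong) auto
    then show ?case using cong by simp
  next
    case (set A)
    have "(\<Sum>x\<in>?T \<gamma>. indicator A x) = ennreal (real (card (?T \<gamma> \<inter> A)))" if "\<gamma> \<in> space M" for \<gamma>
      using finT[OF that] by (simp add: indicator_def sum.If_cases ennreal_of_nat_eq_real_of_nat flip: sum.inter_restrict)
    then show ?case
      using measurable_card_tuples[OF L set] by (subst measurable_cong) auto
  next
    case (mult u c)
    show ?case
      unfolding sum_distrib_left[symmetric] by (intro borel_measurable_times_ennreal borel_measurable_const mult)
  next
    case (add u v)
    show ?case
      unfolding sum.distrib by (rule borel_measurable_add; fact add)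
  next
    case (seq U)
    have mono: "incseq (\<lambda>i. U i x)" for x
      using seq(3) by (auto simp: incseq_def le_fun_def)
    have eq: "(\<Sum>x\<in>?T \<gamma>. (SUP i. U i x)) = (SUP i. \<Sum>x\<in>?T \<gamma>. U i x)" for \<gamma>
      by (rule ennreal_SUP_sum[symmetric]) (rule mono)
    show ?case
      unfolding SUP_apply eq by (intro borel_measurable_SUP) (auto intro: seq)
  qed
qed

lemma inj_tuples_measurable: "{x \<in> space (Tup n). inj_on x {..<n}} \<in> sets (Tup n :: (nat \<Rightarrow> 'a) measure)"
proof -
  have "{x \<in> space (Tup n). inj_on x {..<n}} = {x \<in> space (Tup n). \<forall>i\<in>{..<n}. \<forall>j\<in>{..<n}. i \<noteq> j \<longrightarrow> dist (x i) (x j :: 'a) \<noteq> 0}"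
    by (auto simp: inj_on_def)
  also have "\<dots> \<in> sets (Tup n)" by measurable
  finally show ?thesis .
qed

text \<open>Distinctness of the entries is a measurable condition on tuples, so it is absorbed into
  the summand.\<close>

lemma measurable_sum_distinct_tuples:
  fixes G :: "(nat \<Rightarrow> 'a) \<Rightarrow> ennreal"
  assumes L: "L \<in> sets borel" "bounded L" and [measurable]: "G \<in> borel_measurable (Tup n)"
  shows "(\<lambda>\<gamma>. \<Sum>x\<in>distinct_tuples n (\<gamma> \<inter> L). G x) \<in> borel_measurable M"
proof -
  note [measurable] = inj_tuples_measurable[of n]
  let ?I = "{x \<in> space (Tup n). inj_on x {..<n}} :: (nat \<Rightarrow> 'a) set"
  have "(\<Sum>x\<in>distinct_tuples n (\<gamma> \<inter> L). G x) = (\<Sum>x\<in>{..<n} \<rightarrow>\<^sub>E \<gamma> \<inter> L. G x * indicator ?I x)" if "\<gamma> \<in> space M" for \<gamma>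
  proof (rule sum.mono_neutral_cong_left)
    show "finite ({..<n} \<rightarrow>\<^sub>E \<gamma> \<inter> L)"
      using finite_configuration[OF that L(2)] by (intro finite_PiE) auto
    show "distinct_tuples n (\<gamma> \<inter> L) \<subseteq> ({..<n} \<rightarrow>\<^sub>E \<gamma> \<inter> L)"
      unfolding distinct_tuples_def by blast
    have sp: "x \<in> space (Tup n)" if "x \<in> {..<n} \<rightarrow>\<^sub>E \<gamma> \<inter> L" for x :: "nat \<Rightarrow> 'a"
      using that by (simp add: space_PiM PiE_iff)
    show "\<forall>x\<in>({..<n} \<rightarrow>\<^sub>E \<gamma> \<inter> L) - distinct_tuples n (\<gamma> \<inter> L). G x * indicator ?I x = 0"
    proof
      fix x assume "x \<in> ({..<n} \<rightarrow>\<^sub>E \<gamma> \<inter> L) - distinct_tuples n (\<gamma> \<inter> L)"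
      then have "x \<notin> ?I" unfolding distinct_tuples_def by blast
      then show "G x * indicator ?I x = 0" by simp
    qed
    fix x assume "x \<in> distinct_tuples n (\<gamma> \<inter> L)"
    then have "x \<in> ?I" using sp unfolding distinct_tuples_def by blast
    then show "G x = G x * indicator ?I x" by simp
  qed
  then show ?thesis
    using measurable_sum_tuples[OF L, of "\<lambda>x. G x * indicator ?I x"] by (subst measurable_cong) auto
qed

text \<open>Multiplying the summand by the indicator of tuples in \<open>L\<close> reduces the sum
  over all distinct tuples to a finite one for each configuration.\<close>

lemma campbell_nn_integral:
  fixes G :: "(nat \<Rightarrow> 'a) \<Rightarrow> ennreal"
  assumes \<rho>: "has_correlation_functions M \<rho>" and n: "n \<ge> 1"
    and L[measurable]: "L \<in> sets borel" and "bounded L" and [measurable]: "G \<in> borel_measurable (Tup n)"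
  shows "(\<integral>\<^sup>+\<gamma>. (\<Sum>x\<in>distinct_tuples n (\<gamma> \<inter> L). G x) \<partial>M) =
    (\<integral>\<^sup>+x. G x * indicator ({..<n} \<rightarrow>\<^sub>E L) x * ennreal (\<rho> n x) \<partial>Tup n)"
proof -
  have [measurable]: "({..<n} \<rightarrow>\<^sub>E L) \<in> sets (Tup n)"
    by (intro sets_PiM_I_finite) auto
  have "(\<integral>\<^sup>+x. G x * indicator ({..<n} \<rightarrow>\<^sub>E L) x * ennreal (\<rho> n x) \<partial>Tup n) =
    (\<integral>\<^sup>+\<gamma>. (\<integral>\<^sup>+x. G x * indicator ({..<n} \<rightarrow>\<^sub>E L) x \<partial>count_space (distinct_tuples n \<gamma>)) \<partial>M)"
    using \<rho> n unfolding has_correlation_functions_def by (simp add: mult.assoc)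
  also have "\<dots> = (\<integral>\<^sup>+\<gamma>. (\<Sum>x\<in>distinct_tuples n (\<gamma> \<inter> L). G x) \<partial>M)"
  proof (rule nn_integral_cong)
    fix \<gamma> assume "\<gamma> \<in> space M"
    have "(\<integral>\<^sup>+x. G x * indicator ({..<n} \<rightarrow>\<^sub>E L) x \<partial>count_space (distinct_tuples n \<gamma>)) =
      (\<Sum>x\<in>distinct_tuples n (\<gamma> \<inter> L). G x * indicator ({..<n} \<rightarrow>\<^sub>E L) x)"
      using finite_distinct_tuples[OF finite_configuration[OF \<open>\<gamma> \<in> space M\<close> \<open>bounded L\<close>], of n]
      by (intro nn_integral_count_space') (auto simp: distinct_tuples_def PiE_iff indicator_def)
    also have "\<dots> = (\<Sum>x\<in>distinct_tuples n (\<gamma> \<inter> L). G x)"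
      by (intro sum.cong refl) (auto simp: distinct_tuples_def PiE_iff)
    finally show "(\<integral>\<^sup>+x. G x * indicator ({..<n} \<rightarrow>\<^sub>E L) x \<partial>count_space (distinct_tuples n \<gamma>)) =
      (\<Sum>x\<in>distinct_tuples n (\<gamma> \<inter> L). G x)" .
  qed
  finally show ?thesis ..
qed

lemma campbell_integral:
  fixes G :: "(nat \<Rightarrow> 'a) \<Rightarrow> real"
  assumes \<rho>: "has_correlation_functions M \<rho>" and n: "n \<ge> 1"
    and L: "L \<in> sets borel" "bounded L" and G[measurable]: "G \<in> borel_measurable (Tup n)"
    and int: "integrable (Tup n) (\<lambda>x. G x * indicator ({..<n} \<rightarrow>\<^sub>E L) x * \<rho> n x)"
  shows "has_bochner_integral M (\<lambda>\<gamma>. \<Sum>x\<in>distinct_tuples n (\<gamma> \<inter> L). G x)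
    (LINT x|Tup n. G x * indicator ({..<n} \<rightarrow>\<^sub>E L) x * \<rho> n x)"
proof -
  let ?H = "\<lambda>x. G x * indicator ({..<n} \<rightarrow>\<^sub>E L) x * \<rho> n x"
  have \<rho>0: "0 \<le> \<rho> n x" for x using \<rho> n by (simp add: has_correlation_functions_def)
  \<comment> \<open>Applied with \<open>c = 1\<close> and \<open>c = - 1\<close>, for the positive
    and negative parts of \<open>G\<close>; since \<open>ennreal\<close> sends negative numbers to
    0, it performs the truncation on the side of the integral.\<close>
  have part: "has_bochner_integral M (\<lambda>\<gamma>. \<Sum>x\<in>distinct_tuples n (\<gamma> \<inter> L). max 0 (c * G x))
      (enn2real (\<integral>\<^sup>+x. ennreal (c * ?H x) \<partial>Tup n))" for c :: real
  proof -
    let ?S = "\<lambda>\<gamma>. \<Sum>x\<in>distinct_tuples n (\<gamma> \<inter> L). max 0 (c * G x)"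
    have S: "ennreal (?S \<gamma>) = (\<Sum>x\<in>distinct_tuples n (\<gamma> \<inter> L). ennreal (c * G x))" for \<gamma>
    proof -
      have "ennreal (?S \<gamma>) = (\<Sum>x\<in>distinct_tuples n (\<gamma> \<inter> L). ennreal (max 0 (c * G x)))"
        by (rule sum_ennreal[symmetric]) auto
      also have "\<dots> = (\<Sum>x\<in>distinct_tuples n (\<gamma> \<inter> L). ennreal (c * G x))"
        by (intro sum.cong refl) (simp add: max_def ennreal_neg)
      finally show ?thesis .
    qed
    have "(\<lambda>\<gamma>. \<Sum>x\<in>distinct_tuples n (\<gamma> \<inter> L). ennreal (c * G x)) \<in> borel_measurable M"
      by (rule measurable_sum_distinct_tuples[OF L]) measurable
    then have "(\<lambda>\<gamma>. enn2real (ennreal (?S \<gamma>))) \<in> borel_measurable M"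
      unfolding S by measurable
    moreover have S0: "0 \<le> ?S \<gamma>" for \<gamma> by (intro sum_nonneg) auto
    ultimately have Sm: "?S \<in> borel_measurable M" by simp
    have "(\<integral>\<^sup>+\<gamma>. ennreal (?S \<gamma>) \<partial>M) = (\<integral>\<^sup>+x. ennreal (c * G x) * indicator ({..<n} \<rightarrow>\<^sub>E L) x * ennreal (\<rho> n x) \<partial>Tup n)"
      unfolding S by (rule campbell_nn_integral[OF \<rho> n L]) measurable
    also have "\<dots> = (\<integral>\<^sup>+x. ennreal (c * ?H x) \<partial>Tup n)"
    proof (intro nn_integral_cong)
      fix x
      have "ennreal (c * G x * \<rho> n x) = ennreal (c * G x) * ennreal (\<rho> n x)"
        by (rule ennreal_mult''[OF \<rho>0])
      then show "ennreal (c * G x) * indicator ({..<n} \<rightarrow>\<^sub>E L) x * ennreal (\<rho> n x) = ennreal (c * ?H x)"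
        by (simp add: indicator_def mult.assoc)
    qed
    finally have eq: "(\<integral>\<^sup>+\<gamma>. ennreal (?S \<gamma>) \<partial>M) = (\<integral>\<^sup>+x. ennreal (c * ?H x) \<partial>Tup n)" .
    have "integrable (Tup n) (\<lambda>x. c * ?H x)" using int by simp
    from this[unfolded real_integrable_def] have "(\<integral>\<^sup>+x. ennreal (c * ?H x) \<partial>Tup n) \<noteq> \<infinity>"
      by blast
    then have "(\<integral>\<^sup>+x. ennreal (c * ?H x) \<partial>Tup n) < \<infinity>"
      by (simp only: infinity_ennreal_def less_top)
    with eq have "(\<integral>\<^sup>+\<gamma>. ennreal (?S \<gamma>) \<partial>M) = ennreal (enn2real (\<integral>\<^sup>+x. ennreal (c * ?H x) \<partial>Tup n))"
      by simp
    then show ?thesis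
      using Sm S0 by (intro has_bochner_integral_nn_integral) auto
  qed
  have "has_bochner_integral M (\<lambda>\<gamma>. (\<Sum>x\<in>distinct_tuples n (\<gamma> \<inter> L). max 0 (1 * G x)) - (\<Sum>x\<in>distinct_tuples n (\<gamma> \<inter> L). max 0 (- 1 * G x)))
    (enn2real (\<integral>\<^sup>+x. ennreal (1 * ?H x) \<partial>Tup n) - enn2real (\<integral>\<^sup>+x. ennreal (- 1 * ?H x) \<partial>Tup n))"
    by (rule has_bochner_integral_diff[OF part part])
  also have "(\<lambda>\<gamma>. (\<Sum>x\<in>distinct_tuples n (\<gamma> \<inter> L). max 0 (1 * G x)) - (\<Sum>x\<in>distinct_tuples n (\<gamma> \<inter> L). max 0 (- 1 * G x))) =
    (\<lambda>\<gamma>. \<Sum>x\<in>distinct_tuples n (\<gamma> \<inter> L). G x)"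
    by (auto simp: fun_eq_iff max_def simp flip: sum_subtractf intro!: sum.cong)
  also have "enn2real (\<integral>\<^sup>+x. ennreal (1 * ?H x) \<partial>Tup n) - enn2real (\<integral>\<^sup>+x. ennreal (- 1 * ?H x) \<partial>Tup n) = (LINT x|Tup n. ?H x)"
    using real_lebesgue_integral_def[OF int] by simp
  finally show ?thesis .
qed

end

section \<open>Difference coordinates on tuples\<close>

lemma nn_integral_Tup_Suc:
  fixes f :: "(nat \<Rightarrow> 'a::euclidean_space) \<Rightarrow> ennreal"
  assumes "f \<in> borel_measurable (Tup (Suc n))"
  shows "(\<integral>\<^sup>+x. f x \<partial>Tup (Suc n)) = (\<integral>\<^sup>+x. (\<integral>\<^sup>+y. f (x(n := y)) \<partial>lborel) \<partial>Tup n)"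
proof -
  interpret product_sigma_finite "\<lambda>_::nat. lborel :: 'a measure" ..
  show ?thesis
    using product_nn_integral_insert[of "{..<n}" n f] assms by (simp add: lessThan_Suc)
qed

lemma nn_integral_Tup_0: "(\<integral>\<^sup>+x. f x \<partial>Tup 0) = f (\<lambda>_. undefined)"
proof -
  interpret product_sigma_finite "\<lambda>_::nat. lborel :: 'a measure" ..
  show ?thesis using nn_integral_empty[of f] by simp
qed

lemma emeasure_distr_eq:
  assumes "f \<in> measurable M N" "X \<in> sets N"
  shows "emeasure (distr M N f) X = (\<integral>\<^sup>+x. indicator X (f x) \<partial>M)"
  using nn_integral_distr[of f M N "indicator X"] assms by simp

lemma lborel_eqI_emeasure:
  fixes N :: "'b::euclidean_space measure"
  assumes "sets N = sets borel"
    and "\<And>A. A \<in> sets borel \<Longrightarrow> emeasure N A = (\<integral>\<^sup>+x. indicator A x \<partial>lborel)"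
  shows "N = lborel"
  by (rule measure_eqI) (use assms in auto)

lemma nn_integral_lborel_pair:
  fixes f :: "'a::euclidean_space \<times> 'b::euclidean_space \<Rightarrow> ennreal"
  assumes "f \<in> borel_measurable borel"
  shows "(\<integral>\<^sup>+x. f x \<partial>lborel) = (\<integral>\<^sup>+a. \<integral>\<^sup>+b. f (a, b) \<partial>lborel \<partial>lborel)"
  using lborel.nn_integral_fst[of f "lborel :: 'a measure"] assms by (simp add: lborel_prod borel_prod)

text \<open>Base point and differences are measure preserving coordinates, as each difference is a
  reflected and translated copy of one variable.\<close>

lemma distr_Tup_2:
  "distr (Tup 2) borel (\<lambda>x. (x 0, x 0 - x 1)) = (lborel :: ('a::euclidean_space \<times> 'a) measure)"
proof (rule lborel_eqI_emeasure)
  fix X :: "('a \<times> 'a) set" assume [measurable]: "X \<in> sets borel"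
  have m [measurable]: "(\<lambda>x. (x 0, x 0 - x 1)) \<in> measurable (Tup 2) (borel :: ('a \<times> 'a) measure)"
    by measurable
  have "emeasure (distr (Tup 2) borel (\<lambda>x. (x 0, x 0 - x 1))) X = (\<integral>\<^sup>+x. indicator X (x 0, x 0 - x 1) \<partial>Tup 2)"
    using m by (intro emeasure_distr_eq) auto
  also have "\<dots> = (\<integral>\<^sup>+x. \<integral>\<^sup>+y. indicator X (x, x - y) \<partial>lborel \<partial>lborel)"
    unfolding numeral_2_eq_2
    by (simp add: nn_integral_Tup_Suc nn_integral_Tup_0 PiM_empty)
  also have "\<dots> = (\<integral>\<^sup>+x. \<integral>\<^sup>+y. indicator X (x, y) \<partial>lborel \<partial>lborel)"
    by (intro nn_integral_cong nn_integral_lborel_reflect[of "\<lambda>y. indicator X (_, y)"]) measurable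
  also have "\<dots> = (\<integral>\<^sup>+x. indicator X x \<partial>lborel)"
    by (rule nn_integral_lborel_pair[symmetric]) measurable
  finally show "emeasure (distr (Tup 2) borel (\<lambda>x. (x 0, x 0 - x 1))) X = (\<integral>\<^sup>+x. indicator X x \<partial>lborel)" .
qed simp

lemma distr_Tup_3:
  "distr (Tup 3) borel (\<lambda>x. (x 0, (x 0 - x 1, x 1 - x 2))) = (lborel :: ('a::euclidean_space \<times> 'a \<times> 'a) measure)"
proof (rule lborel_eqI_emeasure)
  fix X :: "('a \<times> 'a \<times> 'a) set" assume [measurable]: "X \<in> sets borel"
  have m [measurable]: "(\<lambda>x. (x 0, (x 0 - x 1, x 1 - x 2))) \<in> measurable (Tup 3) (borel :: ('a \<times> 'a \<times> 'a) measure)"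
    by measurable
  have "emeasure (distr (Tup 3) borel (\<lambda>x. (x 0, (x 0 - x 1, x 1 - x 2)))) X =
    (\<integral>\<^sup>+x. indicator X (x 0, (x 0 - x 1, x 1 - x 2)) \<partial>Tup 3)"
    using m by (intro emeasure_distr_eq) auto
  also have "\<dots> = (\<integral>\<^sup>+x. \<integral>\<^sup>+y. \<integral>\<^sup>+z. indicator X (x, (x - y, y - z)) \<partial>lborel \<partial>lborel \<partial>lborel)"
    unfolding numeral_3_eq_3 numeral_2_eq_2
    by (simp add: nn_integral_Tup_Suc nn_integral_Tup_0 PiM_empty)
  also have "\<dots> = (\<integral>\<^sup>+x. \<integral>\<^sup>+y. \<integral>\<^sup>+z. indicator X (x, (x - y, z)) \<partial>lborel \<partial>lborel \<partial>lborel)"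
    by (intro nn_integral_cong nn_integral_lborel_reflect[of "\<lambda>z. indicator X (_, (_, z))"]) measurable
  also have "\<dots> = (\<integral>\<^sup>+x. \<integral>\<^sup>+y. \<integral>\<^sup>+z. indicator X (x, (y, z)) \<partial>lborel \<partial>lborel \<partial>lborel)"
    by (rule nn_integral_cong, rule nn_integral_lborel_reflect[of "\<lambda>y. \<integral>\<^sup>+z. indicator X (_, (y, z)) \<partial>lborel"]) measurable
  also have "\<dots> = (\<integral>\<^sup>+x. indicator X x \<partial>lborel)"
    by (simp add: nn_integral_lborel_pair del: nn_integral_indicator)
  finally show "emeasure (distr (Tup 3) borel (\<lambda>x. (x 0, (x 0 - x 1, x 1 - x 2)))) X = (\<integral>\<^sup>+x. indicator X x \<partial>lborel)" .
qed simp

text \<open>The two inner differences are grouped because \<open>v\<close> acts on them; the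
  separation of the pairs comes last, as the variable over which the kernels are integrated.\<close>

lemma distr_Tup_4:
  "distr (Tup 4) borel (\<lambda>x. (x 0, ((x 0 - x 1, x 2 - x 3), x 0 - x 2))) =
    (lborel :: ('a::euclidean_space \<times> ('a \<times> 'a) \<times> 'a) measure)"
proof (rule lborel_eqI_emeasure)
  let ?\<psi> = "\<lambda>x. (x 0, ((x 0 - x 1, x 2 - x 3), x 0 - x 2)) :: 'a \<times> ('a \<times> 'a) \<times> 'a"
  fix X :: "('a \<times> ('a \<times> 'a) \<times> 'a) set" assume [measurable]: "X \<in> sets borel"
  have four: "(4::nat) = Suc (Suc (Suc (Suc 0)))" by simp
  have m [measurable]: "?\<psi> \<in> measurable (Tup 4) borel"
    by measurable
  have "emeasure (distr (Tup 4) borel ?\<psi>) X = (\<integral>\<^sup>+x. indicator X (?\<psi> x) \<partial>Tup 4)"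
    using m by (intro emeasure_distr_eq) auto
  also have "\<dots> = (\<integral>\<^sup>+x. \<integral>\<^sup>+y. \<integral>\<^sup>+z. \<integral>\<^sup>+w. indicator X (x, ((x - y, z - w), x - z)) \<partial>lborel \<partial>lborel \<partial>lborel \<partial>lborel)"
    using m unfolding four numeral_3_eq_3 numeral_2_eq_2
    by (simp add: nn_integral_Tup_Suc nn_integral_Tup_0 PiM_empty)
  also have "\<dots> = (\<integral>\<^sup>+x. \<integral>\<^sup>+y. \<integral>\<^sup>+z. \<integral>\<^sup>+w. indicator X (x, ((x - y, w), x - z)) \<partial>lborel \<partial>lborel \<partial>lborel \<partial>lborel)"
    by (intro nn_integral_cong nn_integral_lborel_reflect[of "\<lambda>w. indicator X (_, ((_, w), _))"]) measurable
  also have "\<dots> = (\<integral>\<^sup>+x. \<integral>\<^sup>+y. \<integral>\<^sup>+z. \<integral>\<^sup>+w. indicator X (x, ((x - y, w), z)) \<partial>lborel \<partial>lborel \<partial>lborel \<partial>lborel)"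
    by (rule nn_integral_cong, rule nn_integral_cong,
        rule nn_integral_lborel_reflect[of "\<lambda>z. \<integral>\<^sup>+w. indicator X (_, ((_, w), z)) \<partial>lborel"]) measurable
  also have "\<dots> = (\<integral>\<^sup>+x. \<integral>\<^sup>+y. \<integral>\<^sup>+z. \<integral>\<^sup>+w. indicator X (x, ((y, w), z)) \<partial>lborel \<partial>lborel \<partial>lborel \<partial>lborel)"
    by (rule nn_integral_cong,
        rule nn_integral_lborel_reflect[of "\<lambda>y. \<integral>\<^sup>+z. \<integral>\<^sup>+w. indicator X (_, ((y, w), z)) \<partial>lborel \<partial>lborel"]) measurable
  also have "\<dots> = (\<integral>\<^sup>+x. \<integral>\<^sup>+y. \<integral>\<^sup>+w. \<integral>\<^sup>+z. indicator X (x, ((y, w), z)) \<partial>lborel \<partial>lborel \<partial>lborel \<partial>lborel)"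
    by (rule nn_integral_cong, rule nn_integral_cong, rule lborel_pair.Fubini') measurable
  also have "\<dots> = (\<integral>\<^sup>+x. indicator X x \<partial>lborel)"
    by (simp add: nn_integral_lborel_pair del: nn_integral_indicator)
  finally show "emeasure (distr (Tup 4) borel ?\<psi>) X = (\<integral>\<^sup>+x. indicator X x \<partial>lborel)" .
qed simp

section \<open>Small determinants and growing windows\<close>

text \<open>Laplace expansion along the first row, with entries given by a function so that it can
  be iterated; the inner column index skips \<open>j\<close>.\<close>

lemma det_mat_Suc:
  fixes f :: "nat \<Rightarrow> nat \<Rightarrow> 'a::comm_ring_1"
  shows "Determinant.det (Matrix.mat (Suc n) (Suc n) (\<lambda>(i, j). f i j)) =
    (\<Sum>j<Suc n. f 0 j * ((-1) ^ j * Determinant.det (Matrix.mat n n (\<lambda>(i, k). f (Suc i) (if k < j then k else Suc k)))))"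
proof -
  let ?A = "Matrix.mat (Suc n) (Suc n) (\<lambda>(i, j). f i j)"
  have "Determinant.det ?A = (\<Sum>j<Suc n. ?A $$ (0, j) * Determinant.cofactor ?A 0 j)"
    by (rule laplace_expansion_row) auto
  also have "\<dots> = (\<Sum>j<Suc n. f 0 j * ((-1) ^ j * Determinant.det (Matrix.mat n n (\<lambda>(i, k). f (Suc i) (if k < j then k else Suc k)))))"
  proof (intro sum.cong refl)
    fix j assume j: "j \<in> {..<Suc n}"
    have "mat_delete ?A 0 j = Matrix.mat n n (\<lambda>(i, k). f (Suc i) (if k < j then k else Suc k))"
      by (rule eq_matI) (auto simp: mat_delete_def)
    then show "?A $$ (0, j) * Determinant.cofactor ?A 0 j = f 0 j * ((-1) ^ j * Determinant.det (Matrix.mat n n (\<lambda>(i, k). f (Suc i) (if k < j then k else Suc k))))"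
      using j by (simp add: cofactor_def)
  qed
  finally show ?thesis .
qed

lemma det_mat_0: "Determinant.det (Matrix.mat 0 0 g) = (1 :: 'a::comm_ring_1)"
  by (rule det_dim_zero) auto

lemma det_mat_1: "Determinant.det (Matrix.mat 1 1 (\<lambda>(i, j). f i j)) = (f 0 0 :: 'a::comm_ring_1)"
  using det_mat_Suc[of 0 f] by (simp add: det_mat_0)

lemma det_mat_2: "Determinant.det (Matrix.mat 2 2 (\<lambda>(i, j). f i j)) = (f 0 0 * f 1 1 - f 0 1 * f 1 0 :: 'a::comm_ring_1)"
proof -
  have "Determinant.det (Matrix.mat (Suc 1) (Suc 1) (\<lambda>(i, j). f i j)) = f 0 0 * f 1 1 - f 0 1 * f 1 0"
    unfolding det_mat_Suc det_mat_1 by (simp add: lessThan_Suc)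
  then show ?thesis by (simp add: numeral_2_eq_2)
qed

lemma det_mat_3:
  "Determinant.det (Matrix.mat 3 3 (\<lambda>(i, j). f i j)) =
    (f 0 0 * (f 1 1 * f 2 2 - f 1 2 * f 2 1) - f 0 1 * (f 1 0 * f 2 2 - f 1 2 * f 2 0)
     + f 0 2 * (f 1 0 * f 2 1 - f 1 1 * f 2 0) :: 'a::comm_ring_1)"
proof -
  have "Determinant.det (Matrix.mat (Suc 2) (Suc 2) (\<lambda>(i, j). f i j)) = 
    (f 0 0 * (f 1 1 * f 2 2 - f 1 2 * f 2 1) - f 0 1 * (f 1 0 * f 2 2 - f 1 2 * f 2 0)
     + f 0 2 * (f 1 0 * f 2 1 - f 1 1 * f 2 0))"
    unfolding det_mat_Suc det_mat_2 by (simp add: lessThan_Suc numeral_2_eq_2 algebra_simps)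
  then show ?thesis by simp
qed

lemma det_mat_4:
  fixes f :: "nat \<Rightarrow> nat \<Rightarrow> 'a::comm_ring_1"
  defines "d \<equiv> \<lambda>i j k. f 1 i * (f 2 j * f 3 k - f 2 k * f 3 j) - f 1 j * (f 2 i * f 3 k - f 2 k * f 3 i)
     + f 1 k * (f 2 i * f 3 j - f 2 j * f 3 i)"
  shows "Determinant.det (Matrix.mat 4 4 (\<lambda>(i, j). f i j)) =
    f 0 0 * d 1 2 3 - f 0 1 * d 0 2 3 + f 0 2 * d 0 1 3 - f 0 3 * d 0 1 2"
proof -
  have "Determinant.det (Matrix.mat (Suc 3) (Suc 3) (\<lambda>(i, j). f i j)) = 
    f 0 0 * d 1 2 3 - f 0 1 * d 0 2 3 + f 0 2 * d 0 1 3 - f 0 3 * d 0 1 2"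
    unfolding det_mat_Suc det_mat_3 d_def by (simp add: lessThan_Suc numeral_3_eq_3 numeral_2_eq_2 algebra_simps)
  then show ?thesis by simp
qed

section \<open>Integrals over growing windows\<close>

lemma fst_borel [measurable]: "fst \<in> measurable (borel :: ('a::second_countable_topology \<times> 'b::second_countable_topology) measure) borel"
  and snd_borel [measurable]: "snd \<in> measurable (borel :: ('a \<times> 'b) measure) borel"
  by (simp_all flip: borel_prod)

lemma tendsto_integral_window:
  fixes g :: "'b::euclidean_space \<Rightarrow> real" and R :: "'b \<Rightarrow> real" and S :: "real \<Rightarrow> ('a::euclidean_space \<times> 'b) set"
  assumes g: "integrable lborel g" and S[measurable]: "\<And>l. S l \<in> sets borel"
    and R: "\<And>y. 0 \<le> R y"
    and outer: "\<And>x y l. (x, y) \<in> S l \<Longrightarrow> norm x < l"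
    and inner: "\<And>x y l. norm x + R y < l \<Longrightarrow> (x, y) \<in> S l"
  shows "integrable lborel (\<lambda>(x, y). indicator (S l) (x, y) * g y)"
    and "((\<lambda>l. (LINT (x, y)|lborel. indicator (S l) (x, y) * g y) / measure lborel (ball (0 :: 'a) l)) \<longlongrightarrow> (LINT y|lborel. g y)) at_top"
proof -
  have [measurable]: "g \<in> borel_measurable borel" using g by auto
  have bi: "integrable lborel (\<lambda>x :: 'a. indicator (ball 0 l) x :: real)" for l
    by (rule integrable_real_indicator) (auto intro!: emeasure_bounded_finite[simplified])
  have int: "integrable (lborel \<Otimes>\<^sub>M lborel) (\<lambda>(x, y). indicator (S l) (x, y) * g y)" for l
  proof (rule Bochner_Integration.integrable_bound)
    show "integrable (lborel \<Otimes>\<^sub>M lborel) (\<lambda>(x :: 'a, y). indicator (ball 0 l) x * g y)"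
      by (rule lborel_pair.integrable_tensor[OF bi g])
    show "(\<lambda>(x, y). indicator (S l) (x, y) * g y) \<in> borel_measurable (lborel \<Otimes>\<^sub>M lborel)"
      by (simp add: lborel_prod split_beta) measurable
    show "AE x in lborel \<Otimes>\<^sub>M lborel. norm (case x of (x, y) \<Rightarrow> indicator (S l) (x, y) * g y) \<le> norm (case x of (x :: 'a, y) \<Rightarrow> indicator (ball 0 l) x * g y)"
      using outer by (intro AE_I2) (auto simp: indicator_def abs_mult)
  qed
  then show "integrable lborel (\<lambda>(x, y). indicator (S l) (x, y) * g y)" for l
    by (simp only: lborel_prod)
  define c where "c l y = measure lborel {x. (x, y) \<in> S l} / measure lborel (ball (0 :: 'a) l)" for l y
  have Sm [measurable]: "{x. (x, y) \<in> S l} \<in> sets borel" for y l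
    by measurable
  have sub: "measure lborel (ball (0 :: 'a) (l - R y)) \<le> measure lborel {x. (x, y) \<in> S l}"
    "measure lborel {x. (x, y) \<in> S l} \<le> measure lborel (ball (0 :: 'a) l)" for y l
  proof -
    have s1: "ball 0 (l - R y) \<subseteq> {x. (x, y) \<in> S l}" using inner by auto
    have s2: "{x. (x, y) \<in> S l} \<subseteq> ball 0 l" using outer by auto
    have fin: "{x. (x, y) \<in> S l} \<in> fmeasurable lborel"
      by (rule fmeasurableI2[OF _ s2]) (auto simp: fmeasurable_def intro!: emeasure_bounded_finite[simplified])
    show "measure lborel (ball (0 :: 'a) (l - R y)) \<le> measure lborel {x. (x, y) \<in> S l}"
      by (rule measure_mono_fmeasurable[OF s1 _ fin]) auto
    show "measure lborel {x. (x, y) \<in> S l} \<le> measure lborel (ball (0 :: 'a) l)"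
      by (rule measure_mono_fmeasurable[OF s2]) (auto simp: fmeasurable_def intro!: emeasure_bounded_finite[simplified])
  qed
  have eq: "(LINT (x, y)|lborel. indicator (S l) (x, y) * g y) / measure lborel (ball (0 :: 'a) l) = (LINT y|lborel. c l y * g y)" for l
  proof -
    have "(LINT (x, y)|lborel. indicator (S l) (x, y) * g y) = (LINT y|lborel. LINT x|lborel. indicator (S l) (x, y) * g y)"
      using lborel_pair.integral_snd[OF int] by (simp add: lborel_prod)
    also have "\<dots> = (LINT y|lborel. measure lborel {x. (x, y) \<in> S l} * g y)"
    proof (intro Bochner_Integration.integral_cong refl)
      fix y
      have "(LINT x|lborel. indicator (S l) (x, y) * g y) = (LINT x|lborel. indicator {x. (x, y) \<in> S l} x) * g y"
        by (subst integral_mult_left_zero[symmetric]) (auto simp: indicator_def)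
      then show "(LINT x|lborel. indicator (S l) (x, y) * g y) = measure lborel {x. (x, y) \<in> S l} * g y"
        by simp
    qed
    finally show ?thesis by (simp add: c_def)
  qed
  have c01: "0 \<le> c l y" "c l y \<le> 1" for l y
    using sub[where y = y and l = l] by (auto simp: c_def divide_le_eq_1 intro!: divide_nonneg_nonneg)
  have c_lim: "((\<lambda>l. c l y) \<longlongrightarrow> 1) at_top" for y
  proof (rule tendsto_sandwich)
    have ev: "eventually (\<lambda>l. l > R y) at_top" by (rule eventually_gt_at_top)
    \<comment> \<open>The power is the ratio of the volumes of the balls of radii
      \<open>l - R y\<close> and \<open>l\<close>.\<close>
    show "eventually (\<lambda>l. (1 - R y / l) ^ DIM('a) \<le> c l y) at_top"
      using ev
    proof eventually_elim
      case (elim l)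
      have l: "l > 0" using elim R[of y] by simp
      have "measure lborel (ball (0 :: 'a) (l - R y)) = unit_ball_vol (DIM('a)) * (l - R y) ^ DIM('a)"
        "measure lborel (ball (0 :: 'a) l) = unit_ball_vol (DIM('a)) * l ^ DIM('a)"
        using elim l by (auto simp: content_ball)
      moreover have u: "unit_ball_vol (real DIM('a)) \<noteq> 0"
        using unit_ball_vol_pos[of "real DIM('a)"] by (metis less_irrefl of_nat_0_le_iff)
      ultimately have "measure lborel (ball (0 :: 'a) (l - R y)) / measure lborel (ball (0 :: 'a) l) = ((l - R y) / l) ^ DIM('a)"
        using l u by (simp add: power_divide)
      moreover have "(l - R y) / l = 1 - R y / l" using l by (simp add: diff_divide_distrib)
      ultimately have "(1 - R y / l) ^ DIM('a) = measure lborel (ball (0 :: 'a) (l - R y)) / measure lborel (ball (0 :: 'a) l)"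
        by simp
      also have "\<dots> \<le> c l y"
        unfolding c_def by (intro divide_right_mono sub) auto
      finally show ?case .
    qed
    show "eventually (\<lambda>l. c l y \<le> 1) at_top" using c01 by simp
    have "((\<lambda>l. (1 - R y / l) ^ DIM('a)) \<longlongrightarrow> (1 - 0) ^ DIM('a)) at_top"
      by (intro tendsto_intros tendsto_divide_0[OF tendsto_const] filterlim_at_top_imp_at_infinity filterlim_ident)
    then show "((\<lambda>l. (1 - R y / l) ^ DIM('a)) \<longlongrightarrow> 1) at_top" by simp
  qed simp
  have cm [measurable]: "c l \<in> borel_measurable borel" for l
  proof -
    have "(\<lambda>y. LINT x|lborel. indicator (S l) (x, y) :: real) \<in> borel_measurable borel"
    proof -
      have "(\<lambda>(y, x). indicator (S l) (x, y) :: real) \<in> borel_measurable (borel \<Otimes>\<^sub>M lborel)"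
        by measurable
      then show ?thesis by measurable
    qed
    moreover have "(LINT x|lborel. indicator (S l) (x, y) :: real) = measure lborel {x. (x, y) \<in> S l}" for y
    proof -
      have "(LINT x|lborel. indicator (S l) (x, y) :: real) = (LINT x|lborel. indicator {x. (x, y) \<in> S l} x)"
        by (intro Bochner_Integration.integral_cong refl) (auto simp: indicator_def)
      then show ?thesis by simp
    qed
    ultimately show ?thesis unfolding c_def by simp
  qed
  have "((\<lambda>l. LINT y|lborel. c l y * g y) \<longlongrightarrow> (LINT y|lborel. g y)) at_top"
  proof (rule integral_dominated_convergence_at_top[where w = "\<lambda>y. norm (g y)"])
    show "AE y in lborel. ((\<lambda>l. c l y * g y) \<longlongrightarrow> g y) at_top"
      using tendsto_mult[OF c_lim tendsto_const] by (intro AE_I2) fastforce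
    show "\<forall>\<^sub>F l in at_top. AE y in lborel. norm (c l y * g y) \<le> norm (g y)"
      using c01 by (intro always_eventually allI AE_I2) (auto simp: abs_mult intro!: mult_left_le_one_le)
  qed (use g in auto)
  then show "((\<lambda>l. (LINT (x, y)|lborel. indicator (S l) (x, y) * g y) / measure lborel (ball (0 :: 'a) l)) \<longlongrightarrow> (LINT y|lborel. g y)) at_top"
    unfolding eq .
qed

section \<open>Truncated correlation functions\<close>

text \<open>Two pairs, each given by a base point and a difference, are brought into the coordinates
  of \<open>distr_Tup_4\<close>, so that a product of two pair integrals can be compared with a
  four-point integral.\<close>

lemma distr_pair_shear:
  "distr lborel borel (\<lambda>x. (fst (fst x), ((snd (fst x), snd (snd x)), fst (fst x) - fst (snd x)))) = (lborel :: ('a::euclidean_space \<times> ('a \<times> 'a) \<times> 'a) measure)"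
proof (rule lborel_eqI_emeasure)
  let ?\<psi> = "\<lambda>x. (fst (fst x), ((snd (fst x), snd (snd x)), fst (fst x) - fst (snd x))) :: 'a \<times> ('a \<times> 'a) \<times> 'a"
  fix X :: "('a \<times> ('a \<times> 'a) \<times> 'a) set" assume [measurable]: "X \<in> sets borel"
  have m [measurable]: "?\<psi> \<in> measurable borel borel"
    by measurable
  have "emeasure (distr lborel borel ?\<psi>) X = (\<integral>\<^sup>+x. indicator X (?\<psi> x) \<partial>lborel)"
    by (intro emeasure_distr_eq) auto
  also have "\<dots> = (\<integral>\<^sup>+x. \<integral>\<^sup>+a. \<integral>\<^sup>+y. \<integral>\<^sup>+b. indicator X (x, ((a, b), x - y)) \<partial>lborel \<partial>lborel \<partial>lborel \<partial>lborel)"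
  proof -
    have "(\<integral>\<^sup>+x. indicator X (?\<psi> x) \<partial>lborel) = (\<integral>\<^sup>+p. \<integral>\<^sup>+q. indicator X (?\<psi> (p, q)) \<partial>lborel \<partial>lborel)"
      by (rule nn_integral_lborel_pair) measurable
    also have "\<dots> = (\<integral>\<^sup>+x. \<integral>\<^sup>+a. \<integral>\<^sup>+q. indicator X (?\<psi> ((x, a), q)) \<partial>lborel \<partial>lborel \<partial>lborel)"
      by (rule nn_integral_lborel_pair) measurable
    also have "\<dots> = (\<integral>\<^sup>+x. \<integral>\<^sup>+a. \<integral>\<^sup>+y. \<integral>\<^sup>+b. indicator X (?\<psi> ((x, a), (y, b))) \<partial>lborel \<partial>lborel \<partial>lborel \<partial>lborel)"
      by (rule nn_integral_cong, rule nn_integral_cong, rule nn_integral_lborel_pair) measurable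
    finally show ?thesis by simp
  qed
  also have "\<dots> = (\<integral>\<^sup>+x. \<integral>\<^sup>+a. \<integral>\<^sup>+z. \<integral>\<^sup>+b. indicator X (x, ((a, b), z)) \<partial>lborel \<partial>lborel \<partial>lborel \<partial>lborel)"
    by (rule nn_integral_cong, rule nn_integral_cong,
        rule nn_integral_lborel_reflect[of "\<lambda>z. \<integral>\<^sup>+b. indicator X (_, ((_, b), z)) \<partial>lborel"]) measurable
  also have "\<dots> = (\<integral>\<^sup>+x. \<integral>\<^sup>+a. \<integral>\<^sup>+b. \<integral>\<^sup>+z. indicator X (x, ((a, b), z)) \<partial>lborel \<partial>lborel \<partial>lborel \<partial>lborel)"
    by (rule nn_integral_cong, rule nn_integral_cong, rule lborel_pair.Fubini') measurable
  also have "\<dots> = (\<integral>\<^sup>+x. indicator X x \<partial>lborel)"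
    by (simp add: nn_integral_lborel_pair del: nn_integral_indicator)
  finally show "emeasure (distr lborel borel ?\<psi>) X = (\<integral>\<^sup>+x. indicator X x \<partial>lborel)" .
qed simp

lemma has_bochner_integral_lborel_distr:
  fixes f :: "'b::euclidean_space \<Rightarrow> real"
  assumes d: "distr N borel \<psi> = lborel" and \<psi>: "\<psi> \<in> measurable N borel" and f: "integrable lborel f"
    and eq: "\<And>x. x \<in> space N \<Longrightarrow> g x = f (\<psi> x)"
  shows "has_bochner_integral N g (LINT x|lborel. f x)"
proof -
  have [measurable]: "f \<in> borel_measurable borel" using f by auto
  have "integrable (distr N borel \<psi>) f" using f d by simp
  then have "integrable N (\<lambda>x. f (\<psi> x))"
    using \<psi> by (subst (asm) integrable_distr_eq) auto
  moreover have "(LINT x|lborel. f x) = (LINT x|N. f (\<psi> x))"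
    unfolding d[symmetric] by (rule integral_distr[OF \<psi>]) auto
  ultimately have "has_bochner_integral N (\<lambda>x. f (\<psi> x)) (LINT x|lborel. f x)"
    by (simp add: has_bochner_integral_iff)
  then show ?thesis
    by (subst has_bochner_integral_cong[OF refl eq refl])
qed

context spectral_set
begin

lemma K_le_1: "(K x)\<^sup>2 \<le> 1"
  using K_bound[of x] by (simp add: abs_square_le_1)

text \<open>Correlation functions as functions of differences: the arguments are \<open>x 0 - x 1\<close> for \<open>rho2\<close>;
  \<open>x 0 - x 1\<close> and \<open>x 1 - x 2\<close> for \<open>rho3\<close>; and \<open>x 0 - x 1\<close>, \<open>x 2 - x 3\<close>, \<open>x 0 - x 2\<close> for the truncated function
  \<open>rho4T\<close>, from which the product of \<open>rho2 (x 0 - x 1)\<close> and \<open>rho2 (x 2 - x 3)\<close> has been subtracted.\<close>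

definition rho2 :: "'a \<Rightarrow> real" where
  "rho2 a = 1 - (K a)\<^sup>2"

definition rho3 :: "'a \<Rightarrow> 'a \<Rightarrow> real" where
  "rho3 a b = 1 - (K a)\<^sup>2 - (K b)\<^sup>2 - (K (a + b))\<^sup>2 + 2 * (K a * K b * K (a + b))"

definition rho4T :: "'a \<Rightarrow> 'a \<Rightarrow> 'a \<Rightarrow> real" where
  "rho4T a b z = - ((K z)\<^sup>2 + (K (z - a))\<^sup>2 + (K (z + b))\<^sup>2 + (K (z + b - a))\<^sup>2)
    + 2 * (K a * (K (z - a) * K z) + K a * (K (z + b - a) * K (z + b)) + K b * (K z * K (z + b)) + K b * (K (z - a) * K (z + b - a)))
    + ((K z)\<^sup>2 * (K (z + b - a))\<^sup>2 + (K (z - a))\<^sup>2 * (K (z + b))\<^sup>2)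
    - 2 * (K a * K b * (K (z - a) * K (z + b)) + K a * K b * (K (z + b - a) * K z)
           + K z * K (z - a) * K (z + b) * K (z + b - a))"

lemma rho2_measurable [measurable]: "rho2 \<in> borel_measurable borel"
  unfolding rho2_def by measurable

lemma rho3_measurable [measurable]: "(\<lambda>(a, b). rho3 a b) \<in> borel_measurable borel"
  unfolding rho3_def split_beta by measurable

lemma rho4T_measurable [measurable]: "(\<lambda>((a, b), z). rho4T a b z) \<in> borel_measurable borel"
  unfolding rho4T_def split_beta by measurable

lemma rho2_bound: "\<bar>rho2 a\<bar> \<le> 1"
  using K_le_1[of a] zero_le_power2[of "K a"] by (auto simp: rho2_def abs_le_iff)

lemma rho3_bound: "\<bar>rho3 a b\<bar> \<le> 6"
proof -
  have "\<bar>K a * K b * K (a + b)\<bar> \<le> 1 * 1 * 1"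
    unfolding abs_mult by (intro mult_mono) auto
  then show ?thesis
    using K_le_1[of a] K_le_1[of b] K_le_1[of "a + b"] zero_le_power2[of "K a"] zero_le_power2[of "K b"] zero_le_power2[of "K (a + b)"]
    unfolding rho3_def abs_le_iff by linarith
qed

text \<open>Each term contains at least two factors whose argument involves \<open>z\<close>, that
  is, factors linking the two pairs. Their product is bounded by half the sum of their squares, or
  by one of the squares, and all other factors by 1; the coefficients collected for each square stay
  below 10.\<close>

lemma rho4T_bound: "\<bar>rho4T a b z\<bar> \<le> 10 * ((K z)\<^sup>2 + (K (z - a))\<^sup>2 + (K (z + b))\<^sup>2 + (K (z + b - a))\<^sup>2)"
proof -
  have two: "\<bar>c * (x * y)\<bar> \<le> (x\<^sup>2 + y\<^sup>2) / 2" if "\<bar>c\<bar> \<le> 1" for c x y :: real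
  proof -
    have "\<bar>c * (x * y)\<bar> \<le> 1 * \<bar>x * y\<bar>" unfolding abs_mult[of c] by (intro mult_right_mono that) auto
    also have "\<bar>x * y\<bar> \<le> (x\<^sup>2 + y\<^sup>2) / 2"
      using sum_squares_bound[of "\<bar>x\<bar>" "\<bar>y\<bar>"] by (simp add: abs_mult)
    finally show ?thesis by simp
  qed
  have sq: "\<bar>x\<^sup>2 * y\<^sup>2\<bar> \<le> x\<^sup>2" if "\<bar>y\<bar> \<le> 1" for x y :: real
    using that by (simp add: abs_mult mult_left_le abs_square_le_1)
  have ab: "\<bar>K a * K b\<bar> \<le> 1" and pq: "\<bar>K x * K y\<bar> \<le> 1" for x y
    unfolding abs_mult by (rule mult_le_one; simp)+
  let ?p = "K z" and ?q = "K (z - a)" and ?r = "K (z + b)" and ?s = "K (z + b - a)"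
  have "\<bar>K a * (?q * ?p)\<bar> \<le> (?q\<^sup>2 + ?p\<^sup>2) / 2" "\<bar>K a * (?s * ?r)\<bar> \<le> (?s\<^sup>2 + ?r\<^sup>2) / 2"
    "\<bar>K b * (?p * ?r)\<bar> \<le> (?p\<^sup>2 + ?r\<^sup>2) / 2" "\<bar>K b * (?q * ?s)\<bar> \<le> (?q\<^sup>2 + ?s\<^sup>2) / 2"
    "\<bar>K a * K b * (?q * ?r)\<bar> \<le> (?q\<^sup>2 + ?r\<^sup>2) / 2" "\<bar>K a * K b * (?s * ?p)\<bar> \<le> (?s\<^sup>2 + ?p\<^sup>2) / 2"
    "\<bar>?p * ?q * (?r * ?s)\<bar> \<le> (?r\<^sup>2 + ?s\<^sup>2) / 2"
    by (rule two; simp add: ab pq)+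
  moreover have "\<bar>?p\<^sup>2 * ?s\<^sup>2\<bar> \<le> ?p\<^sup>2" "\<bar>?q\<^sup>2 * ?r\<^sup>2\<bar> \<le> ?q\<^sup>2"
    by (rule sq; simp)+
  moreover have "?p * ?q * (?r * ?s) = ?p * ?q * ?r * ?s" by simp
  moreover have "0 \<le> ?p\<^sup>2" "0 \<le> ?q\<^sup>2" "0 \<le> ?r\<^sup>2" "0 \<le> ?s\<^sup>2" by simp_all
  ultimately show ?thesis
    unfolding rho4T_def abs_le_iff by argo
qed

text \<open>Two of the four factors are bounded by 1; the product of the others is at most the sum
  of their squares, each of integral 1.\<close>

lemma C_integrable: "integrable lborel (\<lambda>z. K z * K (z + a) * K (z + b) * K (z + (a + b)))"
  and C_bound: "\<bar>C a b\<bar> \<le> 2"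
proof -
  have i: "integrable lborel (\<lambda>z. (K z)\<^sup>2 + (K (z + a))\<^sup>2)"
    using K_square_integrable[of 0] K_square_integrable[of a] by simp
  have b: "\<bar>K z * K (z + a) * K (z + b) * K (z + (a + b))\<bar> \<le> (K z)\<^sup>2 + (K (z + a))\<^sup>2" for z
  proof -
    have "\<bar>K z * K (z + a) * K (z + b) * K (z + (a + b))\<bar> \<le> \<bar>K z * K (z + a)\<bar> * 1 * 1"
      unfolding abs_mult by (intro mult_mono) auto
    also have "\<bar>K z * K (z + a)\<bar> \<le> (K z)\<^sup>2 + (K (z + a))\<^sup>2"
      using mult_le_sum_power2[of "\<bar>K z\<bar>" "\<bar>K (z + a)\<bar>"] by (simp add: abs_mult)
    finally show ?thesis by simp
  qed
  show int: "integrable lborel (\<lambda>z. K z * K (z + a) * K (z + b) * K (z + (a + b)))"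
    by (rule Bochner_Integration.integrable_bound[OF i]) (use b in \<open>auto intro!: AE_I2 order_trans[OF _ abs_ge_self]\<close>)
  have "\<bar>C a b\<bar> \<le> (LINT z|lborel. \<bar>K z * K (z + a) * K (z + b) * K (z + (a + b))\<bar>)"
    unfolding C_def by (rule integral_abs_bound)
  also have "\<dots> \<le> (LINT z|lborel. (K z)\<^sup>2 + (K (z + a))\<^sup>2)"
    using int i b by (intro integral_mono) auto
  also have "\<dots> = 2"
    using K_square_integrable[of 0] K_square_integrable[of a] K_square_integral[of 0] K_square_integral[of a] by simp
  finally show "\<bar>C a b\<bar> \<le> 2" .
qed

lemma A_eq_C: "A c = C c 0"
  unfolding A_def C_def by (intro Bochner_Integration.integral_cong refl) (simp add: power2_eq_square)

lemma A_bound: "\<bar>A c\<bar> \<le> 2"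
  unfolding A_eq_C by (rule C_bound)

lemma A_has_integral: "has_bochner_integral lborel (\<lambda>z. (K z)\<^sup>2 * (K (z + c))\<^sup>2) (A c)"
  using C_integrable[of c 0] by (simp add: has_bochner_integral_iff A_def power2_eq_square mult_ac)

lemma A_has_integral':
  assumes "s - r = c"
  shows "has_bochner_integral lborel (\<lambda>z. (K (z + r))\<^sup>2 * (K (z + s))\<^sup>2) (A c)"
proof -
  have i: "integrable lborel (\<lambda>z. (K z)\<^sup>2 * (K (z + c))\<^sup>2)" and e: "(LINT z|lborel. (K z)\<^sup>2 * (K (z + c))\<^sup>2) = A c"
    using A_has_integral[of c] by (auto simp: has_bochner_integral_iff)
  have e: "r + z + c = z + s" "r + z = z + r" for z using assms by (simp_all add: algebra_simps)
  show ?thesis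
    using integrable_lborel_shift[OF i, of r] integral_lborel_shift[of "\<lambda>z. (K z)\<^sup>2 * (K (z + c))\<^sup>2" r] e(1)
    unfolding e(1) unfolding e(2) by (simp add: has_bochner_integral_iff \<open>_ = A c\<close>)
qed

lemma A_measurable [measurable]: "A \<in> borel_measurable borel"
  unfolding A_def by measurable

lemma C_measurable [measurable]: "(\<lambda>(a, b). C a b) \<in> borel_measurable borel"
proof -
  have "(\<lambda>x. C (fst x) (snd x)) \<in> borel_measurable (borel :: ('a \<times> 'a) measure)"
    unfolding C_def by measurable
  then show ?thesis by (simp add: split_beta)
qed

lemma K_mult_has_integral:
  assumes "K (a - b) = k"
  shows "has_bochner_integral lborel (\<lambda>z. K (z + a) * K (z + b)) k"
  using assms K_mult_integrable[of a b] K_mult_integral[of a b] by (simp add: has_bochner_integral_iff)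

text \<open>The integral of \<open>rho4T a b\<close> over \<open>z\<close>: a square gives 1, a
  product of two translates reproduces \<open>K\<close>, and products of four linking factors give
  \<open>A\<close> or \<open>C\<close>. Repeated summands are left as they are to match
  \<open>rho4T\<close> term by term under the integration rules.\<close>

definition rho4T_integral :: "'a \<Rightarrow> 'a \<Rightarrow> real" where
  "rho4T_integral a b = - (1 + 1 + 1 + 1) + 2 * (K a * K a + K a * K a + K b * K b + K b * K b)
    + (A (b - a) + A (a + b)) - 2 * (K a * K b * K (a + b) + K a * K b * K (b - a) + C (- a) b)"

lemma rho4T_has_integral: "has_bochner_integral lborel (rho4T a b) (rho4T_integral a b)"
proof -
  note km = K_mult_has_integral
  have sq: "has_bochner_integral lborel (\<lambda>z. (K (z + c))\<^sup>2) 1" for c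
    using K_square_integrable[of c] K_square_integral[of c] by (simp add: has_bochner_integral_iff)
  have Kc: "K (- a - (b - a)) = K b" "K (b - a - b) = K a" "K (- a - b) = K (a + b)" "K (0 - b) = K b" "K (- a - 0) = K a"
    using K_minus[of b] K_minus[of a] K_minus[of "a + b"] by simp_all
  have c: "has_bochner_integral lborel (\<lambda>z. K (z + 0) * K (z + - a) * K (z + b) * K (z + (b - a))) (C (- a) b)"
    using C_integrable[of "- a" b] by (simp add: has_bochner_integral_iff C_def)
  have "has_bochner_integral lborel (\<lambda>z. - ((K (z + 0))\<^sup>2 + (K (z + - a))\<^sup>2 + (K (z + b))\<^sup>2 + (K (z + (b - a)))\<^sup>2)
    + 2 * (K a * (K (z + - a) * K (z + 0)) + K a * (K (z + (b - a)) * K (z + b)) + K b * (K (z + 0) * K (z + b)) + K b * (K (z + - a) * K (z + (b - a))))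
    + ((K (z + 0))\<^sup>2 * (K (z + (b - a)))\<^sup>2 + (K (z + - a))\<^sup>2 * (K (z + b))\<^sup>2)
    - 2 * (K a * K b * (K (z + - a) * K (z + b)) + K a * K b * (K (z + (b - a)) * K (z + 0))
           + K (z + 0) * K (z + - a) * K (z + b) * K (z + (b - a)))) (rho4T_integral a b)"
    unfolding rho4T_integral_def
    by (intro has_bochner_integral_add has_bochner_integral_diff has_bochner_integral_minus has_bochner_integral_mult_right sq c;
        (rule km A_has_integral'; simp add: Kc add.commute))
  moreover have "z + (b - a) = z + b - a" for z by simp
  ultimately show ?thesis unfolding rho4T_def[abs_def] by simp
qed

end

context spectral_set
begin

text \<open>As \<open>K\<close> is real and even, the determinants become polynomials in
  \<open>K\<close> at the differences. For four points the permutations preserving both pairs make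
  up the product of two \<open>rho2\<close>, and \<open>rho4T\<close> collects the others.\<close>

lemma rho_formulas:
  fixes \<rho> :: "nat \<Rightarrow> (nat \<Rightarrow> 'a) \<Rightarrow> real"
  assumes det: "\<And>n x. n \<ge> 1 \<Longrightarrow> complex_of_real (\<rho> n x) =
    Determinant.det (Matrix.mat n n (\<lambda>(i, j). complex_of_real (K (x i - x j))))"
  shows "\<rho> 2 x = rho2 (x 0 - x 1)"
    and "\<rho> 3 x = rho3 (x 0 - x 1) (x 1 - x 2)"
    and "\<rho> 4 x = rho2 (x 0 - x 1) * rho2 (x 2 - x 3) + rho4T (x 0 - x 1) (x 2 - x 3) (x 0 - x 2)"
proof -
  have K0: "K (x 1 - x 0) = K (x 0 - x 1)" "K (x 2 - x 0) = K (x 0 - x 2)" "K (x 3 - x 0) = K (x 0 - x 3)"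
    "K (x 2 - x 1) = K (x 1 - x 2)" "K (x 3 - x 1) = K (x 1 - x 3)" "K (x 3 - x 2) = K (x 2 - x 3)"
    by (rule K_minus_commute)+
  have "complex_of_real (\<rho> 2 x) = of_real (rho2 (x 0 - x 1))"
    by (subst det, simp, subst det_mat_2, unfold K0) (simp add: rho2_def power2_eq_square)
  then show "\<rho> 2 x = rho2 (x 0 - x 1)" by (simp only: of_real_eq_iff)
  have d3: "x 0 - x 1 + (x 1 - x 2) = x 0 - x 2" by simp
  have "complex_of_real (\<rho> 3 x) = of_real (rho3 (x 0 - x 1) (x 1 - x 2))"
    by (subst det, simp, subst det_mat_3, unfold K0 rho3_def d3) (simp add: power2_eq_square algebra_simps)
  then show "\<rho> 3 x = rho3 (x 0 - x 1) (x 1 - x 2)" by (simp only: of_real_eq_iff)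
  have d4: "x 0 - x 2 - (x 0 - x 1) = x 1 - x 2" "x 0 - x 2 + (x 2 - x 3) = x 0 - x 3" "x 0 - x 3 - (x 0 - x 1) = x 1 - x 3"
    by simp_all
  have "complex_of_real (\<rho> 4 x) = of_real (rho2 (x 0 - x 1) * rho2 (x 2 - x 3) + rho4T (x 0 - x 1) (x 2 - x 3) (x 0 - x 2))"
    by (subst det, simp, subst det_mat_4, unfold K0 rho2_def rho4T_def d4) (simp add: power2_eq_square algebra_simps)
  then show "\<rho> 4 x = rho2 (x 0 - x 1) * rho2 (x 2 - x 3) + rho4T (x 0 - x 1) (x 2 - x 3) (x 0 - x 2)"
    by (simp only: of_real_eq_iff)
qed

end

section \<open>Windows and limiting densities\<close>

definition window2 :: "real \<Rightarrow> ('a::euclidean_space \<times> 'a) set" where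
  "window2 l = {y. norm (fst y) < l \<and> norm (fst y - snd y) < l}"

definition window3 :: "real \<Rightarrow> ('a::euclidean_space \<times> 'a \<times> 'a) set" where
  "window3 l = {y. norm (fst y) < l \<and> norm (fst y - fst (snd y)) < l \<and> norm (fst y - fst (snd y) - snd (snd y)) < l}"

text \<open>For \<open>(x, ((a, b), z))\<close> the four points are \<open>x\<close>,
  \<open>x - a\<close>, \<open>x - z\<close> and \<open>x - z - b\<close>, in the coordinates of
  \<open>distr_Tup_4\<close>.\<close>

definition window4 :: "real \<Rightarrow> ('a::euclidean_space \<times> ('a \<times> 'a) \<times> 'a) set" where
  "window4 l = {y. norm (fst y) < l \<and> norm (fst y - fst (fst (snd y))) < l \<and>
     norm (fst y - snd (snd y)) < l \<and> norm (fst y - snd (snd y) - snd (fst (snd y))) < l}"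

lemma window_measurable [measurable]:
  "window2 l \<in> sets borel" "window3 l \<in> sets borel" "window4 l \<in> sets borel"
  unfolding window2_def window3_def window4_def by measurable

lemma Tup_ball_iff:
  "x \<in> space (Tup n) \<Longrightarrow> x \<in> ({..<n} \<rightarrow>\<^sub>E ball 0 l) \<longleftrightarrow> (\<forall>i<n. norm (x i) < l)"
  by (auto simp: space_PiM PiE_iff)

context even_potential
begin

lemma vv_integrable': "integrable lborel (\<lambda>(a, b). v a * v b)"
  using vv_integrable by (simp add: lborel_prod)

lemma vv_bounded_integrable:
  assumes [measurable]: "(\<lambda>(a, b). f a b) \<in> borel_measurable borel" and f: "\<And>a b. \<bar>f a b\<bar> \<le> B"
  shows "integrable lborel (\<lambda>(a, b). v a * v b * f a b)"
proof (rule Bochner_Integration.integrable_bound)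
  show "integrable lborel (\<lambda>z. B * (case z of (a, b) \<Rightarrow> v a * v b))"
    using vv_integrable' by simp
  have "(\<lambda>z. v (fst z) * v (snd z) * (case z of (a, b) \<Rightarrow> f a b)) \<in> borel_measurable borel"
    by measurable
  then show "(\<lambda>(a, b). v a * v b * f a b) \<in> borel_measurable lborel"
    by (simp add: split_beta)
  show "AE x in lborel. norm (case x of (a, b) \<Rightarrow> v a * v b * f a b) \<le> norm (B * (case x of (a, b) \<Rightarrow> v a * v b))"
  proof (rule AE_I2)
    fix x :: "'a \<times> 'a"
    obtain a b where x: "x = (a, b)" by (cases x)
    have "\<bar>v a * v b\<bar> * \<bar>f a b\<bar> \<le> \<bar>v a * v b\<bar> * \<bar>B\<bar>"
      using f[of a b] by (intro mult_left_mono) auto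
    then show "norm (case x of (a, b) \<Rightarrow> v a * v b * f a b) \<le> norm (B * (case x of (a, b) \<Rightarrow> v a * v b))"
      by (simp add: x abs_mult mult_ac)
  qed
qed

text \<open>Evenness of \<open>v\<close> allows the sign of \<open>a\<close> to be reversed; this
  identifies the terms with \<open>A (b - a)\<close>, \<open>K (b - a)\<close> and
  \<open>C (- a) b\<close> in the four-point integral with their counterparts for
  \<open>a\<close>.\<close>

lemma vv_flip:
  assumes fm: "(\<lambda>(a, b). f a b) \<in> borel_measurable borel" and f: "\<And>a b. \<bar>f a b\<bar> \<le> B"
  shows "(LINT (a, b)|lborel. v a * v b * f (- a) b) = (LINT (a, b)|lborel. v a * v b * f a b)"
proof -
  note [measurable] = fm
  have fm': "(\<lambda>(a, b). f (- a) b) \<in> borel_measurable borel"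
  proof -
    have "(\<lambda>z. case (- fst z, snd z) of (a, b) \<Rightarrow> f a b) \<in> borel_measurable borel"
      by (rule measurable_compose[OF _ fm]) (simp flip: borel_prod)
    then show ?thesis by (simp add: split_beta)
  qed
  have i1: "integrable (lborel \<Otimes>\<^sub>M lborel) (\<lambda>(a, b). v a * v b * f (- a) b)"
    using vv_bounded_integrable[OF fm' f] by (simp add: lborel_prod)
  have i2: "integrable (lborel \<Otimes>\<^sub>M lborel) (\<lambda>(a, b). v a * v b * f a b)"
    using vv_bounded_integrable[OF fm f] by (simp add: lborel_prod)
  have fb: "(\<lambda>a. f a b) \<in> borel_measurable borel" for b
  proof -
    have "(\<lambda>a. (a, b)) \<in> borel \<rightarrow>\<^sub>M (borel :: ('a \<times> 'a) measure)" by measurable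
    from measurable_compose[OF this fm] show ?thesis by simp
  qed
  have "(LINT a|lborel. v a * v b * f (- a) b) = (LINT a|lborel. v a * v b * f a b)" for b
  proof -
    note [measurable] = fb
    have "(LINT a|lborel. (\<lambda>a. v a * v b * f a b) (0 - a)) = (LINT a|lborel. v a * v b * f a b)"
      by (rule integral_lborel_reflect) measurable
    then show ?thesis by (simp add: v_even)
  qed
  then show ?thesis
    using lborel_pair.integral_snd[OF i1] lborel_pair.integral_snd[OF i2] by (simp add: lborel_prod)
qed

definition density2 :: "'a \<Rightarrow> real" where
  "density2 = (\<lambda>a. (v a)\<^sup>2 * rho2 a)"

definition density3 :: "'a \<times> 'a \<Rightarrow> real" where
  "density3 = (\<lambda>(a, b). v a * v b * rho3 a b)"

definition density4 :: "('a \<times> 'a) \<times> 'a \<Rightarrow> real" where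
  "density4 = (\<lambda>((a, b), z). v a * v b * rho4T a b z)"

lemma density2_integrable: "integrable lborel density2"
  unfolding density2_def
proof (rule Bochner_Integration.integrable_bound[OF v_sq])
  show "AE x in lborel. norm ((v x)\<^sup>2 * rho2 x) \<le> norm ((v x)\<^sup>2)"
    using rho2_bound by (auto simp: abs_mult intro!: AE_I2 mult_left_le)
qed measurable

lemma v_rho2_integrable: "integrable lborel (\<lambda>a. v a * rho2 a)"
proof (rule Bochner_Integration.integrable_bound[OF v_int])
  show "AE x in lborel. norm (v x * rho2 x) \<le> norm (v x)"
    using rho2_bound by (auto simp: abs_mult intro!: AE_I2 mult_left_le)
qed measurable

lemma density3_integrable: "integrable lborel density3"
  unfolding density3_def by (rule vv_bounded_integrable[OF rho3_measurable rho3_bound])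

text \<open>Whatever the shift \<open>c y\<close>, the square of \<open>K\<close> has integral 1 in
  \<open>z\<close>, so only the integral of \<open>\<bar>v a * v b\<bar>\<close> remains.\<close>

lemma vv_K_square_integrable:
  assumes [measurable]: "c \<in> borel_measurable (borel :: ('a \<times> 'a) measure)"
  shows "integrable (lborel \<Otimes>\<^sub>M lborel) (\<lambda>(y, z). (case y of (a, b) \<Rightarrow> v a * v b) * (K (z + c y))\<^sup>2)"
proof (rule lborel_pair.Fubini_integrable)
  have "(\<lambda>x. v (fst (fst x)) * v (snd (fst x)) * (K (snd x + c (fst x)))\<^sup>2) \<in> borel_measurable (borel \<Otimes>\<^sub>M borel)"
    by measurable
  then show "(\<lambda>(y, z). (case y of (a, b) \<Rightarrow> v a * v b) * (K (z + c y))\<^sup>2) \<in> borel_measurable (lborel \<Otimes>\<^sub>M lborel)"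
    by (simp add: split_beta lborel_prod borel_prod)
  have "(LINT z|lborel. norm (case (y, z) of (y, z) \<Rightarrow> (case y of (a, b) \<Rightarrow> v a * v b) * (K (z + c y))\<^sup>2)) = \<bar>case y of (a, b) \<Rightarrow> v a * v b\<bar>" for y
    using K_square_integral[of "c y"] by (simp add: abs_mult)
  then show "integrable lborel (\<lambda>y. LINT z|lborel. norm (case (y, z) of (y, z) \<Rightarrow> (case y of (a, b) \<Rightarrow> v a * v b) * (K (z + c y))\<^sup>2))"
    using vv_integrable' by simp
  show "AE y in lborel. integrable lborel (\<lambda>z. case (y, z) of (y, z) \<Rightarrow> (case y of (a, b) \<Rightarrow> v a * v b) * (K (z + c y))\<^sup>2)"
    using K_square_integrable by simp
qed

lemma density4_integrable: "integrable lborel density4"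
proof -
  let ?h = "\<lambda>c (y, z). (case y of (a, b) \<Rightarrow> v a * v b) * (K (z + c y))\<^sup>2"
  \<comment> \<open>The shifts \<open>0\<close>, \<open>- a\<close>, \<open>b\<close> and
    \<open>b - a\<close> are those of the four squares in \<open>rho4T_bound\<close>.\<close>
  have "integrable (lborel \<Otimes>\<^sub>M lborel) (\<lambda>x. 10 * (\<bar>?h (\<lambda>_. 0) x\<bar> + \<bar>?h (\<lambda>y. - fst y) x\<bar> + \<bar>?h snd x\<bar> + \<bar>?h (\<lambda>y. snd y - fst y) x\<bar>))"
    by (intro integrable_mult_right Bochner_Integration.integrable_add integrable_abs vv_K_square_integrable) measurable
  then have "integrable (lborel \<Otimes>\<^sub>M lborel) density4"
  proof (rule Bochner_Integration.integrable_bound)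
    have t: "(\<lambda>x. rho4T (fst (fst x)) (snd (fst x)) (snd x)) \<in> borel_measurable (borel :: (('a \<times> 'a) \<times> 'a) measure)"
      using rho4T_measurable by (simp add: case_prod_unfold)
    have v: "(\<lambda>x. v (fst (fst x))) \<in> borel_measurable (borel :: (('a \<times> 'a) \<times> 'a) measure)"
      "(\<lambda>x. v (snd (fst x))) \<in> borel_measurable (borel :: (('a \<times> 'a) \<times> 'a) measure)"
      by (rule measurable_compose[OF _ v_borel] measurable_compose[OF fst_borel fst_borel] measurable_compose[OF fst_borel snd_borel])+
    have "(\<lambda>x. v (fst (fst x)) * v (snd (fst x)) * rho4T (fst (fst x)) (snd (fst x)) (snd x)) \<in> borel_measurable (borel :: (('a \<times> 'a) \<times> 'a) measure)"
      by (intro borel_measurable_times v t)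
    then show "density4 \<in> borel_measurable (lborel \<Otimes>\<^sub>M lborel)"
      by (simp add: lborel_prod density4_def case_prod_unfold)
    show "AE x in lborel \<Otimes>\<^sub>M lborel. norm (density4 x) \<le> norm (10 * (\<bar>?h (\<lambda>_. 0) x\<bar> + \<bar>?h (\<lambda>y. - fst y) x\<bar> + \<bar>?h snd x\<bar> + \<bar>?h (\<lambda>y. snd y - fst y) x\<bar>))"
    proof (rule AE_I2)
      fix x :: "('a \<times> 'a) \<times> 'a"
      obtain a b z where x: "x = ((a, b), z)" by (metis surj_pair)
      have "\<bar>v a * v b\<bar> * \<bar>rho4T a b z\<bar> \<le> \<bar>v a * v b\<bar> * (10 * ((K z)\<^sup>2 + (K (z - a))\<^sup>2 + (K (z + b))\<^sup>2 + (K (z + b - a))\<^sup>2))"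
        by (intro mult_left_mono rho4T_bound) auto
      also have "\<dots> = 10 * (\<bar>?h (\<lambda>_. 0) x\<bar> + \<bar>?h (\<lambda>y. - fst y) x\<bar> + \<bar>?h snd x\<bar> + \<bar>?h (\<lambda>y. snd y - fst y) x\<bar>)"
        by (simp add: x abs_mult distrib_left add_diff_eq)
      finally show "norm (density4 x) \<le> norm (10 * (\<bar>?h (\<lambda>_. 0) x\<bar> + \<bar>?h (\<lambda>y. - fst y) x\<bar> + \<bar>?h snd x\<bar> + \<bar>?h (\<lambda>y. snd y - fst y) x\<bar>))"
        by (simp add: x density4_def abs_mult)
    qed
  qed
  then show ?thesis by (simp add: lborel_prod)
qed

lemma density4_integral: "(LINT x|lborel. density4 x) = (LINT (a, b)|lborel. v a * v b * rho4T_integral a b)"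
proof -
  have "(LINT x|lborel. density4 x) = (LINT y|lborel. LINT z|lborel. density4 (y, z))"
    using lborel_pair.integral_fst'[of density4] density4_integrable by (simp add: lborel_prod)
  also have "\<dots> = (LINT (a, b)|lborel. v a * v b * rho4T_integral a b)"
  proof (rule Bochner_Integration.integral_cong[OF refl])
    fix y :: "'a \<times> 'a"
    obtain a b where y: "y = (a, b)" by (cases y)
    show "(LINT z|lborel. density4 (y, z)) = (case y of (a, b) \<Rightarrow> v a * v b * rho4T_integral a b)"
      using rho4T_has_integral[of a b] by (simp add: y density4_def has_bochner_integral_iff)
  qed
  finally show ?thesis .
qed

text \<open>The constants \<open>- 4\<close> and \<open>4\<close>, and the multiples of
  \<open>(K a)\<^sup>2\<close> and \<open>(K b)\<^sup>2\<close>, cancel between the four-point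
  integral and four times the three-point density. Reversing the sign of \<open>a\<close> merges
  what is left; the triangle term \<open>K a * K b * K (a + b)\<close> gets the coefficient
  \<open>6 - 2 = 4\<close>.\<close>

lemma limit_variance_assembled:
  "(LINT x|lborel. density4 x) + 4 * (LINT x|lborel. density3 x) + 2 * (LINT x|lborel. density2 x) = limit_variance"
proof -
  have curried_m: "(\<lambda>x. h (fst x) (snd x)) \<in> borel_measurable (borel :: ('a \<times> 'a) measure)
      \<Longrightarrow> (\<lambda>(a, b). h a b) \<in> borel_measurable borel" for h :: "'a \<Rightarrow> 'a \<Rightarrow> real"
    by (simp add: split_beta)
  have KK: "\<bar>K a * K b * K c\<bar> \<le> 1" for a b c
  proof -
    have "\<bar>K a * K b * K c\<bar> \<le> 1 * 1 * 1"
      unfolding abs_mult by (intro mult_mono) auto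
    then show ?thesis by simp
  qed
  let ?f1 = "\<lambda>a b. A (a + b)" and ?f2 = "\<lambda>a b. C a b" and ?f3 = "\<lambda>a b. K a * K b * K (a + b)"
  let ?I = "\<lambda>f. LINT (a, b)|lborel. v a * v b * f a b"
  have Cm': "(\<lambda>x. C (- fst x) (snd x)) \<in> borel_measurable (borel :: ('a \<times> 'a) measure)"
  proof -
    have "(\<lambda>z. case (- fst z, snd z) of (a, b) \<Rightarrow> C a b) \<in> borel_measurable (borel :: ('a \<times> 'a) measure)"
      by (rule measurable_compose[OF _ C_measurable]) (simp flip: borel_prod)
    then show ?thesis by simp
  qed
  have m: "(\<lambda>(a, b). ?f1 a b) \<in> borel_measurable borel" "(\<lambda>(a, b). ?f1 (- a) b) \<in> borel_measurable borel"
    "(\<lambda>(a, b). ?f3 a b) \<in> borel_measurable borel" "(\<lambda>(a, b). ?f3 (- a) b) \<in> borel_measurable borel"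
    "(\<lambda>(a, b). (K (a + b))\<^sup>2) \<in> borel_measurable borel"
    by (rule curried_m, measurable)+
  have m6: "(\<lambda>(a, b). C (- a) b) \<in> borel_measurable borel"
    by (rule curried_m[OF Cm'])
  have K2: "\<bar>(K (a + b))\<^sup>2\<bar> \<le> 1" for a b using K_le_1 by simp
  have i1: "integrable lborel (\<lambda>(a, b). v a * v b * ?f1 a b)" "integrable lborel (\<lambda>(a, b). v a * v b * ?f1 (- a) b)"
    by (rule vv_bounded_integrable[OF _ A_bound], rule m)+
  have i2: "integrable lborel (\<lambda>(a, b). v a * v b * ?f2 a b)" "integrable lborel (\<lambda>(a, b). v a * v b * ?f2 (- a) b)"
    by (rule vv_bounded_integrable[OF C_measurable C_bound], rule vv_bounded_integrable[OF m6 C_bound])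
  have i3: "integrable lborel (\<lambda>(a, b). v a * v b * ?f3 a b)" "integrable lborel (\<lambda>(a, b). v a * v b * ?f3 (- a) b)"
    by (rule vv_bounded_integrable[OF m(3) KK], rule vv_bounded_integrable[OF m(4) KK])
  have i4: "integrable lborel (\<lambda>(a, b). v a * v b * (K (a + b))\<^sup>2)"
    by (rule vv_bounded_integrable[OF m(5) K2])
  have flip: "?I (\<lambda>a b. ?f1 (- a) b) = ?I ?f1" "?I (\<lambda>a b. ?f2 (- a) b) = ?I ?f2" "?I (\<lambda>a b. ?f3 (- a) b) = ?I ?f3"
    by (rule vv_flip[OF m(1) A_bound] vv_flip[OF C_measurable C_bound] vv_flip[OF m(3) KK])+
  have iJ: "integrable lborel (\<lambda>(a, b). v a * v b * rho4T_integral a b)"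
  proof -
    have "(\<lambda>(a, b). v a * v b * rho4T_integral a b) = (\<lambda>x. 2 * (case x of (a, b) \<Rightarrow> v a * v b * (2 * (K a)\<^sup>2 + 2 * (K b)\<^sup>2 - 2)) - 2 * (case x of (a, b) \<Rightarrow> v a * v b * ?f3 a b)
      - 2 * (case x of (a, b) \<Rightarrow> v a * v b * ?f3 (- a) b) + (case x of (a, b) \<Rightarrow> v a * v b * ?f1 (- a) b)
      + (case x of (a, b) \<Rightarrow> v a * v b * ?f1 a b) - 2 * (case x of (a, b) \<Rightarrow> v a * v b * ?f2 (- a) b))"
      by (auto simp: fun_eq_iff rho4T_integral_def power2_eq_square algebra_simps)
    moreover have "integrable lborel (\<lambda>(a, b). v a * v b * (2 * (K a)\<^sup>2 + 2 * (K b)\<^sup>2 - 2))"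
    proof (rule vv_bounded_integrable[where B = 2])
      show "(\<lambda>(a, b). 2 * (K a)\<^sup>2 + 2 * (K b)\<^sup>2 - 2) \<in> borel_measurable borel"
        by (rule curried_m) measurable
      show "\<bar>2 * (K a)\<^sup>2 + 2 * (K b)\<^sup>2 - 2\<bar> \<le> 2" for a b
        using K_le_1[of a] K_le_1[of b] zero_le_power2[of "K a"] zero_le_power2[of "K b"]
        unfolding abs_le_iff by linarith
    qed
    ultimately show ?thesis
      using i1 i2 i3 by simp
  qed
  have "(LINT x|lborel. density4 x) + 4 * (LINT x|lborel. density3 x) =
    (LINT x|lborel. (case x of (a, b) \<Rightarrow> v a * v b * rho4T_integral a b) + 4 * density3 x)"
    using iJ density3_integrable by (simp add: density4_integral)
  also have "\<dots> = (LINT x|lborel. 6 * (case x of (a, b) \<Rightarrow> v a * v b * ?f3 a b) - 2 * (case x of (a, b) \<Rightarrow> v a * v b * ?f3 (- a) b)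
     + (case x of (a, b) \<Rightarrow> v a * v b * ?f1 (- a) b) + (case x of (a, b) \<Rightarrow> v a * v b * ?f1 a b)
     - 2 * (case x of (a, b) \<Rightarrow> v a * v b * ?f2 (- a) b) - 4 * (case x of (a, b) \<Rightarrow> v a * v b * (K (a + b))\<^sup>2))"
    by (intro Bochner_Integration.integral_cong refl)
       (auto simp: rho4T_integral_def density3_def rho3_def power2_eq_square algebra_simps)
  also have "\<dots> = 6 * ?I ?f3 - 2 * ?I (\<lambda>a b. ?f3 (- a) b) + ?I (\<lambda>a b. ?f1 (- a) b) + ?I ?f1
    - 2 * ?I (\<lambda>a b. ?f2 (- a) b) - 4 * ?I (\<lambda>a b. (K (a + b))\<^sup>2)"
    using i1 i2 i3 i4 by simp
  also have "\<dots> = 2 * ?I ?f1 - 2 * ?I ?f2 - 4 * ?I (\<lambda>a b. (K (a + b))\<^sup>2) + 4 * ?I ?f3"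
    unfolding flip by simp
  also have "\<dots> = (LINT x|lborel. 2 * (case x of (a, b) \<Rightarrow> v a * v b * ?f1 a b) - 2 * (case x of (a, b) \<Rightarrow> v a * v b * ?f2 a b)
     - 4 * (case x of (a, b) \<Rightarrow> v a * v b * (K (a + b))\<^sup>2) + 4 * (case x of (a, b) \<Rightarrow> v a * v b * ?f3 a b))"
    using i1 i2 i3 i4 by simp
  also have "\<dots> = (LINT (a, b)|(lborel \<Otimes>\<^sub>M lborel). v a * v b *
      (2 * A (a + b) - 2 * C a b - 4 * (K (a + b))\<^sup>2 + 4 * (K a * K b * K (a + b))))"
    unfolding lborel_prod by (intro Bochner_Integration.integral_cong refl) (auto simp: algebra_simps)
  finally have eq: "(LINT x|lborel. density4 x) + 4 * (LINT x|lborel. density3 x) = \<dots>" .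
  have "2 * (LINT x|lborel. density2 x) = (LINT x|lborel. 2 * (v x)\<^sup>2 * (1 - (K x)\<^sup>2))"
    unfolding integral_mult_right_zero[symmetric] density2_def rho2_def by (simp add: mult.assoc)
  with eq show ?thesis by (simp add: limit_variance_def)
qed

end

section \<open>The variance of the pair energy\<close>

context even_potential
begin

lemma window2_limit:
  fixes f :: "'a \<Rightarrow> real"
  assumes f: "integrable lborel f"
  shows "integrable lborel (\<lambda>(x, a). indicator (window2 l) (x, a) * f a)"
    and "((\<lambda>l. (LINT (x, a)|lborel. indicator (window2 l) (x, a) * f a) / measure lborel (ball (0 :: 'a) l)) \<longlongrightarrow> (LINT a|lborel. f a)) at_top"
proof -
  have inner: "(x, a) \<in> window2 l" if "norm x + norm a < l" for x a :: 'a and l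
    using that norm_triangle_ineq4[of x a] norm_ge_zero[of a] unfolding window2_def mem_Collect_eq fst_conv snd_conv by (intro conjI; linarith)
  have outer: "norm x < l" if "(x, a) \<in> window2 l" for x a :: 'a and l
    using that by (simp add: window2_def)
  note * = tendsto_integral_window[OF f, of window2 norm, OF window_measurable(1) norm_ge_zero outer inner]
  show "integrable lborel (\<lambda>(x, a). indicator (window2 l) (x, a) * f a)"
    by (rule *(1))
  show "((\<lambda>l. (LINT (x, a)|lborel. indicator (window2 l) (x, a) * f a) / measure lborel (ball (0 :: 'a) l)) \<longlongrightarrow> (LINT a|lborel. f a)) at_top"
    by (rule *(2))
qed

lemma window3_limit:
  fixes f :: "'a \<times> 'a \<Rightarrow> real"
  assumes f: "integrable lborel f"
  shows "integrable lborel (\<lambda>(x, y). indicator (window3 l) (x, y) * f y)"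
    and "((\<lambda>l. (LINT (x, y)|lborel. indicator (window3 l) (x, y) * f y) / measure lborel (ball (0 :: 'a) l)) \<longlongrightarrow> (LINT y|lborel. f y)) at_top"
proof -
  have inner: "(x, y) \<in> window3 l" if "norm x + (norm (fst y) + norm (snd y)) < l" for x :: 'a and y :: "'a \<times> 'a" and l
    using that norm_triangle_ineq4[of x "fst y"] norm_triangle_ineq4[of "x - fst y" "snd y"] norm_ge_zero[of "fst y"] norm_ge_zero[of "snd y"]
    unfolding window3_def mem_Collect_eq fst_conv snd_conv by (intro conjI; linarith)
  have outer: "norm x < l" if "(x, y) \<in> window3 l" for x :: 'a and y :: "'a \<times> 'a" and l
    using that by (simp add: window3_def)
  note * = tendsto_integral_window[OF f, of window3 "\<lambda>y. norm (fst y) + norm (snd y)", OF window_measurable(2) _ outer inner]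
  show "integrable lborel (\<lambda>(x, y). indicator (window3 l) (x, y) * f y)"
    by (rule *(1)) simp
  show "((\<lambda>l. (LINT (x, y)|lborel. indicator (window3 l) (x, y) * f y) / measure lborel (ball (0 :: 'a) l)) \<longlongrightarrow> (LINT y|lborel. f y)) at_top"
    by (rule *(2)) simp
qed

lemma window4_limit:
  fixes f :: "('a \<times> 'a) \<times> 'a \<Rightarrow> real"
  assumes f: "integrable lborel f"
  shows "integrable lborel (\<lambda>(x, y). indicator (window4 l) (x, y) * f y)"
    and "((\<lambda>l. (LINT (x, y)|lborel. indicator (window4 l) (x, y) * f y) / measure lborel (ball (0 :: 'a) l)) \<longlongrightarrow> (LINT y|lborel. f y)) at_top"
proof -
  let ?R = "\<lambda>y :: ('a \<times> 'a) \<times> 'a. norm (fst (fst y)) + norm (snd (fst y)) + norm (snd y)"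
  have inner: "(x, y) \<in> window4 l" if "norm x + ?R y < l" for x :: 'a and y :: "('a \<times> 'a) \<times> 'a" and l
    using that norm_triangle_ineq4[of x "fst (fst y)"] norm_triangle_ineq4[of x "snd y"] norm_triangle_ineq4[of "x - snd y" "snd (fst y)"]
      norm_ge_zero[of "fst (fst y)"] norm_ge_zero[of "snd (fst y)"] norm_ge_zero[of "snd y"]
    unfolding window4_def mem_Collect_eq fst_conv snd_conv by (intro conjI; linarith)
  have outer: "norm x < l" if "(x, y) \<in> window4 l" for x :: 'a and y :: "('a \<times> 'a) \<times> 'a" and l
    using that by (simp add: window4_def)
  note * = tendsto_integral_window[OF f, of window4 ?R, OF window_measurable(3) _ outer inner]
  show "integrable lborel (\<lambda>(x, y). indicator (window4 l) (x, y) * f y)"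
    by (rule *(1)) simp
  show "((\<lambda>l. (LINT (x, y)|lborel. indicator (window4 l) (x, y) * f y) / measure lborel (ball (0 :: 'a) l)) \<longlongrightarrow> (LINT y|lborel. f y)) at_top"
    by (rule *(2)) simp
qed

text \<open>At every finite \<open>l\<close> the product part of the four-point function integrates
  to the square of the mean exactly, because the window of four points is a product of two windows
  of pairs. It thus leaves the variance before the division by the volume, which could not control a
  term of quadratic order.\<close>

lemma mean_square:
  fixes l :: real
  defines "f \<equiv> \<lambda>(x, y). indicator (window4 l) (x, y) * (case y of ((a, b), z) \<Rightarrow> v a * v b * (rho2 a * rho2 b))"
  shows "integrable lborel f"
    and "(LINT x|lborel. f x) = (LINT (x, a)|lborel. indicator (window2 l) (x, a) * (v a * rho2 a))\<^sup>2"
proof -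
  let ?\<psi> = "\<lambda>x. (fst (fst x), ((snd (fst x), snd (snd x)), fst (fst x) - fst (snd x))) :: 'a \<times> ('a \<times> 'a) \<times> 'a"
  let ?F = "\<lambda>(x, a). indicator (window2 l) (x, a) * (v a * rho2 a) :: real"
  have F: "integrable lborel ?F"
    by (rule window2_limit[OF v_rho2_integrable])
  have m: "?\<psi> \<in> borel_measurable lborel" by measurable
  have fm [measurable]: "f \<in> borel_measurable borel"
  proof -
    have [measurable]: "(\<lambda>y. v (fst (fst (snd y)))) \<in> borel_measurable (borel :: ('a \<times> ('a \<times> 'a) \<times> 'a) measure)"
      "(\<lambda>y. v (snd (fst (snd y)))) \<in> borel_measurable (borel :: ('a \<times> ('a \<times> 'a) \<times> 'a) measure)"
      "(\<lambda>y. rho2 (fst (fst (snd y)))) \<in> borel_measurable (borel :: ('a \<times> ('a \<times> 'a) \<times> 'a) measure)"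
      "(\<lambda>y. rho2 (snd (fst (snd y)))) \<in> borel_measurable (borel :: ('a \<times> ('a \<times> 'a) \<times> 'a) measure)"
      by (rule measurable_compose[OF _ v_borel] measurable_compose[OF _ rho2_measurable]
          measurable_compose[OF snd_borel] measurable_compose[OF fst_borel] fst_borel snd_borel)+
    have "(\<lambda>y. indicator (window4 l) y * (v (fst (fst (snd y))) * v (snd (fst (snd y))) * (rho2 (fst (fst (snd y))) * rho2 (snd (fst (snd y)))))) \<in> borel_measurable borel"
      by measurable
    then show ?thesis by (simp add: f_def case_prod_unfold)
  qed
  have eq: "f (?\<psi> x) = (case x of (p, q) \<Rightarrow> ?F p * ?F q)" for x
    by (auto simp: f_def indicator_def window4_def window2_def split: prod.splits)
  have "integrable (lborel \<Otimes>\<^sub>M lborel) (\<lambda>(p, q). ?F p * ?F q)"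
    by (rule lborel_pair.integrable_tensor[OF F F])
  then have "integrable lborel (\<lambda>x. f (?\<psi> x))"
    unfolding eq by (simp add: lborel_prod)
  then have "integrable (distr lborel borel ?\<psi>) f"
    using m by (subst integrable_distr_eq) auto
  then show "integrable lborel f"
    by (simp add: distr_pair_shear)
  have "(LINT x|lborel. f x) = (LINT x|distr lborel borel ?\<psi>. f x)"
    by (simp add: distr_pair_shear)
  also have "\<dots> = (LINT x|lborel. f (?\<psi> x))"
    by (rule integral_distr[OF m]) measurable
  also have "\<dots> = (LINT x|(lborel \<Otimes>\<^sub>M lborel). (case x of (p, q) \<Rightarrow> ?F p * ?F q))"
    unfolding eq lborel_prod ..
  also have "\<dots> = (LINT p|lborel. ?F p) * (LINT p|lborel. ?F p)"
    by (rule lborel_pair.integral_tensor[OF F F])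
  finally show "(LINT x|lborel. f x) = (LINT (x, a)|lborel. indicator (window2 l) (x, a) * (v a * rho2 a))\<^sup>2"
    by (simp add: power2_eq_square)
qed

section \<open>Moments of the pair energy\<close>

context
  fixes M :: "'a set measure" and \<rho> :: "nat \<Rightarrow> (nat \<Rightarrow> 'a) \<Rightarrow> real"
  assumes M: "point_process M" and \<rho>: "has_correlation_functions M \<rho>"
    and det: "\<And>n x. n \<ge> 1 \<Longrightarrow> complex_of_real (\<rho> n x) =
      Determinant.det (Matrix.mat n n (\<lambda>(i, j). complex_of_real (K (x i - x j))))"
begin

text \<open>The general \<open>f\<close> serves both for \<open>v\<close> in the mean and for the
  square of \<open>v\<close> in the second moment.\<close>

lemma pair_sum_integral:
  fixes f :: "'a \<Rightarrow> real"
  assumes [measurable]: "f \<in> borel_measurable borel" and int: "integrable lborel (\<lambda>a. f a * rho2 a)"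
  shows "has_bochner_integral M (\<lambda>\<gamma>. \<Sum>a\<in>\<gamma> \<inter> ball 0 l. \<Sum>b\<in>\<gamma> \<inter> ball 0 l - {a}. f (a - b))
    (LINT (x, a)|lborel. indicator (window2 l) (x, a) * (f a * rho2 a))"
proof -
  let ?G = "\<lambda>x :: nat \<Rightarrow> 'a. f (x 0 - x 1)"
  have Gm: "?G \<in> borel_measurable (Tup 2)" by measurable
  have H: "has_bochner_integral (Tup 2) (\<lambda>x. ?G x * indicator ({..<2} \<rightarrow>\<^sub>E ball 0 l) x * \<rho> 2 x)
    (LINT (x, a)|lborel. indicator (window2 l) (x, a) * (f a * rho2 a))"
  proof (rule has_bochner_integral_lborel_distr[OF distr_Tup_2])
    show "(\<lambda>x. (x 0, x 0 - x 1)) \<in> measurable (Tup 2) (borel :: ('a \<times> 'a) measure)" by measurable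
    show "integrable lborel (\<lambda>(x, a). indicator (window2 l) (x, a) * (f a * rho2 a))"
      by (rule window2_limit[OF int])
    fix x :: "nat \<Rightarrow> 'a" assume "x \<in> space (Tup 2)"
    then have "indicator ({..<2} \<rightarrow>\<^sub>E ball 0 l) x = (indicator (window2 l) (x 0, x 0 - x 1) :: real)"
      by (simp add: Tup_ball_iff indicator_def window2_def numeral_2_eq_2 All_less_Suc conj_commute)
    then show "?G x * indicator ({..<2} \<rightarrow>\<^sub>E ball 0 l) x * \<rho> 2 x =
      (case (x 0, x 0 - x 1) of (x, a) \<Rightarrow> indicator (window2 l) (x, a) * (f a * rho2 a))"
      by (simp add: rho_formulas(1)[of \<rho>, OF det])
  qed
  have "has_bochner_integral M (\<lambda>\<gamma>. \<Sum>x\<in>distinct_tuples 2 (\<gamma> \<inter> ball 0 l). ?G x)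
    (LINT x|Tup 2. ?G x * indicator ({..<2} \<rightarrow>\<^sub>E ball 0 l) x * \<rho> 2 x)"
    by (rule campbell_integral[OF M \<rho> _ _ _ Gm]) (use H in \<open>auto simp: has_bochner_integral_iff\<close>)
  also have "(LINT x|Tup 2. ?G x * indicator ({..<2} \<rightarrow>\<^sub>E ball 0 l) x * \<rho> 2 x) = (LINT (x, a)|lborel. indicator (window2 l) (x, a) * (f a * rho2 a))"
    using H by (simp add: has_bochner_integral_iff)
  finally show ?thesis
    using sum_distinct_tuples_2[OF finite_configuration[OF M _ bounded_ball], of _ "\<lambda>a b. f (a - b)"]
    by (subst (asm) has_bochner_integral_cong[OF refl _ refl]) auto
qed

lemma triple_sum_integral:
  "has_bochner_integral M (\<lambda>\<gamma>. \<Sum>a\<in>\<gamma> \<inter> ball 0 l. \<Sum>b\<in>\<gamma> \<inter> ball 0 l - {a}. \<Sum>c\<in>\<gamma> \<inter> ball 0 l - {a, b}. v (a - b) * v (b - c))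
    (LINT (x, y)|lborel. indicator (window3 l) (x, y) * density3 y)"
proof -
  let ?G = "\<lambda>x :: nat \<Rightarrow> 'a. v (x 0 - x 1) * v (x 1 - x 2)"
  have Gm: "?G \<in> borel_measurable (Tup 3)" by measurable
  have H: "has_bochner_integral (Tup 3) (\<lambda>x. ?G x * indicator ({..<3} \<rightarrow>\<^sub>E ball 0 l) x * \<rho> 3 x)
    (LINT (x, y)|lborel. indicator (window3 l) (x, y) * density3 y)"
  proof (rule has_bochner_integral_lborel_distr[OF distr_Tup_3])
    show "(\<lambda>x. (x 0, (x 0 - x 1, x 1 - x 2))) \<in> measurable (Tup 3) (borel :: ('a \<times> 'a \<times> 'a) measure)" by measurable
    show "integrable lborel (\<lambda>(x, y). indicator (window3 l) (x, y) * density3 y)"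
      by (rule window3_limit[OF density3_integrable])
    fix x :: "nat \<Rightarrow> 'a" assume "x \<in> space (Tup 3)"
    then have "indicator ({..<3} \<rightarrow>\<^sub>E ball 0 l) x = (indicator (window3 l) (x 0, (x 0 - x 1, x 1 - x 2)) :: real)"
      by (auto simp: Tup_ball_iff indicator_def window3_def numeral_3_eq_3 numeral_2_eq_2 All_less_Suc)
    then show "?G x * indicator ({..<3} \<rightarrow>\<^sub>E ball 0 l) x * \<rho> 3 x =
      (case (x 0, (x 0 - x 1, x 1 - x 2)) of (x, y) \<Rightarrow> indicator (window3 l) (x, y) * density3 y)"
      by (simp add: rho_formulas(2)[of \<rho>, OF det] density3_def)
  qed
  have "has_bochner_integral M (\<lambda>\<gamma>. \<Sum>x\<in>distinct_tuples 3 (\<gamma> \<inter> ball 0 l). ?G x)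
    (LINT x|Tup 3. ?G x * indicator ({..<3} \<rightarrow>\<^sub>E ball 0 l) x * \<rho> 3 x)"
    by (rule campbell_integral[OF M \<rho> _ _ _ Gm]) (use H in \<open>auto simp: has_bochner_integral_iff\<close>)
  also have "(LINT x|Tup 3. ?G x * indicator ({..<3} \<rightarrow>\<^sub>E ball 0 l) x * \<rho> 3 x) = (LINT (x, y)|lborel. indicator (window3 l) (x, y) * density3 y)"
    using H by (simp add: has_bochner_integral_iff)
  finally show ?thesis
    using sum_distinct_tuples_3[OF finite_configuration[OF M _ bounded_ball], of _ "\<lambda>a b c. v (a - b) * v (b - c)"]
    by (subst (asm) has_bochner_integral_cong[OF refl _ refl]) auto
qed

text \<open>The truncated part of the four-point correlation gives the first summand, the product of
  the two \<open>rho2\<close> the squared mean.\<close>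

lemma quadruple_sum_integral:
  "has_bochner_integral M (\<lambda>\<gamma>. \<Sum>a\<in>\<gamma> \<inter> ball 0 l. \<Sum>b\<in>\<gamma> \<inter> ball 0 l - {a}. \<Sum>c\<in>\<gamma> \<inter> ball 0 l - {a, b}. \<Sum>d\<in>\<gamma> \<inter> ball 0 l - {a, b, c}. v (a - b) * v (c - d))
    ((LINT (x, y)|lborel. indicator (window4 l) (x, y) * density4 y) + (LINT (x, a)|lborel. indicator (window2 l) (x, a) * (v a * rho2 a))\<^sup>2)"
proof -
  let ?G = "\<lambda>x :: nat \<Rightarrow> 'a. v (x 0 - x 1) * v (x 2 - x 3)"
  let ?\<psi> = "\<lambda>x :: nat \<Rightarrow> 'a. (x 0, ((x 0 - x 1, x 2 - x 3), x 0 - x 2))"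
  let ?f = "\<lambda>(x, y). indicator (window4 l) (x, y) * (case y of ((a, b), z) \<Rightarrow> v a * v b * (rho2 a * rho2 b)) :: real"
  let ?g = "\<lambda>(x, y). indicator (window4 l) (x, y) * density4 y"
  let ?I = "(LINT x|lborel. ?g x) + (LINT x|lborel. ?f x)"
  have Gm: "?G \<in> borel_measurable (Tup 4)" by measurable
  have i: "integrable lborel ?f" "integrable lborel ?g"
    by (rule mean_square, rule window4_limit[OF density4_integrable])
  have "has_bochner_integral (Tup 4) (\<lambda>x. ?G x * indicator ({..<4} \<rightarrow>\<^sub>E ball 0 l) x * \<rho> 4 x) (LINT x|lborel. ?g x + ?f x)"
  proof (rule has_bochner_integral_lborel_distr[OF distr_Tup_4])
    show "?\<psi> \<in> measurable (Tup 4) borel" by measurable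
    show "integrable lborel (\<lambda>x. ?g x + ?f x)"
      using i by (intro Bochner_Integration.integrable_add)
    fix x :: "nat \<Rightarrow> 'a" assume x: "x \<in> space (Tup 4)"
    have four: "(\<forall>i<4. P i) \<longleftrightarrow> P 0 \<and> P 1 \<and> P 2 \<and> P (3 :: nat)" for P
      by (auto simp: less_Suc_eq numeral_eq_Suc)
    have "indicator ({..<4} \<rightarrow>\<^sub>E ball 0 l) x = (indicator (window4 l) (?\<psi> x) :: real)"
      using x by (auto simp: Tup_ball_iff indicator_def window4_def four)
    then show "?G x * indicator ({..<4} \<rightarrow>\<^sub>E ball 0 l) x * \<rho> 4 x = ?g (?\<psi> x) + ?f (?\<psi> x)"
      by (simp add: rho_formulas(3)[of \<rho>, OF det] density4_def algebra_simps)
  qed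
  then have H: "has_bochner_integral (Tup 4) (\<lambda>x. ?G x * indicator ({..<4} \<rightarrow>\<^sub>E ball 0 l) x * \<rho> 4 x) ?I"
    using Bochner_Integration.integral_add[OF i(2,1)] by simp
  have "has_bochner_integral M (\<lambda>\<gamma>. \<Sum>x\<in>distinct_tuples 4 (\<gamma> \<inter> ball 0 l). ?G x)
    (LINT x|Tup 4. ?G x * indicator ({..<4} \<rightarrow>\<^sub>E ball 0 l) x * \<rho> 4 x)"
    by (rule campbell_integral[OF M \<rho> _ _ _ Gm]) (use H in \<open>auto simp: has_bochner_integral_iff\<close>)
  also have "(LINT x|Tup 4. ?G x * indicator ({..<4} \<rightarrow>\<^sub>E ball 0 l) x * \<rho> 4 x) = ?I"
    using H by (simp add: has_bochner_integral_iff)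
  finally have "has_bochner_integral M (\<lambda>\<gamma>. \<Sum>x\<in>distinct_tuples 4 (\<gamma> \<inter> ball 0 l). ?G x) ?I" .
  then show ?thesis
    unfolding mean_square(2)
    using sum_distinct_tuples_4[OF finite_configuration[OF M _ bounded_ball], of _ "\<lambda>a b c d. v (a - b) * v (c - d)"]
    by (subst (asm) has_bochner_integral_cong[OF refl _ refl]) auto
qed

lemma energy_integral:
  "has_bochner_integral M (pair_energy v (ball 0 l)) (LINT (x, a)|lborel. indicator (window2 l) (x, a) * (v a * rho2 a))"
  using pair_sum_integral[OF v_borel v_rho2_integrable, of l]
  by (subst has_bochner_integral_cong[OF refl pair_energy_finite refl])
     (auto intro: finite_configuration[OF M])

lemma energy_square_integral:
  "has_bochner_integral M (\<lambda>\<gamma>. (pair_energy v (ball 0 l) \<gamma>)\<^sup>2)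
    ((LINT (x, y)|lborel. indicator (window4 l) (x, y) * density4 y) + (LINT (x, a)|lborel. indicator (window2 l) (x, a) * (v a * rho2 a))\<^sup>2
     + 4 * (LINT (x, y)|lborel. indicator (window3 l) (x, y) * density3 y) + 2 * (LINT (x, a)|lborel. indicator (window2 l) (x, a) * density2 a))"
proof -
  have sq: "has_bochner_integral M (\<lambda>\<gamma>. \<Sum>a\<in>\<gamma> \<inter> ball 0 l. \<Sum>b\<in>\<gamma> \<inter> ball 0 l - {a}. (v (a - b))\<^sup>2)
     (LINT (x, a)|lborel. indicator (window2 l) (x, a) * density2 a)"
    unfolding density2_def by (rule pair_sum_integral) (use density2_integrable in \<open>auto simp: density2_def\<close>)
  have sym: "v (a - b) = v (b - a)" for a b using v_even[of "a - b"] by simp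
  have eq: "(pair_energy v (ball 0 l) \<gamma>)\<^sup>2 =
    (\<Sum>a\<in>\<gamma> \<inter> ball 0 l. \<Sum>b\<in>\<gamma> \<inter> ball 0 l - {a}. \<Sum>c\<in>\<gamma> \<inter> ball 0 l - {a, b}. \<Sum>d\<in>\<gamma> \<inter> ball 0 l - {a, b, c}. v (a - b) * v (c - d)) +
    4 * (\<Sum>a\<in>\<gamma> \<inter> ball 0 l. \<Sum>b\<in>\<gamma> \<inter> ball 0 l - {a}. \<Sum>c\<in>\<gamma> \<inter> ball 0 l - {a, b}. v (a - b) * v (b - c)) +
    2 * (\<Sum>a\<in>\<gamma> \<inter> ball 0 l. \<Sum>b\<in>\<gamma> \<inter> ball 0 l - {a}. (v (a - b))\<^sup>2)" if "\<gamma> \<in> space M" for \<gamma>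
  proof -
    have fin: "finite (\<gamma> \<inter> ball 0 l)" by (rule finite_configuration[OF M that bounded_ball])
    show ?thesis
      unfolding pair_energy_finite[OF fin] by (rule square_pair_sum[OF fin sym])
  qed
  show ?thesis
    by (subst has_bochner_integral_cong[OF refl eq refl], assumption)
       (intro has_bochner_integral_add has_bochner_integral_mult_right quadruple_sum_integral triple_sum_integral sq)
qed

text \<open>The squared mean cancels exactly; each of the three remaining window integrals, divided
  by the volume, tends to the integral of its density.\<close>

theorem variance_limit:
  "((\<lambda>l. prob_space.variance M (pair_energy v (ball 0 l)) / measure lborel (ball (0 :: 'a) l)) \<longlongrightarrow> limit_variance) at_top"
proof -
  interpret prob_space M using M by (simp add: point_process_def)
  let ?I4 = "\<lambda>l. LINT (x, y)|lborel. indicator (window4 l) (x, y) * density4 y"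
  let ?I3 = "\<lambda>l. LINT (x, y)|lborel. indicator (window3 l) (x, y) * density3 y"
  let ?I2 = "\<lambda>l. LINT (x, a)|lborel. indicator (window2 l) (x, a) * density2 a"
  let ?m = "\<lambda>l. measure lborel (ball (0 :: 'a) l)"
  have "variance (pair_energy v (ball 0 l)) = ?I4 l + 4 * ?I3 l + 2 * ?I2 l" for l
    using energy_integral[of l] energy_square_integral[of l]
    by (subst variance_eq) (auto simp: has_bochner_integral_iff)
  then have "(\<lambda>l. variance (pair_energy v (ball 0 l)) / ?m l) = (\<lambda>l. ?I4 l / ?m l + 4 * (?I3 l / ?m l) + 2 * (?I2 l / ?m l))"
    by (simp add: add_divide_distrib)
  moreover have "((\<lambda>l. ?I4 l / ?m l + 4 * (?I3 l / ?m l) + 2 * (?I2 l / ?m l)) \<longlongrightarrow>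
     (LINT x|lborel. density4 x) + 4 * (LINT x|lborel. density3 x) + 2 * (LINT x|lborel. density2 x)) at_top"
    by (intro tendsto_intros window4_limit(2) window3_limit(2) window2_limit(2) density2_integrable density3_integrable density4_integrable)
  ultimately show ?thesis by (simp only: limit_variance_assembled)
qed

end

end

section \<open>Lebesgue measurable data\<close>

text \<open>This supplies the measurability of the pair energy of a merely Lebesgue measurable
  \<open>v\<close> with respect to the completed process.\<close>

lemma (in complete_measure) borel_measurable_AE_cong:
  fixes f g :: "'a \<Rightarrow> real"
  assumes [measurable]: "f \<in> borel_measurable M" and ae: "AE x in M. f x = g x"
  shows "g \<in> borel_measurable M"
proof (rule measurableI)
  fix B :: "real set" assume "B \<in> sets borel"
  then have f: "f -` B \<inter> space M \<in> sets M" by measurable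
  show "g -` B \<inter> space M \<in> sets M"
  proof (rule in_sets_AE[OF _ f])
    show "AE x in M. x \<in> f -` B \<inter> space M \<longleftrightarrow> x \<in> g -` B \<inter> space M"
      using ae by eventually_elim auto
  qed auto
qed simp

lemma AE_lborel_uminus:
  assumes "AE x :: 'a::euclidean_space in lborel. P x"
  shows "AE x in lborel. P (- x)"
proof -
  have "AE x in distr lborel borel uminus. P (x :: 'a)"
    by (subst distr_lborel_uminus) (rule assms)
  then show ?thesis by (rule AE_distrD[rotated]) simp
qed

lemma symmetric_borel_version:
  fixes E :: "'a::euclidean_space set"
  assumes E: "E \<in> sets lebesgue" and sym: "uminus ` E = E"
  obtains F where "F \<in> sets borel" "\<And>x. - x \<in> F \<longleftrightarrow> x \<in> F" "AE x in lborel. x \<in> F \<longleftrightarrow> x \<in> E"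
proof -
  obtain S N N' where S: "E = S \<union> N" "N \<subseteq> N'" "N' \<in> null_sets lborel" "S \<in> sets lborel"
    using E by (rule sets_completionE)
  have [measurable]: "S \<in> sets borel" using S(4) by simp
  have Esym: "- x \<in> E \<longleftrightarrow> x \<in> E" for x
    using sym by (metis imageI minus_minus)
  \<comment> \<open>The Borel part \<open>S\<close> of \<open>E\<close> need not be symmetric, so it
    is intersected with its reflection; symmetry of \<open>E\<close> makes the loss a null
    set.\<close>
  define F where "F = {x. x \<in> S \<and> - x \<in> S}"
  have "F \<in> sets borel" unfolding F_def by measurable
  moreover have "- x \<in> F \<longleftrightarrow> x \<in> F" for x by (auto simp: F_def)
  moreover have n: "AE x in lborel. x \<notin> N'" using S(3) by (rule AE_not_in)
  have "AE x in lborel. x \<in> F \<longleftrightarrow> x \<in> E"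
    using n AE_lborel_uminus[OF n]
  proof eventually_elim
    case (elim x)
    then have "x \<in> E \<longleftrightarrow> x \<in> S" "- x \<in> E \<longleftrightarrow> - x \<in> S" using S by auto
    then show ?case using Esym[of x] by (auto simp: F_def)
  qed
  ultimately show ?thesis using that by blast
qed

lemma even_borel_version:
  fixes v :: "'a::euclidean_space \<Rightarrow> real"
  assumes v: "v \<in> borel_measurable lebesgue" and even: "\<And>x. v (- x) = v x"
  obtains u where "u \<in> borel_measurable borel" "\<And>x. u (- x) = u x" "AE x in lborel. v x = u x"
proof -
  obtain w where w: "w \<in> borel_measurable lborel" "AE x in lborel. v x = w x"
    using completion_ex_borel_measurable_real[OF v] by blast
  have [measurable]: "w \<in> borel_measurable borel" using w(1) by simp
  \<comment> \<open>Averaging with the reflection restores evenness at every point and, as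
    \<open>v\<close> is even, alters nothing almost everywhere.\<close>
  define u where "u x = (w x + w (- x)) / 2" for x
  have "u \<in> borel_measurable borel" unfolding u_def by measurable
  moreover have "u (- x) = u x" for x by (simp add: u_def)
  moreover have "AE x in lborel. v x = u x"
    using w(2) AE_lborel_uminus[OF w(2)] by eventually_elim (simp add: u_def even)
  ultimately show ?thesis using that by blast
qed

lemma integrable_lborel_AE_cong:
  fixes f g :: "'a::euclidean_space \<Rightarrow> real"
  assumes f: "integrable lebesgue f" and [measurable]: "g \<in> borel_measurable borel" and ae: "AE x in lborel. f x = g x"
  shows "integrable lborel g"
proof -
  have g: "g \<in> borel_measurable lborel" by simp
  have "AE x in lebesgue. f x = g x" using ae by (rule AE_completion)
  then have "integrable lebesgue g"
    by (rule integrable_cong_AE_imp[OF f measurable_completion[OF g]])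
  then show ?thesis using integrable_completion[OF g] by simp
qed

text \<open>By the two-point Campbell formula the expected number of pairs with difference in
  \<open>Z\<close> is an integral over a null set. So a null set of differences is almost surely
  avoided, although the energy evaluates \<open>v\<close> at individual points.\<close>

lemma AE_pair_differences:
  fixes M :: "'a::euclidean_space set measure"
  assumes M: "point_process M" and \<rho>: "has_correlation_functions M \<rho>"
    and L: "L \<in> sets borel" "bounded L" and Z: "Z \<in> null_sets lborel"
  shows "AE \<gamma> in M. \<forall>a\<in>\<gamma> \<inter> L. \<forall>b\<in>\<gamma> \<inter> L - {a}. a - b \<notin> Z"
proof -
  have [measurable]: "Z \<in> sets borel" using Z by auto
  let ?G = "\<lambda>x :: nat \<Rightarrow> 'a. indicator Z (x 0 - x 1) :: ennreal"
  have Gm: "?G \<in> borel_measurable (Tup 2)" by measurable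
  have m: "(\<lambda>x. (x 0, x 0 - x 1)) \<in> measurable (Tup 2) (borel :: ('a \<times> 'a) measure)" by measurable
  have "(\<integral>\<^sup>+x. ?G x \<partial>Tup 2) = (\<integral>\<^sup>+y. indicator Z (snd y) \<partial>distr (Tup 2) borel (\<lambda>x. (x 0, x 0 - x 1)))"
    by (subst nn_integral_distr[OF m]) auto
  also have "\<dots> = (\<integral>\<^sup>+y. indicator Z (snd y) \<partial>(lborel :: ('a \<times> 'a) measure))"
    by (simp only: distr_Tup_2)
  also have "\<dots> = (\<integral>\<^sup>+x. \<integral>\<^sup>+a. indicator Z (snd (x :: 'a, a)) \<partial>lborel \<partial>lborel)"
    by (rule nn_integral_lborel_pair) measurable
  also have "\<dots> = 0" using null_setsD1[OF Z] by simp
  finally have "AE x in Tup 2. ?G x = 0"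
    using Gm by (simp add: nn_integral_0_iff_AE)
  then have "(\<integral>\<^sup>+x. ?G x * indicator ({..<2} \<rightarrow>\<^sub>E L) x * ennreal (\<rho> 2 x) \<partial>Tup 2) = (\<integral>\<^sup>+x. 0 \<partial>(Tup 2 :: (nat \<Rightarrow> 'a) measure))"
    by (intro nn_integral_cong_AE) (auto elim!: eventually_mono)
  then have "(\<integral>\<^sup>+\<gamma>. (\<Sum>x\<in>distinct_tuples 2 (\<gamma> \<inter> L). ?G x) \<partial>M) = 0"
    by (subst campbell_nn_integral[OF M \<rho> _ L Gm]) auto
  then have "AE \<gamma> in M. (\<Sum>x\<in>distinct_tuples 2 (\<gamma> \<inter> L). ?G x) = 0"
    by (subst (asm) nn_integral_0_iff_AE[OF measurable_sum_distinct_tuples[OF M L Gm]])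
  then show ?thesis
  proof (rule AE_mp, intro AE_I2 impI)
    fix \<gamma> assume \<gamma>: "\<gamma> \<in> space M" and "(\<Sum>x\<in>distinct_tuples 2 (\<gamma> \<inter> L). ?G x) = 0"
    then have "(\<Sum>a\<in>\<gamma> \<inter> L. \<Sum>b\<in>\<gamma> \<inter> L - {a}. indicator Z (a - b) :: ennreal) = 0"
      using sum_distinct_tuples_2[OF finite_configuration[OF M \<gamma> L(2)], of "\<lambda>a b. indicator Z (a - b) :: ennreal"] by simp
    then show "\<forall>a\<in>\<gamma> \<inter> L. \<forall>b\<in>\<gamma> \<inter> L - {a}. a - b \<notin> Z"
      using finite_configuration[OF M \<gamma> L(2)] by (auto simp: indicator_eq_0_iff)
  qed
qed

text \<open>Almost surely all differences within \<open>L\<close> avoid the null set where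
  \<open>v\<close> and \<open>u\<close> differ, so the energies coincide and the variance can be
  computed for the Borel function.\<close>

lemma energy_variance_AE_cong:
  fixes M :: "'a::euclidean_space set measure"
  assumes M: "point_process M" and \<rho>: "has_correlation_functions M \<rho>"
    and L: "L \<in> sets borel" "bounded L" and ae: "AE x in lborel. v x = u x"
    and um [measurable]: "pair_energy u L \<in> borel_measurable M"
  shows "energy_variance M v L = prob_space.variance M (pair_energy u L)"
proof -
  obtain Z where Z: "Z \<in> null_sets lborel" "{x. v x \<noteq> u x} \<subseteq> Z"
    using ae by (auto simp: eventually_ae_filter)
  have "AE \<gamma> in M. pair_energy u L \<gamma> = pair_energy v L \<gamma>"
    using AE_pair_differences[OF M \<rho> L Z(1)]
  proof (rule AE_mp, intro AE_I2 impI)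
    fix \<gamma> assume \<gamma>: "\<gamma> \<in> space M" and d: "\<forall>a\<in>\<gamma> \<inter> L. \<forall>b\<in>\<gamma> \<inter> L - {a}. a - b \<notin> Z"
    have fin: "finite (\<gamma> \<inter> L)" by (rule finite_configuration[OF M \<gamma> L(2)])
    have "v (a - b) = u (a - b)" if "a \<in> \<gamma> \<inter> L" "b \<in> \<gamma> \<inter> L - {a}" for a b
    proof -
      have "a - b \<notin> Z" using d that by blast
      then show ?thesis using Z(2) by auto
    qed
    then show "pair_energy u L \<gamma> = pair_energy v L \<gamma>"
      unfolding pair_energy_finite[OF fin] by (intro sum.cong refl) auto
  qed
  then have eq: "AE \<gamma> in completion M. pair_energy u L \<gamma> = pair_energy v L \<gamma>"
    by (rule AE_completion)
  have uc [measurable]: "pair_energy u L \<in> borel_measurable (completion M)"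
    by (rule measurable_completion[OF um])
  have vc [measurable]: "pair_energy v L \<in> borel_measurable (completion M)"
    by (rule completion.borel_measurable_AE_cong[OF uc eq])
  have mean: "(LINT \<gamma>|completion M. pair_energy v L \<gamma>) = (LINT \<gamma>|M. pair_energy u L \<gamma>)"
  proof -
    have "(LINT \<gamma>|completion M. pair_energy v L \<gamma>) = (LINT \<gamma>|completion M. pair_energy u L \<gamma>)"
      using eq by (intro integral_cong_AE vc uc) auto
    then show ?thesis by (simp add: integral_completion)
  qed
  have "energy_variance M v L = (LINT \<gamma>|completion M. (pair_energy v L \<gamma> - (LINT \<gamma>|M. pair_energy u L \<gamma>))\<^sup>2)"
    by (simp add: energy_variance_def mean)
  also have "\<dots> = (LINT \<gamma>|completion M. (pair_energy u L \<gamma> - (LINT \<gamma>|M. pair_energy u L \<gamma>))\<^sup>2)"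
    using eq by (intro integral_cong_AE) auto
  also have "\<dots> = (LINT \<gamma>|M. (pair_energy u L \<gamma> - (LINT \<gamma>|M. pair_energy u L \<gamma>))\<^sup>2)"
    by (rule integral_completion) measurable
  finally show ?thesis .
qed

lemma fourier_kernel_AE_cong:
  fixes E F :: "'a::euclidean_space set"
  assumes E: "E \<in> sets lebesgue" and F [measurable]: "F \<in> sets borel" and ae: "AE x in lborel. x \<in> F \<longleftrightarrow> x \<in> E"
  shows "fourier_kernel E x = fourier (\<lambda>y. indicator F y) x"
proof -
  let ?f = "\<lambda>\<xi>. indicator F \<xi> *\<^sub>R ee (x \<bullet> \<xi>)"
  have fm: "?f \<in> borel_measurable lborel" by measurable
  have em: "(\<lambda>\<xi>. ee (x \<bullet> \<xi>)) \<in> borel_measurable lborel" by measurable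
  have "fourier_kernel E x = (LINT \<xi>|lebesgue. indicator E \<xi> *\<^sub>R ee (x \<bullet> \<xi>))"
    unfolding fourier_kernel_def set_lebesgue_integral_def ee_exp ..
  also have "\<dots> = (LINT \<xi>|lebesgue. ?f \<xi>)"
  proof (rule integral_cong_AE)
    show "(\<lambda>\<xi>. indicator E \<xi> *\<^sub>R ee (x \<bullet> \<xi>)) \<in> borel_measurable lebesgue"
      using E measurable_completion[OF em] by (intro borel_measurable_scaleR borel_measurable_indicator)
    show "?f \<in> borel_measurable lebesgue" by (rule measurable_completion[OF fm])
    show "AE \<xi> in lebesgue. indicator E \<xi> *\<^sub>R ee (x \<bullet> \<xi>) = ?f \<xi>"
      using AE_completion[OF ae] by eventually_elim (auto simp: indicator_def)
  qed
  also have "\<dots> = (LINT \<xi>|lborel. ?f \<xi>)" by (rule integral_completion[OF fm])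
  also have "\<dots> = fourier (\<lambda>y. indicator F y) x"
    unfolding fourier_def by (intro Bochner_Integration.integral_cong refl) (auto simp: indicator_def)
  finally show ?thesis .
qed

theorem theorem4p2:
  fixes E :: "'a::euclidean_space set" and M :: "'a set measure" and v :: "'a \<Rightarrow> real"
  assumes "E \<in> sets lebesgue"
    and "uminus ` E = E"
    and "emeasure lebesgue E = 1"
    and "determinantal_point_process (\<lambda>x y. fourier_kernel E (x - y)) M"
    and "integrable lebesgue v"
    and "integrable lebesgue (\<lambda>x. (v x)\<^sup>2)"
    and "\<forall>x. v (- x) = v x"
    and "\<not> (AE x in lebesgue. v x = 0)"
  shows "\<exists>c>0. ((\<lambda>l. energy_variance M v (ball 0 l) / measure lebesgue (ball (0 :: 'a) l))
    \<longlongrightarrow> c) at_top"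
proof -
  obtain F where F: "F \<in> sets borel" "\<And>x. - x \<in> F \<longleftrightarrow> x \<in> F" "AE x in lborel. x \<in> F \<longleftrightarrow> x \<in> E"
    using symmetric_borel_version[OF assms(1,2)] by blast
  obtain u where u: "u \<in> borel_measurable borel" "\<And>x. u (- x) = u x" "AE x in lborel. v x = u x"
    using even_borel_version[of v] assms(5,7) by blast
  have "emeasure lborel F = emeasure lebesgue F"
    using F(1) by (simp add: emeasure_completion)
  also have "\<dots> = emeasure lebesgue E"
    using AE_completion[OF F(3)] F(1) assms(1) by (intro emeasure_eq_AE) auto
  finally have "emeasure lborel F = 1" using assms(3) by simp
  moreover have "integrable lborel u"
    by (rule integrable_lborel_AE_cong[OF assms(5) u(1,3)])
  moreover have "integrable lborel (\<lambda>x. (u x)\<^sup>2)"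
    by (rule integrable_lborel_AE_cong[OF assms(6)]) (use u in \<open>auto elim: eventually_mono\<close>)
  \<comment> \<open>From here on \<open>K\<close> and \<open>limit_variance\<close> belong to the
    Borel versions \<open>F\<close> and \<open>u\<close>; the process stays the same, because the
    kernels of \<open>E\<close> and \<open>F\<close> agree.\<close>
  ultimately interpret even_potential F u
    using F u by unfold_locales auto
  have ker: "fourier_kernel E x = of_real (K x)" for x
    using fourier_kernel_AE_cong[OF assms(1) F(1,3)] by (simp add: fourier_indicator_eq)
  obtain \<rho> where M: "point_process M" and \<rho>: "has_correlation_functions M \<rho>"
    and det: "\<And>n x. n \<ge> 1 \<Longrightarrow> complex_of_real (\<rho> n x) =
      Determinant.det (Matrix.mat n n (\<lambda>(i, j). complex_of_real (K (x i - x j))))"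
    using assms(4) unfolding determinantal_point_process_def ker by blast
  have "energy_variance M v (ball 0 l) = prob_space.variance M (pair_energy u (ball 0 l))" for l
    by (rule energy_variance_AE_cong[OF M \<rho> _ _ u(3)])
       (use energy_integral[OF M \<rho> det, of l] in \<open>auto simp: has_bochner_integral_iff\<close>)
  then have "((\<lambda>l. energy_variance M v (ball 0 l) / measure lebesgue (ball (0 :: 'a) l)) \<longlongrightarrow> limit_variance) at_top"
    using variance_limit[OF M \<rho> det] by simp
  moreover have "limit_variance > 0"
  proof (rule limit_variance_pos)
    show "\<not> (AE x in lborel. u x = 0)"
    proof
      assume "AE x in lborel. u x = 0"
      then have "AE x in lborel. v x = 0" using u(3) by eventually_elim simp
      with assms(8) show False using AE_completion by blast
    qed
  qed
  ultimately show ?thesis by blast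
qed

end
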